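(* If $\theta\in\mathbb R$ is irrational, the bornological noncommutative torus $\mathcal A_\theta$ is simple.
   Context: Bornology. A bornology on a set is a collection of subsets (called bounded) closed under passing to subsets and under finite unions and containing all singletons. A complex bornological vector space is a complex vector space with a bornology such that for bounded $A,B$ and scalars $\lambda$ the sets $A+B$, $\lambda A$ and $\{\mu a: |\mu|\le 1, a\in A\}$ are bounded. A linear map is bounded if it maps bounded sets to bounded sets. A disk is a convex subset $D$ with $\mu D\subset D$ for all $|\mu|\le 1$; its span $V_D$ carries the seminorm $\|v\|_D=\inf\{r>0: v\in rD\}$; $D$ is completant if $\|\cdot\|_D$ is a norm and $V_D$ is complete. A bornological vector space is complete if every bounded set is contained in a bounded completant disk. $\mathrm{cBorn}$ is the category of complete bornological vector spaces and bounded linear maps; $V\hat\otimes W$ is the complete bornological vector space representing bounded bilinear maps from $V\times W$ to complete bornological vector spaces. Algebras in $\mathrm{cBorn}$ are associative, not necessarily unital. $M\hat\otimes_A N$ is the coequalizer in $\mathrm{cBorn}$ of the two action maps $M\hat\otimes A\hat\otimes N\rightrightarrows M\hat\otimes N$. An $A$-$A$-bimodule $M$ in $\mathrm{cBorn}$ is smooth if $A\hat\otimes_AM\to M$ and $M\hat\otimes_AA\to M$ are isomorphisms; $A$ is self-induced if it is smooth over itself. Ideals. An ideal of a self-induced complete bornological algebra $A$ is a strong subobject of $A$ (i.e. one represented by a strong monomorphism) in the category of smooth $A$-$A$-bimodules in $\mathrm{cBorn}$; in other words, a closed subspace $I\subset A$ (equipped with the subspace bornology) with $AI\subset I$, $IA\subset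 I$ that is smooth as an $A$-$A$-bimodule. (A subspace is closed if it is closed under limits of Mackey convergent sequences; $v_n\to v$ in the sense of Mackey if $\|v_n-v\|_D\to0$ for some bounded disk $D$ with $v_n,v\in V_D$.) $A$ is simple if $0$ and $A$ are its only ideals. The noncommutative torus. Let $S^1=\mathbb R/\mathbb Z$ and let $\mathbb Z$ act on $S^1$ by $k\cdot[r]=[r+k\theta]$. $\mathcal A_\theta=A(\mathbb Z\ltimes S^1)$ is the complete bornological convolution algebra of the action groupoid (with counting measure as Haar system): $\mathcal A_\theta=C_c^\infty(\mathbb Z\times S^1)$ (complex-valued functions), where a set is bounded if its elements have common compact support and all derivatives are uniformly bounded, with product $(a*b)(k,x)=\sum_{j\in\mathbb Z}a(k-j,\,j\cdot x)\,b(j,x)$. *)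

theory Defs
  imports "HOL-Analysis.Analysis" "HOL-Algebra.Module" "HOL-Algebra.AbelCoset"
begin

section \<open>Complete bornological vector spaces\<close>

definition complex_ring :: "complex ring" where
  "complex_ring = \<lparr>carrier = UNIV, mult = (*), one = 1, zero = 0, add = (+)\<rparr>"

text \<open>
  Library modules extend rings, so the record carries a multiplication and a unit.  The
  multiplication is used when the space is an algebra and is otherwise irrelevant; the unit is
  never used, since algebras need not be unital.
\<close>

record 'a born_space = "(complex, 'a) module" +
  bornology :: "'a set set"

definition is_bornology :: "'a set \<Rightarrow> 'a set set \<Rightarrow> bool" where
  "is_bornology X \<B> \<longleftrightarrow> \<B> \<subseteq> Pow X \<and> {} \<in> \<B> \<and> (\<forall>x\<in>X. {x} \<in> \<B>)
     \<and> (\<forall>B\<in>\<B>. \<forall>A. A \<subseteq> B \<longrightarrow> A \<in> \<B>) \<and> (\<forall>A\<in>\<B>. \<forall>B\<in>\<B>. A \<union> B \<in> \<B>)"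

definition born_vector_space :: "('a, 'm) born_space_scheme \<Rightarrow> bool" where
  "born_vector_space V \<longleftrightarrow> Module.module complex_ring V
     \<and> is_bornology (carrier V) (bornology V)
     \<and> (\<forall>A\<in>bornology V. \<forall>B\<in>bornology V. {a \<oplus>\<^bsub>V\<^esub> b |a b. a \<in> A \<and> b \<in> B} \<in> bornology V)
     \<and> (\<forall>A\<in>bornology V. \<forall>c. {c \<odot>\<^bsub>V\<^esub> a |a. a \<in> A} \<in> bornology V)
     \<and> (\<forall>A\<in>bornology V. {c \<odot>\<^bsub>V\<^esub> a |c a. cmod c \<le> 1 \<and> a \<in> A} \<in> bornology V)"

definition bounded_linear_map ::
  "('a, 'm) born_space_scheme \<Rightarrow> ('b, 'n) born_space_scheme \<Rightarrow> ('a \<Rightarrow> 'b) \<Rightarrow> bool" where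
  "bounded_linear_map V W f \<longleftrightarrow> f \<in> carrier V \<rightarrow> carrier W
     \<and> (\<forall>x\<in>carrier V. \<forall>y\<in>carrier V. f (x \<oplus>\<^bsub>V\<^esub> y) = f x \<oplus>\<^bsub>W\<^esub> f y)
     \<and> (\<forall>c. \<forall>x\<in>carrier V. f (c \<odot>\<^bsub>V\<^esub> x) = c \<odot>\<^bsub>W\<^esub> f x)
     \<and> (\<forall>B\<in>bornology V. f ` B \<in> bornology W)"

definition bounded_bilinear_map ::
  "('a, 'm) born_space_scheme \<Rightarrow> ('b, 'n) born_space_scheme \<Rightarrow> ('c, 'k) born_space_scheme
     \<Rightarrow> ('a \<Rightarrow> 'b \<Rightarrow> 'c) \<Rightarrow> bool" where
  "bounded_bilinear_map V W X f \<longleftrightarrow> (\<forall>v\<in>carrier V. \<forall>w\<in>carrier W. f v w \<in> carrier X)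
     \<and> (\<forall>v\<in>carrier V. \<forall>v'\<in>carrier V. \<forall>w\<in>carrier W. f (v \<oplus>\<^bsub>V\<^esub> v') w = f v w \<oplus>\<^bsub>X\<^esub> f v' w)
     \<and> (\<forall>v\<in>carrier V. \<forall>w\<in>carrier W. \<forall>w'\<in>carrier W. f v (w \<oplus>\<^bsub>W\<^esub> w') = f v w \<oplus>\<^bsub>X\<^esub> f v w')
     \<and> (\<forall>c. \<forall>v\<in>carrier V. \<forall>w\<in>carrier W. f (c \<odot>\<^bsub>V\<^esub> v) w = c \<odot>\<^bsub>X\<^esub> f v w)
     \<and> (\<forall>c. \<forall>v\<in>carrier V. \<forall>w\<in>carrier W. f v (c \<odot>\<^bsub>W\<^esub> w) = c \<odot>\<^bsub>X\<^esub> f v w)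
     \<and> (\<forall>A\<in>bornology V. \<forall>B\<in>bornology W. {f a b |a b. a \<in> A \<and> b \<in> B} \<in> bornology X)"

definition born_iso ::
  "('a, 'm) born_space_scheme \<Rightarrow> ('b, 'n) born_space_scheme \<Rightarrow> ('a \<Rightarrow> 'b) \<Rightarrow> bool" where
  "born_iso V W f \<longleftrightarrow> bounded_linear_map V W f \<and>
     (\<exists>g. bounded_linear_map W V g \<and> (\<forall>v\<in>carrier V. g (f v) = v) \<and> (\<forall>w\<in>carrier W. f (g w) = w))"

text \<open>Absolutely convex sets are understood to be nonempty, so that the seminorm below is finite.\<close>

definition disk :: "('a, 'm) born_space_scheme \<Rightarrow> 'a set \<Rightarrow> bool" where
  "disk V D \<longleftrightarrow> D \<subseteq> carrier V \<and> D \<noteq> {}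
     \<and> (\<forall>x\<in>D. \<forall>y\<in>D. \<forall>t\<in>{0..1}. of_real (1 - t) \<odot>\<^bsub>V\<^esub> x \<oplus>\<^bsub>V\<^esub> of_real t \<odot>\<^bsub>V\<^esub> y \<in> D)
     \<and> (\<forall>c. \<forall>x\<in>D. cmod c \<le> 1 \<longrightarrow> c \<odot>\<^bsub>V\<^esub> x \<in> D)"

definition lin_span :: "('a, 'm) born_space_scheme \<Rightarrow> 'a set \<Rightarrow> 'a set" where
  "lin_span V S = \<Inter>{H. submodule H complex_ring V \<and> S \<subseteq> H}"

definition disk_norm :: "('a, 'm) born_space_scheme \<Rightarrow> 'a set \<Rightarrow> 'a \<Rightarrow> real" where
  "disk_norm V D v = Inf {r. 0 < r \<and> (\<exists>d\<in>D. v = of_real r \<odot>\<^bsub>V\<^esub> d)}"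

definition completant :: "('a, 'm) born_space_scheme \<Rightarrow> 'a set \<Rightarrow> bool" where
  "completant V D \<longleftrightarrow> disk V D
     \<and> (\<forall>v\<in>lin_span V D. disk_norm V D v = 0 \<longrightarrow> v = \<zero>\<^bsub>V\<^esub>)
     \<and> (\<forall>s. range s \<subseteq> lin_span V D
            \<and> (\<forall>e>0. \<exists>N. \<forall>m\<ge>N. \<forall>n\<ge>N. disk_norm V D (s m \<ominus>\<^bsub>V\<^esub> s n) < e)
          \<longrightarrow> (\<exists>v\<in>lin_span V D. (\<lambda>n. disk_norm V D (s n \<ominus>\<^bsub>V\<^esub> v)) \<longlonglongrightarrow> 0))"

definition complete_born_space :: "('a, 'm) born_space_scheme \<Rightarrow> bool" where
  "complete_born_space V \<longleftrightarrow> born_vector_space V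
     \<and> (\<forall>B\<in>bornology V. \<exists>D\<in>bornology V. B \<subseteq> D \<and> completant V D)"

definition Mackey_converges ::
  "('a, 'm) born_space_scheme \<Rightarrow> (nat \<Rightarrow> 'a) \<Rightarrow> 'a \<Rightarrow> bool" where
  "Mackey_converges V s v \<longleftrightarrow> (\<exists>D\<in>bornology V. disk V D \<and> range s \<subseteq> lin_span V D \<and> v \<in> lin_span V D
     \<and> (\<lambda>n. disk_norm V D (s n \<ominus>\<^bsub>V\<^esub> v)) \<longlonglongrightarrow> 0)"

definition closed_subspace :: "('a, 'm) born_space_scheme \<Rightarrow> 'a set \<Rightarrow> bool" where
  "closed_subspace V N \<longleftrightarrow> submodule N complex_ring V
     \<and> (\<forall>s v. range s \<subseteq> N \<and> v \<in> carrier V \<and> Mackey_converges V s v \<longrightarrow> v \<in> N)"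

definition closed_span :: "('a, 'm) born_space_scheme \<Rightarrow> 'a set \<Rightarrow> 'a set" where
  "closed_span V S = \<Inter>{N. closed_subspace V N \<and> S \<subseteq> N}"

definition sub_space :: "('a, 'm) born_space_scheme \<Rightarrow> 'a set \<Rightarrow> ('a, 'm) born_space_scheme" where
  "sub_space V N = V\<lparr>carrier := N, bornology := {B \<in> bornology V. B \<subseteq> N}\<rparr>"

definition quotient_space :: "('a, 'm) born_space_scheme \<Rightarrow> 'a set \<Rightarrow> 'a set born_space" where
  "quotient_space V N = \<lparr>carrier = a_rcosets\<^bsub>V\<^esub> N, mult = undefined, one = undefined,
     zero = N, add = set_add V, smult = (\<lambda>c X. \<Union>x\<in>X. N +>\<^bsub>V\<^esub> (c \<odot>\<^bsub>V\<^esub> x)),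
     bornology = {(\<lambda>x. N +>\<^bsub>V\<^esub> x) ` B |B. B \<in> bornology V}\<rparr>"


section \<open>Completed tensor products\<close>

text \<open>
  The completed tensor product is realised as follows.  Absolutely summable families supported on
  a product of bounded sets form the free complete bornological vector space on the set
  \<open>V \<times> W\<close>; dividing by the closed subspace generated by the relations of bilinearity
  gives the complete space that represents bounded bilinear maps.  The representing property is
  proved below, in \<open>complete_tensor_space\<close>, \<open>bounded_bilinear_tensor\<close>,
  \<open>tensor_space_lift\<close> and \<open>tensor_space_ext\<close>, for arguments and test spaces over arbitrary types.
\<close>

definition summable_families ::
  "('a, 'm) born_space_scheme \<Rightarrow> ('b, 'n) born_space_scheme \<Rightarrow> ('a \<times> 'b \<Rightarrow> complex) born_space" where
  "summable_families V W = \<lparr>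
     carrier = {\<xi>. (\<lambda>p. cmod (\<xi> p)) summable_on UNIV \<and>
       (\<exists>D\<in>bornology V. \<exists>E\<in>bornology W. \<forall>p. \<xi> p \<noteq> 0 \<longrightarrow> p \<in> D \<times> E)},
     mult = undefined, one = undefined,
     zero = (\<lambda>p. 0), add = (\<lambda>\<xi> \<eta> p. \<xi> p + \<eta> p), smult = (\<lambda>c \<xi> p. c * \<xi> p),
     bornology = {S. \<exists>D\<in>bornology V. \<exists>E\<in>bornology W. \<exists>C. \<forall>\<xi>\<in>S. (\<lambda>p. cmod (\<xi> p)) summable_on UNIV \<and>
       infsum (\<lambda>p. cmod (\<xi> p)) UNIV \<le> C \<and> (\<forall>p. \<xi> p \<noteq> 0 \<longrightarrow> p \<in> D \<times> E)}\<rparr>"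

abbreviation single :: "'a \<Rightarrow> 'b \<Rightarrow> 'a \<times> 'b \<Rightarrow> complex" where
  "single v w \<equiv> indicator {(v, w)}"

definition bilinear_relations ::
  "('a, 'm) born_space_scheme \<Rightarrow> ('b, 'n) born_space_scheme \<Rightarrow> ('a \<times> 'b \<Rightarrow> complex) set" where
  "bilinear_relations V W =
     {(\<lambda>p. single (v \<oplus>\<^bsub>V\<^esub> v') w p - single v w p - single v' w p) |v v' w.
        v \<in> carrier V \<and> v' \<in> carrier V \<and> w \<in> carrier W} \<union>
     {(\<lambda>p. single v (w \<oplus>\<^bsub>W\<^esub> w') p - single v w p - single v w' p) |v w w'.
        v \<in> carrier V \<and> w \<in> carrier W \<and> w' \<in> carrier W} \<union>
     {(\<lambda>p. single (c \<odot>\<^bsub>V\<^esub> v) w p - c * single v w p) |c v w. v \<in> carrier V \<and> w \<in> carrier W} \<union>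
     {(\<lambda>p. single v (c \<odot>\<^bsub>W\<^esub> w) p - c * single v w p) |c v w. v \<in> carrier V \<and> w \<in> carrier W}"

definition bilinear_kernel ::
  "('a, 'm) born_space_scheme \<Rightarrow> ('b, 'n) born_space_scheme \<Rightarrow> ('a \<times> 'b \<Rightarrow> complex) set" where
  "bilinear_kernel V W = closed_span (summable_families V W) (bilinear_relations V W)"

definition tensor_space ::
  "('a, 'm) born_space_scheme \<Rightarrow> ('b, 'n) born_space_scheme \<Rightarrow> ('a \<times> 'b \<Rightarrow> complex) set born_space" where
  "tensor_space V W = quotient_space (summable_families V W) (bilinear_kernel V W)"

definition tensor ::
  "('a, 'm) born_space_scheme \<Rightarrow> ('b, 'n) born_space_scheme \<Rightarrow> 'a \<Rightarrow> 'b \<Rightarrow> ('a \<times> 'b \<Rightarrow> complex) set" where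
  "tensor V W v w = bilinear_kernel V W +>\<^bsub>summable_families V W\<^esub> single v w"

text \<open>The bounded linear map induced by a bounded bilinear map; unique on the carrier.\<close>

definition tensor_lift ::
  "('a, 'm) born_space_scheme \<Rightarrow> ('b, 'n) born_space_scheme \<Rightarrow> ('c, 'k) born_space_scheme
     \<Rightarrow> ('a \<Rightarrow> 'b \<Rightarrow> 'c) \<Rightarrow> ('a \<times> 'b \<Rightarrow> complex) set \<Rightarrow> 'c" where
  "tensor_lift V W X f = (SOME g. bounded_linear_map (tensor_space V W) X g \<and>
     (\<forall>v\<in>carrier V. \<forall>w\<in>carrier W. g (tensor V W v w) = f v w))"

definition coequalizer_kernel ::
  "('a, 'm) born_space_scheme \<Rightarrow> ('b, 'n) born_space_scheme \<Rightarrow> ('a \<Rightarrow> 'b) \<Rightarrow> ('a \<Rightarrow> 'b) \<Rightarrow> 'b set" where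
  "coequalizer_kernel X Y f g = closed_span Y {f x \<ominus>\<^bsub>Y\<^esub> g x |x. x \<in> carrier X}"

text \<open>
  The two action maps from \<open>(M \<otimes> A) \<otimes> N\<close> to \<open>M \<otimes> N\<close>; here \<open>r\<close> is the right
  action of \<open>A\<close> on \<open>M\<close> and \<open>l\<close> the left action of \<open>A\<close> on \<open>N\<close>.  Their coequalizer
  is a quotient by a closed subspace; its universal property is proved below, in the locale
  \<open>balanced\<close>.
\<close>

definition right_act where
  "right_act M A N r = tensor_lift (tensor_space M A) N (tensor_space M N)
     (\<lambda>t n. tensor M N (tensor_lift M A M r t) n)"

definition left_act where
  "left_act M A N l = tensor_lift (tensor_space M A) N (tensor_space M N)
     (\<lambda>t n. tensor_lift M A (tensor_space M N) (\<lambda>m a. tensor M N m (l a n)) t)"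

definition balanced_kernel where
  "balanced_kernel M A N r l = coequalizer_kernel (tensor_space (tensor_space M A) N)
     (tensor_space M N) (right_act M A N r) (left_act M A N l)"

definition balanced_tensor_space where
  "balanced_tensor_space M A N r l =
     quotient_space (tensor_space M N) (balanced_kernel M A N r l)"

definition balanced_tensor where
  "balanced_tensor M A N r l m n =
     balanced_kernel M A N r l +>\<^bsub>tensor_space M N\<^esub> tensor M N m n"


section \<open>Smooth bimodules, ideals, simple algebras\<close>

definition complete_born_algebra :: "('a, 'm) born_space_scheme \<Rightarrow> bool" where
  "complete_born_algebra A \<longleftrightarrow> complete_born_space A \<and> bounded_bilinear_map A A A (mult A)
     \<and> (\<forall>a\<in>carrier A. \<forall>b\<in>carrier A. \<forall>c\<in>carrier A.
          (a \<otimes>\<^bsub>A\<^esub> b) \<otimes>\<^bsub>A\<^esub> c = a \<otimes>\<^bsub>A\<^esub> (b \<otimes>\<^bsub>A\<^esub> c))"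

definition born_bimodule ::
  "('a, 'm) born_space_scheme \<Rightarrow> ('b, 'n) born_space_scheme \<Rightarrow> ('a \<Rightarrow> 'b \<Rightarrow> 'b) \<Rightarrow> ('b \<Rightarrow> 'a \<Rightarrow> 'b) \<Rightarrow> bool"
where
  "born_bimodule A M l r \<longleftrightarrow> complete_born_algebra A \<and> complete_born_space M
     \<and> bounded_bilinear_map A M M l \<and> bounded_bilinear_map M A M r
     \<and> (\<forall>a\<in>carrier A. \<forall>b\<in>carrier A. \<forall>m\<in>carrier M.
          l (a \<otimes>\<^bsub>A\<^esub> b) m = l a (l b m) \<and> r m (a \<otimes>\<^bsub>A\<^esub> b) = r (r m a) b \<and> r (l a m) b = l a (r m b))"

text \<open>
  The maps from the balanced tensor products to \<open>M\<close> are determined by their values on elementary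
  tensors (lemma \<open>balanced_tensor_ext\<close> below).
\<close>

definition smooth_bimodule ::
  "('a, 'm) born_space_scheme \<Rightarrow> ('b, 'n) born_space_scheme \<Rightarrow> ('a \<Rightarrow> 'b \<Rightarrow> 'b) \<Rightarrow> ('b \<Rightarrow> 'a \<Rightarrow> 'b) \<Rightarrow> bool"
where
  "smooth_bimodule A M l r \<longleftrightarrow> born_bimodule A M l r
     \<and> (\<exists>f. born_iso (balanced_tensor_space A A M (mult A) l) M f
          \<and> (\<forall>a\<in>carrier A. \<forall>m\<in>carrier M. f (balanced_tensor A A M (mult A) l a m) = l a m))
     \<and> (\<exists>f. born_iso (balanced_tensor_space M A A r (mult A)) M f
          \<and> (\<forall>m\<in>carrier M. \<forall>a\<in>carrier A. f (balanced_tensor M A A r (mult A) m a) = r m a))"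

definition self_induced :: "('a, 'm) born_space_scheme \<Rightarrow> bool" where
  "self_induced A \<longleftrightarrow> complete_born_algebra A \<and> smooth_bimodule A A (mult A) (mult A)"

definition born_ideal :: "('a, 'm) born_space_scheme \<Rightarrow> 'a set \<Rightarrow> bool" where
  "born_ideal A I \<longleftrightarrow> self_induced A \<and> closed_subspace A I
     \<and> (\<forall>a\<in>carrier A. \<forall>x\<in>I. a \<otimes>\<^bsub>A\<^esub> x \<in> I \<and> x \<otimes>\<^bsub>A\<^esub> a \<in> I)
     \<and> smooth_bimodule A (sub_space A I) (mult A) (mult A)"

definition simple_born_algebra :: "('a, 'm) born_space_scheme \<Rightarrow> bool" where
  "simple_born_algebra A \<longleftrightarrow> self_induced A \<and> {I. born_ideal A I} = {{\<zero>\<^bsub>A\<^esub>}, carrier A}"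


section \<open>The noncommutative torus\<close>

quotient_type circle = real / "\<lambda>x y :: real. x - y \<in> \<int>"
proof (rule equivpI)
  show "reflp (\<lambda>x y :: real. x - y \<in> \<int>)" by (simp add: reflp_def)
  show "symp (\<lambda>x y :: real. x - y \<in> \<int>)" by (metis (mono_tags, lifting) Ints_minus minus_diff_eq sympI)
  show "transp (\<lambda>x y :: real. x - y \<in> \<int>)"
    by (rule transpI) (metis Ints_add diff_add_cancel add_diff_eq)
qed

lift_definition rotate :: "real \<Rightarrow> int \<Rightarrow> circle \<Rightarrow> circle"
  is "\<lambda>\<theta> k r. r + of_int k * \<theta>"
  by simp

definition nth_derivative :: "nat \<Rightarrow> (real \<Rightarrow> complex) \<Rightarrow> real \<Rightarrow> complex" where
  "nth_derivative n f = ((\<lambda>g t. vector_derivative g (at t)) ^^ n) f"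

definition smooth_fun :: "(real \<Rightarrow> complex) \<Rightarrow> bool" where
  "smooth_fun f \<longleftrightarrow> (\<forall>n t. nth_derivative n f differentiable at t)"

text \<open>
  A subset of \<open>\<int> \<times> S\<^sup>1\<close> is relatively compact if and only if its projection to \<open>\<int>\<close>
  is finite.
\<close>

definition noncommutative_torus :: "real \<Rightarrow> (int \<times> circle \<Rightarrow> complex) born_space" where
  "noncommutative_torus \<theta> = \<lparr>
     carrier = {a. (\<forall>k. smooth_fun (\<lambda>t. a (k, abs_circle t))) \<and> (\<exists>F. finite F \<and> (\<forall>k x. a (k, x) \<noteq> 0 \<longrightarrow> k \<in> F))},
     mult = (\<lambda>a b (k, x). infsum (\<lambda>j. a (k - j, rotate \<theta> j x) * b (j, x)) UNIV),
     one = (\<lambda>(k, x). if k = 0 then 1 else 0),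
     zero = (\<lambda>p. 0), add = (\<lambda>a b p. a p + b p), smult = (\<lambda>c a p. c * a p),
     bornology = {S. (\<forall>a\<in>S. \<forall>k. smooth_fun (\<lambda>t. a (k, abs_circle t)))
       \<and> (\<exists>F. finite F \<and> (\<forall>a\<in>S. \<forall>k x. a (k, x) \<noteq> 0 \<longrightarrow> k \<in> F))
       \<and> (\<forall>n. \<exists>C. \<forall>a\<in>S. \<forall>k t. cmod (nth_derivative n (\<lambda>t. a (k, abs_circle t)) t) \<le> C)}\<rparr>"


section \<open>Elementary properties\<close>

lemma complex_ring_simps [simp]:
  "carrier complex_ring = UNIV" "mult complex_ring = (*)" "one complex_ring = 1"
  "zero complex_ring = 0" "add complex_ring = (+)"
  by (simp_all add: complex_ring_def)

lemma cring_complex_ring: "cring complex_ring"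
proof (rule cringI)
  show "abelian_group complex_ring"
    by (rule abelian_groupI) (auto simp: algebra_simps intro: exI[of _ "- x" for x] add.left_inverse)
  show "comm_monoid complex_ring"
    by (rule comm_monoidI) (auto simp: algebra_simps)
qed (auto simp: algebra_simps)

lemma complex_moduleI:
  assumes "\<And>x y. x \<in> carrier V \<Longrightarrow> y \<in> carrier V \<Longrightarrow> x \<oplus>\<^bsub>V\<^esub> y \<in> carrier V"
    and "\<zero>\<^bsub>V\<^esub> \<in> carrier V"
    and "\<And>x y z. x \<in> carrier V \<Longrightarrow> y \<in> carrier V \<Longrightarrow> z \<in> carrier V \<Longrightarrow> (x \<oplus>\<^bsub>V\<^esub> y) \<oplus>\<^bsub>V\<^esub> z = x \<oplus>\<^bsub>V\<^esub> (y \<oplus>\<^bsub>V\<^esub> z)"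
    and "\<And>x y. x \<in> carrier V \<Longrightarrow> y \<in> carrier V \<Longrightarrow> x \<oplus>\<^bsub>V\<^esub> y = y \<oplus>\<^bsub>V\<^esub> x"
    and "\<And>x. x \<in> carrier V \<Longrightarrow> \<zero>\<^bsub>V\<^esub> \<oplus>\<^bsub>V\<^esub> x = x"
    and "\<And>x. x \<in> carrier V \<Longrightarrow> (-1) \<odot>\<^bsub>V\<^esub> x \<oplus>\<^bsub>V\<^esub> x = \<zero>\<^bsub>V\<^esub>"
    and "\<And>a x. x \<in> carrier V \<Longrightarrow> a \<odot>\<^bsub>V\<^esub> x \<in> carrier V"
    and "\<And>a b x. x \<in> carrier V \<Longrightarrow> (a + b) \<odot>\<^bsub>V\<^esub> x = a \<odot>\<^bsub>V\<^esub> x \<oplus>\<^bsub>V\<^esub> b \<odot>\<^bsub>V\<^esub> x"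
    and "\<And>a x y. x \<in> carrier V \<Longrightarrow> y \<in> carrier V \<Longrightarrow> a \<odot>\<^bsub>V\<^esub> (x \<oplus>\<^bsub>V\<^esub> y) = a \<odot>\<^bsub>V\<^esub> x \<oplus>\<^bsub>V\<^esub> a \<odot>\<^bsub>V\<^esub> y"
    and "\<And>a b x. x \<in> carrier V \<Longrightarrow> (a * b) \<odot>\<^bsub>V\<^esub> x = a \<odot>\<^bsub>V\<^esub> (b \<odot>\<^bsub>V\<^esub> x)"
    and "\<And>x. x \<in> carrier V \<Longrightarrow> 1 \<odot>\<^bsub>V\<^esub> x = x"
  shows "Module.module complex_ring V"
proof (rule moduleI[OF cring_complex_ring])
  show "abelian_group V"
  proof (rule abelian_groupI)
    show "\<exists>y\<in>carrier V. y \<oplus>\<^bsub>V\<^esub> x = \<zero>\<^bsub>V\<^esub>" if "x \<in> carrier V" for x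
      using that assms(6,7) by (intro bexI[of _ "(-1) \<odot>\<^bsub>V\<^esub> x"])
  qed (fact assms)+
qed (simp_all add: assms(7-))

locale born_vs =
  fixes V :: "('a, 'm) born_space_scheme" (structure)
  assumes born: "born_vector_space V"

sublocale born_vs \<subseteq> Module.module complex_ring V
  using born by (simp add: born_vector_space_def)

context born_vs
begin

lemma bornD:
  "is_bornology (carrier V) (bornology V)"
  "A \<in> bornology V \<Longrightarrow> B \<in> bornology V \<Longrightarrow> {a \<oplus> b |a b. a \<in> A \<and> b \<in> B} \<in> bornology V"
  "A \<in> bornology V \<Longrightarrow> {c \<odot> a |a. a \<in> A} \<in> bornology V"
  "A \<in> bornology V \<Longrightarrow> {c \<odot> a |c a. cmod c \<le> 1 \<and> a \<in> A} \<in> bornology V"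
  using born by (auto simp: born_vector_space_def)

lemma bornology_carrier: "B \<in> bornology V \<Longrightarrow> B \<subseteq> carrier V"
  and bornology_empty: "{} \<in> bornology V"
  and bornology_single: "x \<in> carrier V \<Longrightarrow> {x} \<in> bornology V"
  and bornology_subset: "B \<in> bornology V \<Longrightarrow> A \<subseteq> B \<Longrightarrow> A \<in> bornology V"
  and bornology_Un: "A \<in> bornology V \<Longrightarrow> B \<in> bornology V \<Longrightarrow> A \<union> B \<in> bornology V"
  using bornD(1) by (auto simp: is_bornology_def)

lemma smult_l [simp]: "x \<in> carrier V \<Longrightarrow> c \<odot> x \<in> carrier V"
  by simp

lemma sdistl: "x \<in> carrier V \<Longrightarrow> (a + b) \<odot> x = a \<odot> x \<oplus> b \<odot> x"
  using smult_l_distr[of a b x] by simp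

lemma sdistr: "x \<in> carrier V \<Longrightarrow> y \<in> carrier V \<Longrightarrow> a \<odot> (x \<oplus> y) = a \<odot> x \<oplus> a \<odot> y"
  using smult_r_distr[of a x y] by simp

lemma sassoc: "x \<in> carrier V \<Longrightarrow> a \<odot> (b \<odot> x) = (a * b) \<odot> x"
  using smult_assoc1[of a b x] by simp

lemma sone: "x \<in> carrier V \<Longrightarrow> 1 \<odot> x = x"
  using smult_one[of x] by simp

lemma szero: "x \<in> carrier V \<Longrightarrow> 0 \<odot> x = \<zero>"
  using smult_l_null[of x] by simp

lemma sneg: "x \<in> carrier V \<Longrightarrow> (-1) \<odot> x = \<ominus> x"
  using sdistl[of x "-1" 1] by (simp add: sone szero M.minus_equality)

lemma sminus: "x \<in> carrier V \<Longrightarrow> y \<in> carrier V \<Longrightarrow> x \<ominus> y = x \<oplus> (-1) \<odot> y"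
  by (simp add: sneg M.minus_eq)

lemma sdiffr: "x \<in> carrier V \<Longrightarrow> y \<in> carrier V \<Longrightarrow> a \<odot> (x \<ominus> y) = a \<odot> x \<ominus> a \<odot> y"
  by (simp add: sminus sdistr sassoc)

lemma submodule_D:
  assumes "submodule H complex_ring V"
  shows "H \<subseteq> carrier V" "\<zero> \<in> H" "x \<in> H \<Longrightarrow> y \<in> H \<Longrightarrow> x \<oplus> y \<in> H" "x \<in> H \<Longrightarrow> c \<odot> x \<in> H"
    "x \<in> H \<Longrightarrow> y \<in> H \<Longrightarrow> x \<ominus> y \<in> H"
proof -
  note E = submoduleE[OF assms]
  show H: "H \<subseteq> carrier V" by (rule E(1))
  show s: "x \<in> H \<Longrightarrow> c \<odot> x \<in> H" for x c using E(4) by auto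
  show a: "x \<in> H \<Longrightarrow> y \<in> H \<Longrightarrow> x \<oplus> y \<in> H" for x y using E(5) by auto
  show "\<zero> \<in> H" using E(2) s[of _ 0] H szero by force
  show "x \<in> H \<Longrightarrow> y \<in> H \<Longrightarrow> x \<ominus> y \<in> H" using a s H by (auto simp: sminus subset_iff)
qed

lemma submodule_I:
  assumes "H \<subseteq> carrier V" "\<zero> \<in> H" "\<And>x y. x \<in> H \<Longrightarrow> y \<in> H \<Longrightarrow> x \<oplus> y \<in> H" "\<And>x c. x \<in> H \<Longrightarrow> c \<odot> x \<in> H"
  shows "submodule H complex_ring V"
proof (rule submoduleI)
  fix a assume "a \<in> H" then show "\<ominus> a \<in> H"
    using assms(1) assms(4)[of a "-1"] by (auto simp: sneg subset_iff)
qed (use assms in auto)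

lemma submodule_Inter:
  assumes "\<And>H. H \<in> \<H> \<Longrightarrow> submodule H complex_ring V" "\<H> \<noteq> {}"
  shows "submodule (\<Inter>\<H>) complex_ring V"
proof (rule submodule_I)
  note D = submodule_D[OF assms(1)]
  obtain H where "H \<in> \<H>" using assms(2) by blast
  then show "\<Inter>\<H> \<subseteq> carrier V" using D(1) by blast
  show "\<zero> \<in> \<Inter>\<H>" using D(2) by blast
  show "x \<oplus> y \<in> \<Inter>\<H>" if "x \<in> \<Inter>\<H>" "y \<in> \<Inter>\<H>" for x y using that D(3) by (meson InterE InterI)
  show "c \<odot> x \<in> \<Inter>\<H>" if "x \<in> \<Inter>\<H>" for x c using that D(4) by (meson InterE InterI)
qed

definition scl :: "real \<Rightarrow> 'a set \<Rightarrow> 'a set" where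
  "scl r D = {of_real r \<odot> d |d. d \<in> D}"

lemma disk_carrier: "disk V D \<Longrightarrow> D \<subseteq> carrier V"
  and disk_ne: "disk V D \<Longrightarrow> D \<noteq> {}"
  and disk_circled: "disk V D \<Longrightarrow> x \<in> D \<Longrightarrow> cmod c \<le> 1 \<Longrightarrow> c \<odot> x \<in> D"
  and disk_convex: "disk V D \<Longrightarrow> x \<in> D \<Longrightarrow> y \<in> D \<Longrightarrow> 0 \<le> t \<Longrightarrow> t \<le> 1 \<Longrightarrow> of_real (1 - t) \<odot> x \<oplus> of_real t \<odot> y \<in> D"
  by (auto simp: disk_def)

lemma disk_zero: "disk V D \<Longrightarrow> \<zero> \<in> D"
  using disk_ne[of D] disk_circled[of D _ 0] disk_carrier[of D] szero by force

lemma scl_carrier: "disk V D \<Longrightarrow> v \<in> scl r D \<Longrightarrow> v \<in> carrier V"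
  using disk_carrier[of D] by (auto simp: scl_def)

lemma scl_one: "disk V D \<Longrightarrow> scl 1 D = D"
  using disk_carrier[of D] by (auto simp: scl_def sone subset_iff) (metis sone)

lemma scl_smult:
  assumes D: "disk V D" and v: "v \<in> scl r D" and r: "0 \<le> r" "cmod c * r \<le> s"
  shows "c \<odot> v \<in> scl s D"
proof -
  obtain d where d: "d \<in> D" "v = of_real r \<odot> d" using v by (auto simp: scl_def)
  have dc: "d \<in> carrier V" using d D disk_carrier by auto
  show ?thesis
  proof (cases "s = 0")
    case True
    then have "c * of_real r = 0"
      using r by (metis mult_nonneg_nonneg norm_ge_zero norm_mult norm_of_real abs_of_nonneg order_antisym norm_eq_zero)
    then have "c \<odot> v = of_real s \<odot> d" using d dc True by (auto simp: sassoc szero)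
    then show ?thesis using d by (auto simp: scl_def)
  next
    case False
    then have s: "s > 0" using r by (smt (verit) mult_nonneg_nonneg norm_ge_zero)
    have "(c * of_real r / of_real s) \<odot> d \<in> D"
      using d s r by (intro disk_circled[OF D]) (auto simp: norm_mult norm_divide divide_simps)
    moreover have "c \<odot> v = of_real s \<odot> ((c * of_real r / of_real s) \<odot> d)"
      using d dc s by (simp add: sassoc)
    ultimately show ?thesis by (auto simp: scl_def)
  qed
qed

lemma scl_mono: "disk V D \<Longrightarrow> v \<in> scl r D \<Longrightarrow> 0 \<le> r \<Longrightarrow> r \<le> s \<Longrightarrow> v \<in> scl s D"
  using scl_smult[of D v r 1 s] scl_carrier[of D v r] by (simp add: sone)

lemma scl_zero: "disk V D \<Longrightarrow> \<zero> \<in> scl r D"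
  using disk_zero[of D] smult_r_null[of "of_real r"] by (force simp: scl_def)

lemma scl_add:
  assumes D: "disk V D" and v: "v \<in> scl r D" and w: "w \<in> scl s D" and r: "0 \<le> r" "0 \<le> s"
  shows "v \<oplus> w \<in> scl (r + s) D"
proof (cases "r + s = 0")
  case True
  then have "r = 0" "s = 0" using r by auto
  then have "v = \<zero>" "w = \<zero>" using v w disk_carrier[OF D] by (auto simp: scl_def szero)
  then show ?thesis using scl_zero[OF D] by simp
next
  case False
  obtain d where d: "d \<in> D" "v = of_real r \<odot> d" using v by (auto simp: scl_def)
  obtain e where e: "e \<in> D" "w = of_real s \<odot> e" using w by (auto simp: scl_def)
  have c: "d \<in> carrier V" "e \<in> carrier V" using d e D disk_carrier by auto
  let ?t = "s / (r + s)"
  have t: "1 - ?t = r / (r + s)" using False by (simp add: field_simps)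
  have "of_real (1 - ?t) \<odot> d \<oplus> of_real ?t \<odot> e \<in> D"
    using r False by (intro disk_convex[OF D d(1) e(1)]) (auto simp: divide_simps)
  moreover have "v \<oplus> w = of_real (r + s) \<odot> (of_real (1 - ?t) \<odot> d \<oplus> of_real ?t \<odot> e)"
    unfolding t using c False by (simp add: d e sdistr sassoc flip: of_real_add of_real_mult del: of_real_divide)
  ultimately show ?thesis unfolding scl_def by blast
qed

lemma scl_uminus: "disk V D \<Longrightarrow> v \<in> scl r D \<Longrightarrow> 0 \<le> r \<Longrightarrow> (-1) \<odot> v \<in> scl r D"
  using scl_smult[of D v r "-1" r] by simp

lemma scl_diff:
  assumes D: "disk V D" and v: "v \<in> scl r D" and w: "w \<in> scl s D" and r: "0 \<le> r" "0 \<le> s"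
  shows "v \<ominus> w \<in> scl (r + s) D"
  using scl_add[OF D v scl_uminus[OF D w r(2)] r] scl_carrier[OF D v] scl_carrier[OF D w] by (simp add: sminus)

lemma scl_diff_commute: "disk V D \<Longrightarrow> x \<in> carrier V \<Longrightarrow> y \<in> carrier V \<Longrightarrow> x \<ominus> y \<in> scl r D \<Longrightarrow> 0 \<le> r \<Longrightarrow> y \<ominus> x \<in> scl r D"
  using scl_uminus[of D "x \<ominus> y" r] by (simp add: sminus sdistr sassoc sone M.a_comm)

lemma diff_add_diff: "x \<in> carrier V \<Longrightarrow> y \<in> carrier V \<Longrightarrow> z \<in> carrier V \<Longrightarrow> (x \<ominus> y) \<oplus> (y \<ominus> z) = x \<ominus> z"
  by (simp add: M.minus_eq M.a_ac M.r_neg2)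

lemma scl_triangle:
  assumes D: "disk V D" and "x \<in> carrier V" "y \<in> carrier V" "z \<in> carrier V"
    and "x \<ominus> y \<in> scl r D" "y \<ominus> z \<in> scl s D" and r: "0 \<le> r" "0 \<le> s"
  shows "x \<ominus> z \<in> scl (r + s) D"
  using scl_add[OF D assms(5,6) r] diff_add_diff[OF assms(2-4)] by simp

lemma add_diff_self: "x \<in> carrier V \<Longrightarrow> y \<in> carrier V \<Longrightarrow> (x \<oplus> y) \<ominus> x = y"
  by (simp add: M.minus_eq M.a_ac M.r_neg2 M.r_neg1 M.r_neg M.a_lcomm[of x y])

lemma diff_add_self: "x \<in> carrier V \<Longrightarrow> y \<in> carrier V \<Longrightarrow> (x \<ominus> y) \<oplus> y = x"
  by (simp add: M.minus_eq M.a_assoc M.l_neg)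

lemma diff_zero_iff: "x \<in> carrier V \<Longrightarrow> y \<in> carrier V \<Longrightarrow> x \<ominus> y = \<zero> \<longleftrightarrow> x = y"
  using diff_add_self[of x y] by (auto simp: M.minus_eq M.r_neg)

lemma lin_span_disk:
  assumes D: "disk V D"
  shows "lin_span V D = {v. \<exists>r>0. v \<in> scl r D}" (is "_ = ?S")
proof
  have "submodule ?S complex_ring V"
  proof (rule submodule_I)
    show "?S \<subseteq> carrier V" using scl_carrier[OF D] by auto
    show "\<zero> \<in> ?S" using scl_zero[OF D, of 1] zero_less_one by blast
    show "x \<oplus> y \<in> ?S" if "x \<in> ?S" "y \<in> ?S" for x y
      using that scl_add[OF D] by simp (metis add_pos_pos less_imp_le)
    show "c \<odot> x \<in> ?S" if "x \<in> ?S" for c x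
    proof -
      obtain r where r: "r > 0" "x \<in> scl r D" using \<open>x \<in> ?S\<close> by auto
      then have "c \<odot> x \<in> scl (cmod c * r + 1) D" by (intro scl_smult[OF D]) auto
      moreover have "cmod c * r + 1 > 0" using r by (simp add: add_nonneg_pos)
      ultimately show ?thesis by blast
    qed
  qed
  moreover have "D \<subseteq> ?S" using scl_one[OF D] zero_less_one by blast
  ultimately show "lin_span V D \<subseteq> ?S" by (auto simp: lin_span_def)
  show "?S \<subseteq> lin_span V D"
    unfolding lin_span_def scl_def using submodule_D(4) by blast
qed

lemma disk_norm_le:
  assumes D: "disk V D" and "v \<in> scl r D" "r > 0" shows "disk_norm V D v \<le> r"
  unfolding disk_norm_def by (rule cInf_lower) (use assms in \<open>auto simp: scl_def intro!: bdd_belowI[of _ 0]\<close>)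

lemma disk_norm_less:
  assumes D: "disk V D" and v: "v \<in> lin_span V D" and "disk_norm V D v < r" shows "v \<in> scl r D"
proof -
  let ?S = "{r. 0 < r \<and> (\<exists>d\<in>D. v = of_real r \<odot> d)}"
  have ne: "?S \<noteq> {}" using v by (auto simp: lin_span_disk[OF D] scl_def)
  have "Inf ?S < r" using assms(3) by (simp add: disk_norm_def)
  from cInf_lessD[OF ne this] obtain s where s: "s \<in> ?S" "s < r" by (rule bexE)
  then have "v \<in> scl s D" "0 \<le> s" by (auto simp: scl_def)
  then show ?thesis using s(2) by (metis scl_mono[OF D] less_imp_le)
qed

lemma disk_norm_nonneg:
  assumes D: "disk V D" and v: "v \<in> lin_span V D" shows "0 \<le> disk_norm V D v"
  unfolding disk_norm_def by (rule cInf_greatest) (use v in \<open>auto simp: lin_span_disk[OF D] scl_def\<close>)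

lemma span_sub: "disk V D \<Longrightarrow> lin_span V D \<subseteq> carrier V"
  by (auto simp: lin_span_disk scl_carrier)

lemma span_submodule: "disk V D \<Longrightarrow> submodule (lin_span V D) complex_ring V"
  unfolding lin_span_def by (rule submodule_Inter) (auto intro!: exI[of _ "carrier V"] carrier_is_submodule disk_carrier)

lemma scl_span: "disk V D \<Longrightarrow> v \<in> scl r D \<Longrightarrow> v \<in> lin_span V D"
proof -
  assume D: "disk V D" and v: "v \<in> scl r D"
  then have "D \<subseteq> lin_span V D" by (auto simp: lin_span_def)
  then show ?thesis using v submodule_D(4)[OF span_submodule[OF D]] by (auto simp: scl_def)
qed

lemma disk_norm_zero_iff:
  assumes D: "disk V D" and v: "v \<in> lin_span V D"
  shows "disk_norm V D v = 0 \<longleftrightarrow> (\<forall>r>0. v \<in> scl r D)"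
  using disk_norm_less[OF D v] disk_norm_le[OF D, of v] disk_norm_nonneg[OF D v]
  by (metis dense less_eq_real_def not_less)

lemma disk_norm_tendsto_iff:
  assumes D: "disk V D" and v: "\<And>n. s n \<in> lin_span V D"
  shows "(\<lambda>n. disk_norm V D (s n)) \<longlonglongrightarrow> 0 \<longleftrightarrow> (\<forall>r>0. \<exists>N. \<forall>n\<ge>N. s n \<in> scl r D)"
proof
  assume L: "(\<lambda>n. disk_norm V D (s n)) \<longlonglongrightarrow> 0"
  show "\<forall>r>0. \<exists>N. \<forall>n\<ge>N. s n \<in> scl r D"
  proof (intro allI impI)
    fix r :: real assume "r > 0"
    then obtain N where "\<forall>n\<ge>N. norm (disk_norm V D (s n) - 0) < r" using LIMSEQ_D[OF L] by blast
    then show "\<exists>N. \<forall>n\<ge>N. s n \<in> scl r D" using disk_norm_less[OF D v] by (metis abs_ge_self diff_zero le_less_trans real_norm_def)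
  qed
next
  assume R: "\<forall>r>0. \<exists>N. \<forall>n\<ge>N. s n \<in> scl r D"
  show "(\<lambda>n. disk_norm V D (s n)) \<longlonglongrightarrow> 0"
  proof (rule LIMSEQ_I)
    fix r :: real assume r: "r > 0"
    then obtain N where N: "\<forall>n\<ge>N. s n \<in> scl (r/2) D" using R by (meson half_gt_zero)
    have "norm (disk_norm V D (s n) - 0) < r" if "n \<ge> N" for n
    proof -
      have "disk_norm V D (s n) \<le> r/2" using N that r by (intro disk_norm_le[OF D]) auto
      then show ?thesis using r disk_norm_nonneg[OF D v[of n]] by simp
    qed
    then show "\<exists>N. \<forall>n\<ge>N. norm (disk_norm V D (s n) - 0) < r" by blast
  qed
qed

end

lemma setcompr1: "{f a |a. a \<in> A} = f ` A"
  by auto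

lemma setcompr2: "{f a b |a b. P a \<and> b \<in> B} = (\<lambda>(a, b). f a b) ` (Collect P \<times> B)"
  by auto

lemma setcompr2': "{f a b |a b. a \<in> A \<and> b \<in> B} = (\<lambda>(a, b). f a b) ` (A \<times> B)"
  by auto

lemma image_pair2:
  assumes "\<And>a b. a \<in> A \<Longrightarrow> b \<in> B \<Longrightarrow> r (f a b) = g (p a) (q b)"
  shows "(\<lambda>(a, b). g a b) ` (p ` A \<times> q ` B) = r ` (\<lambda>(a, b). f a b) ` (A \<times> B)"
proof -
  have "r ` (\<lambda>(a, b). f a b) ` (A \<times> B) = (\<lambda>z. g (p (fst z)) (q (snd z))) ` (A \<times> B)"
    unfolding image_image by (rule image_cong) (auto simp: assms)
  also have "\<dots> = (\<lambda>(a, b). g a b) ` (map_prod p q ` (A \<times> B))"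
    unfolding image_image by (rule image_cong) auto
  also have "map_prod p q ` (A \<times> B) = p ` A \<times> q ` B"
    by (rule map_prod_surj_on) auto
  finally show ?thesis by simp
qed

lemma image_pair:
  assumes "\<And>c b. c \<in> C \<Longrightarrow> b \<in> B \<Longrightarrow> p (f c b) = g c (p b)"
  shows "(\<lambda>(a, b). g a b) ` (C \<times> p ` B) = p ` (\<lambda>(a, b). f a b) ` (C \<times> B)"
proof -
  have "p ` (\<lambda>(a, b). f a b) ` (C \<times> B) = (\<lambda>z. g (fst z) (p (snd z))) ` (C \<times> B)"
    unfolding image_image by (rule image_cong) (auto simp: assms)
  also have "\<dots> = (\<lambda>(a, b). g a b) ` (map_prod id p ` (C \<times> B))"
    unfolding image_image by (rule image_cong) auto
  also have "map_prod id p ` (C \<times> B) = C \<times> p ` B"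
    by (rule map_prod_surj_on) auto
  finally show ?thesis by simp
qed

context born_vs
begin

lemma completant_disk: "completant V D \<Longrightarrow> disk V D"
  by (simp add: completant_def)

lemma completant_iff:
  assumes D: "disk V D"
  shows "completant V D \<longleftrightarrow> (\<forall>v. (\<forall>r>0. v \<in> scl r D) \<longrightarrow> v = \<zero>)
     \<and> (\<forall>s :: nat \<Rightarrow> 'a. range s \<subseteq> lin_span V D \<and> (\<forall>r>0. \<exists>N. \<forall>m\<ge>N. \<forall>n\<ge>N. s m \<ominus> s n \<in> scl r D)
          \<longrightarrow> (\<exists>v\<in>lin_span V D. \<forall>r>0. \<exists>N. \<forall>n\<ge>N. s n \<ominus> v \<in> scl r D))"
proof -
  note sub = submodule_D[OF span_submodule[OF D]]
  have 1: "(\<forall>v\<in>lin_span V D. disk_norm V D v = 0 \<longrightarrow> v = \<zero>) \<longleftrightarrow> (\<forall>v. (\<forall>r>0. v \<in> scl r D) \<longrightarrow> v = \<zero>)"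
    using disk_norm_zero_iff[OF D] scl_span[OF D] by (metis zero_less_one)
  have 2: "(\<forall>e>0. \<exists>N. \<forall>m\<ge>N. \<forall>n\<ge>N. disk_norm V D (s m \<ominus> s n) < e)
      \<longleftrightarrow> (\<forall>r>0. \<exists>N. \<forall>m\<ge>N. \<forall>n\<ge>N. s m \<ominus> s n \<in> scl r D)" (is "?L \<longleftrightarrow> ?R") if "range s \<subseteq> lin_span V D" for s :: "nat \<Rightarrow> 'a"
  proof
    have sp: "s m \<ominus> s n \<in> lin_span V D" for m n using that by (intro sub(5)) blast+
    show ?R if ?L
    proof (intro allI impI)
      fix r :: real assume "r > 0"
      with \<open>?L\<close> obtain N where "\<forall>m\<ge>N. \<forall>n\<ge>N. disk_norm V D (s m \<ominus> s n) < r" by meson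
      then show "\<exists>N. \<forall>m\<ge>N. \<forall>n\<ge>N. s m \<ominus> s n \<in> scl r D" using disk_norm_less[OF D sp] by meson
    qed
    show ?L if ?R
    proof (intro allI impI)
      fix r :: real assume r: "r > 0"
      with \<open>?R\<close> obtain N where "\<forall>m\<ge>N. \<forall>n\<ge>N. s m \<ominus> s n \<in> scl (r/2) D" by (meson half_gt_zero)
      then have "disk_norm V D (s m \<ominus> s n) \<le> r/2" if "m \<ge> N" "n \<ge> N" for m n
        using that r by (intro disk_norm_le[OF D]) auto
      then show "\<exists>N. \<forall>m\<ge>N. \<forall>n\<ge>N. disk_norm V D (s m \<ominus> s n) < r"
        using r by (intro exI[of _ N]) (smt (verit) field_sum_of_halves)
    qed
  qed
  have 3: "(\<lambda>n. disk_norm V D (s n \<ominus> v)) \<longlonglongrightarrow> 0 \<longleftrightarrow> (\<forall>r>0. \<exists>N. \<forall>n\<ge>N. s n \<ominus> v \<in> scl r D)"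
    if "range s \<subseteq> lin_span V D" "v \<in> lin_span V D" for s v
    by (rule disk_norm_tendsto_iff[OF D], rule sub(5)) (use that in blast)+
  have 4: "(range s \<subseteq> lin_span V D \<and> (\<forall>e>0. \<exists>N. \<forall>m\<ge>N. \<forall>n\<ge>N. disk_norm V D (s m \<ominus> s n) < e)
          \<longrightarrow> (\<exists>v\<in>lin_span V D. (\<lambda>n. disk_norm V D (s n \<ominus> v)) \<longlonglongrightarrow> 0)) \<longleftrightarrow>
      (range s \<subseteq> lin_span V D \<and> (\<forall>r>0. \<exists>N. \<forall>m\<ge>N. \<forall>n\<ge>N. s m \<ominus> s n \<in> scl r D)
          \<longrightarrow> (\<exists>v\<in>lin_span V D. \<forall>r>0. \<exists>N. \<forall>n\<ge>N. s n \<ominus> v \<in> scl r D))" for s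
  proof (cases "range s \<subseteq> lin_span V D")
    case True
    then show ?thesis by (simp only: 2[OF True] 3[OF True] cong: bex_cong)
  qed simp
  show ?thesis unfolding completant_def 1 4 using D by simp
qed

lemma Mackey_iff:
  "Mackey_converges V s v \<longleftrightarrow> (\<exists>D\<in>bornology V. disk V D \<and> range s \<subseteq> lin_span V D \<and> v \<in> lin_span V D
     \<and> (\<forall>r>0. \<exists>N. \<forall>n\<ge>N. s n \<ominus> v \<in> scl r D))"
proof -
  have "(\<lambda>n. disk_norm V D (s n \<ominus> v)) \<longlonglongrightarrow> 0 \<longleftrightarrow> (\<forall>r>0. \<exists>N. \<forall>n\<ge>N. s n \<ominus> v \<in> scl r D)"
    if "disk V D" "range s \<subseteq> lin_span V D" "v \<in> lin_span V D" for D
    by (rule disk_norm_tendsto_iff[OF that(1)], rule submodule_D(5)[OF span_submodule[OF that(1)]]) (use that in blast)+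
  then show ?thesis unfolding Mackey_converges_def by blast
qed

lemma closed_subspace_carrier: "closed_subspace V (carrier V)"
  by (simp add: closed_subspace_def carrier_is_submodule)

lemma closed_subspace_submodule: "closed_subspace V N \<Longrightarrow> submodule N complex_ring V"
  by (simp add: closed_subspace_def)

lemma closed_subspace_Inter:
  assumes "\<And>N. N \<in> \<N> \<Longrightarrow> closed_subspace V N" "\<N> \<noteq> {}"
  shows "closed_subspace V (\<Inter>\<N>)"
  unfolding closed_subspace_def
proof (intro conjI allI impI)
  show "submodule (\<Inter>\<N>) complex_ring V"
    using assms by (intro submodule_Inter closed_subspace_submodule)
  fix s v assume *: "range s \<subseteq> \<Inter>\<N> \<and> v \<in> carrier V \<and> Mackey_converges V s v"
  show "v \<in> \<Inter>\<N>"
  proof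
    fix N assume N: "N \<in> \<N>"
    then have "range s \<subseteq> N" using * by blast
    then show "v \<in> N" using assms(1)[OF N] * unfolding closed_subspace_def by blast
  qed
qed

lemma closed_span_closed: "S \<subseteq> carrier V \<Longrightarrow> closed_subspace V (closed_span V S)"
  unfolding closed_span_def by (rule closed_subspace_Inter) (use closed_subspace_carrier in auto)

lemma closed_span_superset: "S \<subseteq> closed_span V S"
  by (auto simp: closed_span_def)

lemma closed_span_least: "closed_subspace V N \<Longrightarrow> S \<subseteq> N \<Longrightarrow> closed_span V S \<subseteq> N"
  by (auto simp: closed_span_def)

end

locale complete_vs = born_vs V for V (structure) +
  assumes complete: "complete_born_space V"
begin

lemma completant_ex: "B \<in> bornology V \<Longrightarrow> \<exists>D\<in>bornology V. B \<subseteq> D \<and> completant V D"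
  using complete by (simp add: complete_born_space_def)

lemma complete_separated:
  assumes "D \<in> bornology V" "\<And>r. r > 0 \<Longrightarrow> v \<in> scl r D"
  shows "v = \<zero>"
proof -
  obtain E where E: "E \<in> bornology V" "D \<subseteq> E" "completant V E" using completant_ex[OF assms(1)] by blast
  have "v \<in> scl r E" if "r > 0" for r using assms(2)[OF that] E(2) by (auto simp: scl_def)
  moreover have "\<forall>v. (\<forall>r>0. v \<in> scl r E) \<longrightarrow> v = \<zero>"
    using E(3) completant_iff[OF completant_disk[OF E(3)]] by simp
  ultimately show ?thesis by simp
qed

end

lemma complete_vsI: "complete_born_space V \<Longrightarrow> complete_vs V"
  by (simp add: complete_vs_def born_vs_def complete_vs_axioms_def complete_born_space_def)

locale born_lin = V: born_vs V + W: born_vs W for V :: "('a, 'm) born_space_scheme" and W :: "('b, 'n) born_space_scheme" +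
  fixes f assumes lin: "bounded_linear_map V W f"
begin

lemma lin_carrier [simp]: "x \<in> carrier V \<Longrightarrow> f x \<in> carrier W"
  and lin_add: "x \<in> carrier V \<Longrightarrow> y \<in> carrier V \<Longrightarrow> f (x \<oplus>\<^bsub>V\<^esub> y) = f x \<oplus>\<^bsub>W\<^esub> f y"
  and lin_smult: "x \<in> carrier V \<Longrightarrow> f (c \<odot>\<^bsub>V\<^esub> x) = c \<odot>\<^bsub>W\<^esub> f x"
  and lin_bounded: "B \<in> bornology V \<Longrightarrow> f ` B \<in> bornology W"
  using lin by (auto simp: bounded_linear_map_def)

lemma lin_zero: "f \<zero>\<^bsub>V\<^esub> = \<zero>\<^bsub>W\<^esub>"
  using lin_smult[of "\<zero>\<^bsub>V\<^esub>" 0] by (simp add: V.szero W.szero)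

lemma lin_diff: "x \<in> carrier V \<Longrightarrow> y \<in> carrier V \<Longrightarrow> f (x \<ominus>\<^bsub>V\<^esub> y) = f x \<ominus>\<^bsub>W\<^esub> f y"
  by (simp add: V.sminus W.sminus lin_add lin_smult)

lemma lin_disk:
  assumes D: "disk V D" shows "disk W (f ` D)"
  unfolding disk_def
proof (intro conjI ballI allI impI)
  note c = subsetD[OF V.disk_carrier[OF D]]
  show "f ` D \<subseteq> carrier W" using c by auto
  show "f ` D \<noteq> {}" using V.disk_ne[OF D] by auto
  fix x assume "x \<in> f ` D"
  then obtain d where d: "d \<in> D" "x = f d" by blast
  show "c \<odot>\<^bsub>W\<^esub> x \<in> f ` D" if "cmod c \<le> 1" for c
    using V.disk_circled[OF D d(1) that] lin_smult[OF c[OF d(1)], of c] d(2) by (metis imageI)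
  fix y t assume y: "y \<in> f ` D" and t: "t \<in> {0..1::real}"
  then obtain e where e: "e \<in> D" "y = f e" by blast
  have "f (of_real (1 - t) \<odot>\<^bsub>V\<^esub> d \<oplus>\<^bsub>V\<^esub> of_real t \<odot>\<^bsub>V\<^esub> e) = of_real (1 - t) \<odot>\<^bsub>W\<^esub> x \<oplus>\<^bsub>W\<^esub> of_real t \<odot>\<^bsub>W\<^esub> y"
    using c[OF d(1)] c[OF e(1)] by (simp add: lin_add lin_smult d e del: of_real_diff)
  moreover have "of_real (1 - t) \<odot>\<^bsub>V\<^esub> d \<oplus>\<^bsub>V\<^esub> of_real t \<odot>\<^bsub>V\<^esub> e \<in> D"
    using V.disk_convex[OF D d(1) e(1)] t by auto
  ultimately show "of_real (1 - t) \<odot>\<^bsub>W\<^esub> x \<oplus>\<^bsub>W\<^esub> of_real t \<odot>\<^bsub>W\<^esub> y \<in> f ` D" by (metis imageI)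
qed

lemma lin_scl:
  assumes "D \<subseteq> carrier V" "v \<in> V.scl r D" shows "f v \<in> W.scl r (f ` D)"
  using assms by (auto simp: V.scl_def W.scl_def lin_smult subset_iff)

lemma kernel_closed:
  assumes "complete_born_space W"
  shows "closed_subspace V {v \<in> carrier V. f v = \<zero>\<^bsub>W\<^esub>}"
  unfolding closed_subspace_def
proof (intro conjI allI impI)
  interpret W: complete_vs W by (rule complete_vsI[OF assms])
  show "submodule {v \<in> carrier V. f v = \<zero>\<^bsub>W\<^esub>} complex_ring V"
    by (rule V.submodule_I) (auto simp: lin_zero lin_add lin_smult W.smult_r_null)
  fix s v assume *: "range s \<subseteq> {v \<in> carrier V. f v = \<zero>\<^bsub>W\<^esub>} \<and> v \<in> carrier V \<and> Mackey_converges V s v"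
  then obtain D where D: "D \<in> bornology V" "disk V D" and lim: "\<And>r. r > 0 \<Longrightarrow> \<exists>N. \<forall>n\<ge>N. s n \<ominus>\<^bsub>V\<^esub> v \<in> V.scl r D"
    unfolding V.Mackey_iff by meson
  have s: "s n \<in> carrier V" "f (s n) = \<zero>\<^bsub>W\<^esub>" for n using * by auto
  have v: "v \<in> carrier V" using * by auto
  have "f v = \<zero>\<^bsub>W\<^esub>"
  proof (rule W.complete_separated[OF lin_bounded[OF D(1)]])
    fix r :: real assume r: "r > 0"
    then obtain n where "s n \<ominus>\<^bsub>V\<^esub> v \<in> V.scl r D" using lim[OF r] by (metis le_refl)
    then have "f (s n \<ominus>\<^bsub>V\<^esub> v) \<in> W.scl r (f ` D)" by (rule lin_scl[OF V.disk_carrier[OF D(2)]])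
    then have "\<zero>\<^bsub>W\<^esub> \<ominus>\<^bsub>W\<^esub> f v \<in> W.scl r (f ` D)" using s v by (simp add: lin_diff)
    then have "f v \<ominus>\<^bsub>W\<^esub> \<zero>\<^bsub>W\<^esub> \<in> W.scl r (f ` D)"
      using W.scl_diff_commute[OF lin_disk[OF D(2)]] v r by simp
    then show "f v \<in> W.scl r (f ` D)" using v by (simp add: W.sminus W.smult_r_null)
  qed
  then show "v \<in> {v \<in> carrier V. f v = \<zero>\<^bsub>W\<^esub>}" using v by simp
qed

end

locale born_quot = V: born_vs V for V :: "('a, 'm) born_space_scheme" +
  fixes Q :: "('b, 'n) born_space_scheme" and \<pi> :: "'a \<Rightarrow> 'b" and N
  assumes Qcarrier: "carrier Q = \<pi> ` carrier V"
    and Qadd: "\<And>x y. x \<in> carrier V \<Longrightarrow> y \<in> carrier V \<Longrightarrow> \<pi> (x \<oplus>\<^bsub>V\<^esub> y) = \<pi> x \<oplus>\<^bsub>Q\<^esub> \<pi> y"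
    and Qsmult: "\<And>x c. x \<in> carrier V \<Longrightarrow> \<pi> (c \<odot>\<^bsub>V\<^esub> x) = c \<odot>\<^bsub>Q\<^esub> \<pi> x"
    and Qzero: "\<pi> \<zero>\<^bsub>V\<^esub> = \<zero>\<^bsub>Q\<^esub>"
    and Qker: "\<And>x. x \<in> carrier V \<Longrightarrow> \<pi> x = \<zero>\<^bsub>Q\<^esub> \<longleftrightarrow> x \<in> N"
    and Qborn: "bornology Q = {\<pi> ` B |B. B \<in> bornology V}"
begin

lemma Q_module: "Module.module complex_ring Q"
  by (rule complex_moduleI)
    (auto simp: Qcarrier V.sneg V.M.l_neg V.sone
      simp flip: Qadd Qsmult Qzero V.sdistl V.sdistr V.sassoc intro!: arg_cong[of _ _ \<pi>] V.M.a_ac imageI)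

lemma Q_born_vector_space: "born_vector_space Q"
  unfolding born_vector_space_def
proof (intro conjI ballI allI)
  note ca = V.bornology_carrier
  show "Module.module complex_ring Q" by (rule Q_module)
  show "is_bornology (carrier Q) (bornology Q)"
    unfolding is_bornology_def
  proof (intro conjI ballI allI impI)
    show "bornology Q \<subseteq> Pow (carrier Q)" using ca by (auto simp: Qborn Qcarrier)
    show "{} \<in> bornology Q" using V.bornology_empty by (auto simp: Qborn)
    show "{x} \<in> bornology Q" if "x \<in> carrier Q" for x
    proof -
      obtain y where "y \<in> carrier V" "x = \<pi> y" using \<open>x \<in> carrier Q\<close> by (auto simp: Qcarrier)
      then show ?thesis using V.bornology_single[of y] unfolding Qborn by (intro CollectI exI[of _ "{y}"]) auto
    qed
    fix B assume "B \<in> bornology Q"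
    then obtain B' where B': "B' \<in> bornology V" "B = \<pi> ` B'" by (auto simp: Qborn)
    show "A \<in> bornology Q" if "A \<subseteq> B" for A
    proof -
      have "A = \<pi> ` {x \<in> B'. \<pi> x \<in> A}" using that B' by auto
      moreover have "{x \<in> B'. \<pi> x \<in> A} \<in> bornology V" by (rule V.bornology_subset[OF B'(1)]) auto
      ultimately show ?thesis unfolding Qborn by blast
    qed
    fix C assume "C \<in> bornology Q"
    then obtain C' where C': "C' \<in> bornology V" "C = \<pi> ` C'" by (auto simp: Qborn)
    have "B \<union> C = \<pi> ` (B' \<union> C')" using B' C' by (simp add: image_Un)
    then show "B \<union> C \<in> bornology Q" using V.bornology_Un[OF B'(1) C'(1)] unfolding Qborn by blast
  qed
  fix A assume "A \<in> bornology Q"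
  then obtain A' where A': "A' \<in> bornology V" "A = \<pi> ` A'" by (auto simp: Qborn)
  have ac: "a \<in> carrier V" if "a \<in> A'" for a using that ca A' by auto
  have "{c \<odot>\<^bsub>Q\<^esub> a |a. a \<in> A} = \<pi> ` {c \<odot>\<^bsub>V\<^esub> a |a. a \<in> A'}" for c
    unfolding A' setcompr1 image_image by (rule image_cong) (simp_all add: Qsmult ac)
  then show "{c \<odot>\<^bsub>Q\<^esub> a |a. a \<in> A} \<in> bornology Q" for c
    using V.bornD(3)[OF A'(1)] unfolding Qborn by blast
  have "{c \<odot>\<^bsub>Q\<^esub> a |c a. cmod c \<le> 1 \<and> a \<in> A} = \<pi> ` {c \<odot>\<^bsub>V\<^esub> a |c a. cmod c \<le> 1 \<and> a \<in> A'}"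
    unfolding A' setcompr2 by (rule image_pair) (simp_all add: Qsmult ac)
  then show "{c \<odot>\<^bsub>Q\<^esub> a |c a. cmod c \<le> 1 \<and> a \<in> A} \<in> bornology Q"
    using V.bornD(4)[OF A'(1)] unfolding Qborn by blast
  fix B assume "B \<in> bornology Q"
  then obtain B' where B': "B' \<in> bornology V" "B = \<pi> ` B'" by (auto simp: Qborn)
  have bc: "a \<in> carrier V" if "a \<in> B'" for a using that ca B' by auto
  have "{a \<oplus>\<^bsub>Q\<^esub> b |a b. a \<in> A \<and> b \<in> B} = \<pi> ` {a \<oplus>\<^bsub>V\<^esub> b |a b. a \<in> A' \<and> b \<in> B'}"
    unfolding A' B' setcompr2' by (rule image_pair2) (simp_all add: Qadd ac bc)
  then show "{a \<oplus>\<^bsub>Q\<^esub> b |a b. a \<in> A \<and> b \<in> B} \<in> bornology Q"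
    using V.bornD(2)[OF A'(1) B'(1)] unfolding Qborn by blast
qed

sublocale Q: born_vs Q
  by unfold_locales (rule Q_born_vector_space)

lemma pi_linear: "bounded_linear_map V Q \<pi>"
  unfolding bounded_linear_map_def using Qadd Qsmult by (auto simp: Qcarrier Qborn)

sublocale pi: born_lin V Q \<pi>
  by unfold_locales (rule pi_linear)

lemma pi_eq_iff: "x \<in> carrier V \<Longrightarrow> y \<in> carrier V \<Longrightarrow> \<pi> x = \<pi> y \<longleftrightarrow> x \<ominus>\<^bsub>V\<^esub> y \<in> N"
  using Qker[of "x \<ominus>\<^bsub>V\<^esub> y"] pi.lin_diff[of x y]
  by (simp add: Q.diff_zero_iff)

lemma quotient_lift:
  assumes "born_vector_space X" "bounded_linear_map V X f" "\<And>x. x \<in> N \<Longrightarrow> x \<in> carrier V \<Longrightarrow> f x = \<zero>\<^bsub>X\<^esub>"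
  shows "\<exists>g. bounded_linear_map Q X g \<and> (\<forall>x\<in>carrier V. g (\<pi> x) = f x)"
proof -
  interpret X: born_vs X by unfold_locales (rule assms)
  interpret f: born_lin V X f by unfold_locales (rule assms)
  have wd: "f x = f y" if "x \<in> carrier V" "y \<in> carrier V" "\<pi> x = \<pi> y" for x y
  proof -
    have "f (x \<ominus>\<^bsub>V\<^esub> y) = \<zero>\<^bsub>X\<^esub>" using that pi_eq_iff by (intro assms(3)) auto
    then show ?thesis using that by (simp add: f.lin_diff X.diff_zero_iff)
  qed
  define g where "g q = f (SOME x. x \<in> carrier V \<and> \<pi> x = q)" for q
  have g: "g (\<pi> x) = f x" if "x \<in> carrier V" for x
    unfolding g_def using someI[of "\<lambda>y. y \<in> carrier V \<and> \<pi> y = \<pi> x" x] that by (intro wd) auto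
  have "bounded_linear_map Q X g"
    unfolding bounded_linear_map_def
  proof (intro conjI ballI allI)
    show "g \<in> carrier Q \<rightarrow> carrier X" by (auto simp: Qcarrier g)
    show "g (x \<oplus>\<^bsub>Q\<^esub> y) = g x \<oplus>\<^bsub>X\<^esub> g y" if "x \<in> carrier Q" "y \<in> carrier Q" for x y
      using that by (auto simp: Qcarrier g f.lin_add simp flip: Qadd)
    show "g (c \<odot>\<^bsub>Q\<^esub> x) = c \<odot>\<^bsub>X\<^esub> g x" if "x \<in> carrier Q" for c x
      using that by (auto simp: Qcarrier g f.lin_smult simp flip: Qsmult)
    show "g ` B \<in> bornology X" if B: "B \<in> bornology Q" for B
    proof -
      obtain A where A: "A \<in> bornology V" "B = \<pi> ` A" using B by (auto simp: Qborn)
      have "g ` B = f ` A" unfolding A image_image using V.bornology_carrier[OF A(1)] g by (intro image_cong) auto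
      then show ?thesis using f.lin_bounded[OF A(1)] by simp
    qed
  qed
  then show ?thesis using g by blast
qed

lemma Q_complete:
  assumes "complete_born_space V" "closed_subspace V N"
  shows "complete_born_space Q"
  unfolding complete_born_space_def
proof (intro conjI ballI)
  interpret V: complete_vs V by (rule complete_vsI[OF assms(1)])
  show "born_vector_space Q" by (rule Q_born_vector_space)
  fix B assume "B \<in> bornology Q"
  then obtain A where A: "A \<in> bornology V" "B = \<pi> ` A" by (auto simp: Qborn)
  obtain D where D: "D \<in> bornology V" "A \<subseteq> D" "completant V D" using V.completant_ex[OF A(1)] by meson
  have dD: "disk V D" by (rule V.completant_disk[OF D(3)])
  have Dc: "D \<subseteq> carrier V" by (rule V.disk_carrier[OF dD])
  let ?E = "\<pi> ` D"
  have dE: "disk Q ?E" by (rule pi.lin_disk[OF dD])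
  have lift: "\<exists>d\<in>V.scl r D. \<pi> d = q" if "q \<in> Q.scl r ?E" for q r
    using that Dc by (fastforce simp: Q.scl_def V.scl_def Qsmult)
  have "completant Q ?E"
    unfolding Q.completant_iff[OF dE]
  proof (intro conjI allI impI)
    fix q assume q: "\<forall>r>0. q \<in> Q.scl r ?E"
    have "\<forall>k::nat. \<exists>d. d \<in> V.scl (1 / real (Suc k)) D \<and> \<pi> d = q"
    proof
      fix k :: nat
      have "q \<in> Q.scl (1 / real (Suc k)) ?E" using q by simp
      then show "\<exists>d. d \<in> V.scl (1 / real (Suc k)) D \<and> \<pi> d = q" using lift by meson
    qed
    then obtain d where d: "\<And>k. d k \<in> V.scl (1 / real (Suc k)) D" "\<And>k. \<pi> (d k) = q" by metis
    have dc: "d k \<in> carrier V" for k using V.scl_carrier[OF dD d(1)] .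
    have dsp: "d k \<in> lin_span V D" for k by (rule V.scl_span[OF dD d(1)])
    note sub = V.submodule_D[OF V.span_submodule[OF dD]]
    have "d 0 \<in> N"
    proof -
      have "range (\<lambda>k. d 0 \<ominus>\<^bsub>V\<^esub> d k) \<subseteq> N" using pi_eq_iff[OF dc[of 0] dc] d(2) by auto
      moreover have "Mackey_converges V (\<lambda>k. d 0 \<ominus>\<^bsub>V\<^esub> d k) (d 0)"
        unfolding V.Mackey_iff
      proof (intro bexI[OF _ D(1)] conjI allI impI)
        show "range (\<lambda>k. d 0 \<ominus>\<^bsub>V\<^esub> d k) \<subseteq> lin_span V D" using sub(5) dsp by blast
        fix r :: real assume r: "r > 0"
        then obtain k0 where k0: "1 / real (Suc k0) < r" using nat_approx_posE by metis
        have "d 0 \<ominus>\<^bsub>V\<^esub> d k \<ominus>\<^bsub>V\<^esub> d 0 \<in> V.scl r D" if "k \<ge> k0" for k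
        proof -
          have "1 / real (Suc k) \<le> 1 / real (Suc k0)" using that by (simp add: frac_le)
          then have "d k \<in> V.scl r D" using k0 by (intro V.scl_mono[OF dD d(1)]) auto
          moreover have "d 0 \<ominus>\<^bsub>V\<^esub> d k \<ominus>\<^bsub>V\<^esub> d 0 = (-1) \<odot>\<^bsub>V\<^esub> d k"
            using V.add_diff_self[of "d 0" "(-1) \<odot>\<^bsub>V\<^esub> d k"] dc by (simp add: V.sminus)
          ultimately show ?thesis using V.scl_uminus[OF dD] r by simp
        qed
        then show "\<exists>N. \<forall>n\<ge>N. d 0 \<ominus>\<^bsub>V\<^esub> d n \<ominus>\<^bsub>V\<^esub> d 0 \<in> V.scl r D" by meson
      qed (use dD dsp in auto)
      ultimately show ?thesis using assms(2) dc[of 0] unfolding closed_subspace_def by meson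
    qed
    then show "q = \<zero>\<^bsub>Q\<^esub>" using Qker[OF dc[of 0]] d(2) by metis
  next
    fix s :: "nat \<Rightarrow> 'b" assume s: "range s \<subseteq> lin_span Q ?E \<and> (\<forall>r>0. \<exists>N. \<forall>m\<ge>N. \<forall>n\<ge>N. s m \<ominus>\<^bsub>Q\<^esub> s n \<in> Q.scl r ?E)"
    have sc: "s n \<in> carrier Q" for n using s Q.span_sub[OF dE] by auto
    define b where "b k = (1/2::real) ^ k" for k
    have b0: "b k > 0" for k by (simp add: b_def)
    obtain M where M: "\<And>k m n. m \<ge> M k \<Longrightarrow> n \<ge> M k \<Longrightarrow> s m \<ominus>\<^bsub>Q\<^esub> s n \<in> Q.scl (b k) ?E"
    proof -
      have "\<forall>k. \<exists>N. \<forall>m\<ge>N. \<forall>n\<ge>N. s m \<ominus>\<^bsub>Q\<^esub> s n \<in> Q.scl (b k) ?E" using s b0 by simp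
      from choice[OF this] obtain M where "\<forall>k. \<forall>m\<ge>M k. \<forall>n\<ge>M k. s m \<ominus>\<^bsub>Q\<^esub> s n \<in> Q.scl (b k) ?E" by (rule exE)
      then show ?thesis by (intro that[of M]) simp
    qed
    define M' where "M' k = (\<Sum>i\<le>k. M i)" for k
    have M': "M' k \<ge> M k" "M' (Suc k) \<ge> M' k" for k
      using member_le_sum[of k "{..k}" M] by (auto simp: M'_def)
    obtain d0 where d0: "d0 \<in> lin_span V D" "\<pi> d0 = s (M' 0)"
    proof -
      have "s (M' 0) \<in> lin_span Q ?E" using s by (auto dest: range_subsetD)
      then have "\<exists>r. s (M' 0) \<in> Q.scl r ?E" unfolding Q.lin_span_disk[OF dE] by auto
      then obtain r where "s (M' 0) \<in> Q.scl r ?E" by (rule exE)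
      from lift[OF this] obtain d where d: "d \<in> V.scl r D" "\<pi> d = s (M' 0)" by (rule bexE)
      show ?thesis by (rule that[OF V.scl_span[OF dD d(1)] d(2)])
    qed
    have "\<exists>d. d \<in> V.scl (b k) D \<and> \<pi> d = s (M' (Suc k)) \<ominus>\<^bsub>Q\<^esub> s (M' k)" for k
    proof -
      have "s (M' (Suc k)) \<ominus>\<^bsub>Q\<^esub> s (M' k) \<in> Q.scl (b k) ?E"
        by (rule M) (use M'[of k] in linarith)+
      from lift[OF this] show ?thesis by (simp add: Bex_def)
    qed
    then obtain e where e: "\<And>k. e k \<in> V.scl (b k) D" "\<And>k. \<pi> (e k) = s (M' (Suc k)) \<ominus>\<^bsub>Q\<^esub> s (M' k)"
      by metis
    define x where "x = rec_nat d0 (\<lambda>k y. y \<oplus>\<^bsub>V\<^esub> e k)"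
    have x0: "x 0 = d0" and xS: "x (Suc k) = x k \<oplus>\<^bsub>V\<^esub> e k" for k by (auto simp: x_def)
    note sub = V.submodule_D[OF V.span_submodule[OF dD]]
    have xsp: "x k \<in> lin_span V D" for k
      by (induction k) (auto simp: x0 xS d0 intro!: sub(3) V.scl_span[OF dD e(1)])
    have xc: "x k \<in> carrier V" for k using xsp V.span_sub[OF dD] by auto
    have ec: "e k \<in> carrier V" for k using V.scl_carrier[OF dD e(1)] .
    have px: "\<pi> (x k) = s (M' k)" for k
    proof (induction k)
      case (Suc k)
      then have "\<pi> (x (Suc k)) = s (M' k) \<oplus>\<^bsub>Q\<^esub> (s (M' (Suc k)) \<ominus>\<^bsub>Q\<^esub> s (M' k))"
        using xc ec by (simp add: xS Qadd e(2))
      also have "\<dots> = s (M' (Suc k))" using Q.diff_add_self sc by (simp add: Q.M.a_comm)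
      finally show ?case .
    qed (simp add: x0 d0)
    have tail: "x (k + j) \<ominus>\<^bsub>V\<^esub> x k \<in> V.scl (2 * b k - 2 * b (k + j)) D" for k j
    proof (induction j)
      case 0
      then show ?case using V.scl_zero[OF dD] xc by (simp add: V.M.minus_eq V.M.r_neg)
    next
      case (Suc j)
      have "x (k + Suc j) \<ominus>\<^bsub>V\<^esub> x (k + j) \<in> V.scl (b (k + j)) D"
        using e(1)[of "k + j"] V.add_diff_self[OF xc ec] by (simp add: xS)
      moreover have "2 * b k - 2 * b (k + j) \<ge> 0" by (simp add: b_def power_add power_le_one mult_left_le)
      ultimately have "x (k + Suc j) \<ominus>\<^bsub>V\<^esub> x k \<in> V.scl (b (k + j) + (2 * b k - 2 * b (k + j))) D"
        using b0[of "k + j"] by (intro V.scl_triangle[OF dD xc xc xc _ Suc]) auto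
      moreover have "b (k + j) + (2 * b k - 2 * b (k + j)) = 2 * b k - 2 * b (k + Suc j)" by (simp add: b_def)
      ultimately show ?case by simp
    qed
    have tail2: "x m \<ominus>\<^bsub>V\<^esub> x k \<in> V.scl (2 * b k) D" if "m \<ge> k" for m k
    proof -
      obtain j where "m = k + j" using le_Suc_ex[OF \<open>k \<le> m\<close>] by (rule exE)
      moreover have "2 * b k - 2 * b (k + j) \<ge> 0" by (simp add: b_def power_add power_le_one mult_left_le)
      ultimately show ?thesis
        using V.scl_mono[OF dD tail[of k j], of "2 * b k"] b0[of "k + j"] by simp
    qed
    have small: "\<exists>k. c * b k < r" if "r > 0" "c > 0" for r c :: real
    proof -
      obtain k where "(1/2::real) ^ k < r / c" using real_arch_pow_inv[of "r / c" "1/2"] \<open>0 < r\<close> \<open>0 < c\<close> by auto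
      then show ?thesis using that by (auto simp: b_def field_simps)
    qed
    have xspr: "range x \<subseteq> lin_span V D" using xsp by (rule image_subsetI)
    have cau: "\<forall>r>0. \<exists>N. \<forall>m\<ge>N. \<forall>n\<ge>N. x m \<ominus>\<^bsub>V\<^esub> x n \<in> V.scl r D"
    proof (intro allI impI)
      fix r :: real assume "r > 0"
      then obtain k where k: "4 * b k < r" using small[of r 4] by auto
      have "x m \<ominus>\<^bsub>V\<^esub> x n \<in> V.scl r D" if "m \<ge> k" "n \<ge> k" for m n
      proof -
        have "x k \<ominus>\<^bsub>V\<^esub> x n \<in> V.scl (2 * b k) D"
          using V.scl_diff_commute[OF dD xc xc tail2[OF that(2)]] b0[of k] by simp
        then have "x m \<ominus>\<^bsub>V\<^esub> x n \<in> V.scl (2 * b k + 2 * b k) D"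
          using b0[of k] by (intro V.scl_triangle[OF dD xc xc xc tail2[OF that(1)]]) auto
        then show ?thesis by (rule V.scl_mono[OF dD]) (use k b0[of k] in auto)
      qed
      then show "\<exists>N. \<forall>m\<ge>N. \<forall>n\<ge>N. x m \<ominus>\<^bsub>V\<^esub> x n \<in> V.scl r D" by meson
    qed
    obtain v where v: "v \<in> lin_span V D" "\<And>r. r > 0 \<Longrightarrow> \<exists>N. \<forall>n\<ge>N. x n \<ominus>\<^bsub>V\<^esub> v \<in> V.scl r D"
      using D(3)[unfolded V.completant_iff[OF dD]] xspr cau by metis
    have vc: "v \<in> carrier V" using v(1) V.span_sub[OF dD] by auto
    show "\<exists>v\<in>lin_span Q ?E. \<forall>r>0. \<exists>N. \<forall>n\<ge>N. s n \<ominus>\<^bsub>Q\<^esub> v \<in> Q.scl r ?E"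
    proof (intro bexI[of _ "\<pi> v"] allI impI)
      show "\<pi> v \<in> lin_span Q ?E"
      proof -
        from v(1) have "\<exists>r>0. v \<in> V.scl r D" by (simp add: V.lin_span_disk[OF dD])
        then obtain r where "v \<in> V.scl r D" by auto
        then show ?thesis by (rule Q.scl_span[OF dE pi.lin_scl[OF Dc]])
      qed
      fix r :: real assume r: "r > 0"
      obtain k where k: "1 * b k < r/2" using small[of "r/2" 1] r by auto
      obtain n0 where n0: "\<And>n. n \<ge> n0 \<Longrightarrow> x n \<ominus>\<^bsub>V\<^esub> v \<in> V.scl (r/2) D" using v(2)[of "r/2"] r by auto
      let ?j = "max k n0"
      have mono: "M' i \<le> M' j" if "i \<le> j" for i j using M'(2) that by (rule lift_Suc_mono_le)
      have "s n \<ominus>\<^bsub>Q\<^esub> \<pi> v \<in> Q.scl r ?E" if "n \<ge> M k" for n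
      proof -
        have "s n \<ominus>\<^bsub>Q\<^esub> s (M' ?j) \<in> Q.scl (b k) ?E"
          using that M'(1)[of k] mono[of k ?j] by (intro M) auto
        moreover have "s (M' ?j) \<ominus>\<^bsub>Q\<^esub> \<pi> v \<in> Q.scl (r/2) ?E"
          using pi.lin_scl[OF Dc n0[of ?j]] xc vc by (simp add: pi.lin_diff px)
        ultimately have "s n \<ominus>\<^bsub>Q\<^esub> \<pi> v \<in> Q.scl (b k + r/2) ?E"
          using b0[of k] r sc vc by (intro Q.scl_triangle[OF dE, of _ "s (M' ?j)"]) auto
        then show ?thesis by (rule Q.scl_mono[OF dE]) (use k b0[of k] r in auto)
      qed
      then show "\<exists>N. \<forall>n\<ge>N. s n \<ominus>\<^bsub>Q\<^esub> \<pi> v \<in> Q.scl r ?E" by meson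
    qed
  qed
  moreover have "B \<subseteq> ?E" using A D by auto
  moreover have "?E \<in> bornology Q" using D(1) by (auto simp: Qborn)
  ultimately show "\<exists>D\<in>bornology Q. B \<subseteq> D \<and> completant Q D" by blast
qed

end

context born_vs
begin

lemma coset_mem_iff:
  assumes N: "submodule N complex_ring V" and x: "x \<in> carrier V"
  shows "y \<in> N +> x \<longleftrightarrow> y \<in> carrier V \<and> y \<ominus> x \<in> N"
proof
  assume "y \<in> N +> x"
  then obtain h where h: "h \<in> N" "y = h \<oplus> x" by (auto simp: a_r_coset_def')
  then have hc: "h \<in> carrier V" using submodule_D(1)[OF N] by (rule_tac subsetD)
  have "y \<ominus> x = h" using add_diff_self[OF x hc] M.a_comm[OF x hc] h by simp
  then show "y \<in> carrier V \<and> y \<ominus> x \<in> N" using h x hc by simp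
next
  assume y: "y \<in> carrier V \<and> y \<ominus> x \<in> N"
  then have "y = (y \<ominus> x) \<oplus> x" using diff_add_self x by simp
  then show "y \<in> N +> x" using y unfolding a_r_coset_def' by (intro UN_I[of "y \<ominus> x"]) auto
qed

lemma coset_eq_iff:
  assumes N: "submodule N complex_ring V" and x: "x \<in> carrier V" and y: "y \<in> carrier V"
  shows "N +> x = N +> y \<longleftrightarrow> x \<ominus> y \<in> N"
proof
  have "x \<in> N +> x" using x submodule_D(2)[OF N] by (simp add: coset_mem_iff[OF N x] M.minus_eq M.r_neg)
  then show "x \<ominus> y \<in> N" if "N +> x = N +> y" using that coset_mem_iff[OF N y] by simp
next
  assume xy: "x \<ominus> y \<in> N"
  have yx: "y \<ominus> x \<in> N"
    using submodule_D(4)[OF N xy, of "-1"] x y by (simp add: sminus sdistr sassoc sone M.a_comm)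
  show "N +> x = N +> y"
  proof (intro Set.set_eqI)
    fix z
    have "z \<ominus> x \<in> N \<longleftrightarrow> z \<ominus> y \<in> N" if z: "z \<in> carrier V"
      using submodule_D(3)[OF N _ xy, of "z \<ominus> x"] submodule_D(3)[OF N _ yx, of "z \<ominus> y"]
        diff_add_diff[OF z x y] diff_add_diff[OF z y x] by auto
    then show "z \<in> N +> x \<longleftrightarrow> z \<in> N +> y" using coset_mem_iff[OF N x] coset_mem_iff[OF N y] by auto
  qed
qed

lemma quotient_space_quot:
  assumes N: "submodule N complex_ring V"
  shows "born_quot V (quotient_space V N) (\<lambda>x. N +> x) N"
proof
  let ?Q = "quotient_space V N"
  have ab: "abelian_subgroup N V"
    by (rule abelian_subgroupI3) (use N in \<open>simp_all add: submodule_def additive_subgroup_def M.abelian_group_axioms\<close>)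
  show zero: "N +> \<zero> = \<zero>\<^bsub>?Q\<^esub>"
    using submodule_D(1)[OF N] by (auto simp: quotient_space_def a_r_coset_def' subset_iff)
  show "carrier ?Q = (\<lambda>x. N +> x) ` carrier V"
    by (auto simp: quotient_space_def A_RCOSETS_def')
  show "N +> (x \<oplus> y) = (N +> x) \<oplus>\<^bsub>?Q\<^esub> (N +> y)" if "x \<in> carrier V" "y \<in> carrier V" for x y
    using abelian_subgroup.a_rcos_sum[OF ab that] by (simp add: quotient_space_def)
  show "N +> (c \<odot> x) = c \<odot>\<^bsub>?Q\<^esub> (N +> x)" if x: "x \<in> carrier V" for c x
  proof -
    have eq: "N +> (c \<odot> y) = N +> (c \<odot> x)" if "y \<in> N +> x" for y
    proof -
      have y: "y \<in> carrier V" "y \<ominus> x \<in> N" using that coset_mem_iff[OF N x] by auto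
      have "c \<odot> y \<ominus> c \<odot> x \<in> N" using submodule_D(4)[OF N y(2), of c] y x by (simp add: sdiffr)
      then show ?thesis using coset_eq_iff[OF N] x y by simp
    qed
    have "x \<in> N +> x" using x submodule_D(2)[OF N] by (simp add: coset_mem_iff[OF N x] M.minus_eq M.r_neg)
    then have ne: "N +> x \<noteq> {}" by auto
    have "(\<Union>y\<in>N +> x. N +> (c \<odot> y)) = (\<Union>y\<in>N +> x. N +> (c \<odot> x))"
      by (rule arg_cong[of _ _ Union], rule image_cong[OF refl eq])
    then have "(\<Union>y\<in>N +> x. N +> (c \<odot> y)) = N +> (c \<odot> x)"
      using ne by simp
    then show ?thesis by (simp add: quotient_space_def)
  qed
  show "N +> x = \<zero>\<^bsub>?Q\<^esub> \<longleftrightarrow> x \<in> N" if x: "x \<in> carrier V" for x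
    using coset_eq_iff[OF N x, of \<zero>] zero x by (simp add: sminus)
  show "bornology ?Q = {(\<lambda>x. N +> x) ` B |B. B \<in> bornology V}" by (simp add: quotient_space_def)
qed

lemma scl_scl: "D \<subseteq> carrier V \<Longrightarrow> scl r (scl c D) = scl (r * c) D"
proof -
  assume D: "D \<subseteq> carrier V"
  show ?thesis
    unfolding scl_def setcompr1 image_image
    by (rule image_cong[OF refl]) (simp add: sassoc subsetD[OF D])
qed

lemma disk_scl:
  assumes D: "disk V D" and c: "c > 0" shows "disk V (scl c D)"
  unfolding disk_def
proof (intro conjI ballI allI impI)
  show "scl c D \<subseteq> carrier V" using scl_carrier[OF D] by (rule subsetI)
  show "scl c D \<noteq> {}" using scl_zero[OF D, of c] by (metis empty_iff)
  fix x assume x: "x \<in> scl c D"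
  show "k \<odot> x \<in> scl c D" if "cmod k \<le> 1" for k
    by (rule scl_smult[OF D x]) (use c that in auto)
  fix y t assume y: "y \<in> scl c D" and t: "t \<in> {0..1::real}"
  have "of_real (1 - t) \<odot> x \<in> scl ((1 - t) * c) D"
    by (rule scl_smult[OF D x]) (use c t in \<open>auto simp del: of_real_diff\<close>)
  moreover have "of_real t \<odot> y \<in> scl (t * c) D" by (rule scl_smult[OF D y]) (use c t in auto)
  ultimately have "of_real (1 - t) \<odot> x \<oplus> of_real t \<odot> y \<in> scl ((1 - t) * c + t * c) D"
    by (rule scl_add[OF D]) (use c t in auto)
  then show "of_real (1 - t) \<odot> x \<oplus> of_real t \<odot> y \<in> scl c D" by (simp add: algebra_simps)
qed

lemma completant_scl:
  assumes "completant V D" "c > 0" shows "completant V (scl c D)"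
proof -
  note D = completant_disk[OF assms(1)]
  note D' = disk_scl[OF D assms(2)]
  have eq: "scl r (scl c D) = scl (r * c) D" for r by (rule scl_scl[OF disk_carrier[OF D]])
  have all: "(\<forall>r>0. P (r * c)) \<longleftrightarrow> (\<forall>r>0. P r)" for P :: "real \<Rightarrow> bool"
  proof
    assume P: "\<forall>r>0. P (r * c)"
    show "\<forall>r>0. P r"
    proof (intro allI impI)
      fix r :: real assume "r > 0"
      then show "P r" using spec[OF P, of "r / c"] assms(2) by simp
    qed
  qed (use assms(2) in auto)
  have ex: "(\<exists>r>0. P (r * c)) \<longleftrightarrow> (\<exists>r>0. P r)" for P :: "real \<Rightarrow> bool"
    using all[of "\<lambda>r. \<not> P r"] by auto
  have sp: "lin_span V (scl c D) = lin_span V D"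
    unfolding lin_span_disk[OF D] lin_span_disk[OF D'] eq by (simp add: ex[of "\<lambda>r. _ \<in> scl r D"])
  show ?thesis
    using assms(1)
    unfolding completant_iff[OF D] completant_iff[OF D'] sp eq
      all[of "\<lambda>r. _ \<in> scl r D"] all[of "\<lambda>r. \<exists>N. \<forall>m\<ge>N. \<forall>n\<ge>N. _ m n \<in> scl r D"] all[of "\<lambda>r. \<exists>N. \<forall>n\<ge>N. _ n \<in> scl r D"]
    .
qed

end

subsection \<open>Absolutely summable families\<close>

abbreviation nsum :: "('i \<Rightarrow> complex) \<Rightarrow> real" where
  "nsum \<xi> \<equiv> infsum (\<lambda>p. cmod (\<xi> p)) UNIV"

abbreviation asum :: "('i \<Rightarrow> complex) \<Rightarrow> bool" where
  "asum \<xi> \<equiv> (\<lambda>p. cmod (\<xi> p)) summable_on UNIV"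

lemma asum_bound:
  assumes "\<And>F. finite F \<Longrightarrow> (\<Sum>p\<in>F. cmod (\<xi> p)) \<le> C"
  shows "asum \<xi>" "nsum \<xi> \<le> C"
proof -
  show a: "asum \<xi>"
    by (rule nonneg_bdd_above_summable_on) (use assms in \<open>auto intro!: bdd_aboveI[of _ C]\<close>)
  show "nsum \<xi> \<le> C" by (rule infsum_le_finite_sums[OF a]) (use assms in auto)
qed

lemma asum_finite: "asum \<xi> \<Longrightarrow> finite F \<Longrightarrow> (\<Sum>p\<in>F. cmod (\<xi> p)) \<le> nsum \<xi>"
  by (rule finite_sum_le_infsum) auto

lemma nsum_nonneg: "0 \<le> nsum \<xi>"
  by (rule infsum_nonneg) auto

lemma asum_add:
  assumes "asum \<xi>" "asum \<eta>"
  shows "asum (\<lambda>p. \<xi> p + \<eta> p)" "nsum (\<lambda>p. \<xi> p + \<eta> p) \<le> nsum \<xi> + nsum \<eta>"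
proof -
  have *: "(\<Sum>p\<in>F. cmod (\<xi> p + \<eta> p)) \<le> nsum \<xi> + nsum \<eta>" if "finite F" for F
  proof -
    have "(\<Sum>p\<in>F. cmod (\<xi> p + \<eta> p)) \<le> (\<Sum>p\<in>F. cmod (\<xi> p) + cmod (\<eta> p))"
      by (rule sum_mono) (rule norm_triangle_ineq)
    also have "\<dots> \<le> nsum \<xi> + nsum \<eta>"
      unfolding sum.distrib using asum_finite assms that by (intro add_mono) auto
    finally show ?thesis .
  qed
  show "asum (\<lambda>p. \<xi> p + \<eta> p)" "nsum (\<lambda>p. \<xi> p + \<eta> p) \<le> nsum \<xi> + nsum \<eta>"
    using asum_bound[of "\<lambda>p. \<xi> p + \<eta> p"] * by blast+
qed

lemma asum_smult:
  assumes "asum \<xi>"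
  shows "asum (\<lambda>p. c * \<xi> p)" "nsum (\<lambda>p. c * \<xi> p) = cmod c * nsum \<xi>"
  using assms by (simp_all add: norm_mult summable_on_cmult_right infsum_cmult_right)

lemma asum_zero: "asum (\<lambda>p. 0)" "nsum (\<lambda>p. 0) = 0"
  by simp_all

lemma asum_tail:
  assumes "asum \<xi>" "e > 0"
  obtains S where "finite S" "\<And>G. finite G \<Longrightarrow> G \<inter> S = {} \<Longrightarrow> (\<Sum>p\<in>G. cmod (\<xi> p)) \<le> e"
proof -
  have "((\<lambda>p. cmod (\<xi> p)) has_sum nsum \<xi>) UNIV" using assms by simp
  then have "\<forall>\<^sub>F F in finite_subsets_at_top UNIV. dist (sum (\<lambda>p. cmod (\<xi> p)) F) (nsum \<xi>) < e"
    using assms(2) by (simp add: has_sum_def tendsto_iff)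
  then obtain S where S: "finite S" "dist (sum (\<lambda>p. cmod (\<xi> p)) S) (nsum \<xi>) < e"
    unfolding eventually_finite_subsets_at_top by blast
  have "(\<Sum>p\<in>G. cmod (\<xi> p)) \<le> e" if "finite G" "G \<inter> S = {}" for G
  proof -
    have "(\<Sum>p\<in>S. cmod (\<xi> p)) + (\<Sum>p\<in>G. cmod (\<xi> p)) = (\<Sum>p\<in>S \<union> G. cmod (\<xi> p))"
      using that S by (subst sum.union_disjoint) auto
    also have "\<dots> \<le> nsum \<xi>" using asum_finite[OF assms(1)] that S by simp
    finally show ?thesis using S(2) by (simp add: dist_real_def)
  qed
  with S(1) that show ?thesis by blast
qed

definition sball :: "'a set \<Rightarrow> 'b set \<Rightarrow> real \<Rightarrow> ('a \<times> 'b \<Rightarrow> complex) set" where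
  "sball D E C = {\<xi>. asum \<xi> \<and> nsum \<xi> \<le> C \<and> (\<forall>p. \<xi> p \<noteq> 0 \<longrightarrow> p \<in> D \<times> E)}"

lemma sballI:
  "asum \<xi> \<Longrightarrow> nsum \<xi> \<le> C \<Longrightarrow> (\<And>p. \<xi> p \<noteq> 0 \<Longrightarrow> p \<in> D \<times> E) \<Longrightarrow> \<xi> \<in> sball D E C"
  unfolding sball_def by blast

lemma sballD:
  assumes "\<xi> \<in> sball D E C"
  shows "asum \<xi>" "nsum \<xi> \<le> C" "\<xi> p \<noteq> 0 \<Longrightarrow> p \<in> D \<times> E" "p \<notin> D \<times> E \<Longrightarrow> \<xi> p = 0"
  using assms unfolding sball_def by blast+

lemma sball_mono: "D \<subseteq> D' \<Longrightarrow> E \<subseteq> E' \<Longrightarrow> C \<le> C' \<Longrightarrow> sball D E C \<subseteq> sball D' E' C'"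
proof
  assume a: "D \<subseteq> D'" "E \<subseteq> E'" "C \<le> C'"
  fix \<xi> assume x: "\<xi> \<in> sball D E C"
  show "\<xi> \<in> sball D' E' C'"
  proof (rule sballI)
    show "p \<in> D' \<times> E'" if "\<xi> p \<noteq> 0" for p using sballD(3)[OF x that] a(1,2) by blast
  qed (use sballD(1,2)[OF x] a(3) in auto)
qed

lemma sball_add:
  assumes x: "\<xi> \<in> sball D E C" and y: "\<eta> \<in> sball D E C'"
  shows "(\<lambda>p. \<xi> p + \<eta> p) \<in> sball D E (C + C')"
proof (rule sballI)
  note s = asum_add[OF sballD(1)[OF x] sballD(1)[OF y]]
  show "asum (\<lambda>p. \<xi> p + \<eta> p)" by (rule s)
  show "nsum (\<lambda>p. \<xi> p + \<eta> p) \<le> C + C'" using s(2) sballD(2)[OF x] sballD(2)[OF y] by linarith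
  show "p \<in> D \<times> E" if "\<xi> p + \<eta> p \<noteq> 0" for p
    using that sballD(3)[OF x, of p] sballD(3)[OF y, of p] by (cases "\<xi> p = 0") auto
qed

lemma sball_smult:
  assumes x: "\<xi> \<in> sball D E C" and C: "cmod c * C \<le> C'"
  shows "(\<lambda>p. c * \<xi> p) \<in> sball D E C'"
proof (rule sballI)
  note s = asum_smult[OF sballD(1)[OF x], of c]
  show "asum (\<lambda>p. c * \<xi> p)" by (rule s)
  show "nsum (\<lambda>p. c * \<xi> p) \<le> C'"
    using s(2) mult_left_mono[OF sballD(2)[OF x], of "cmod c"] C by simp
  show "p \<in> D \<times> E" if "c * \<xi> p \<noteq> 0" for p using that sballD(3)[OF x, of p] by simp
qed

lemma sball_zero: "0 \<le> C \<Longrightarrow> (\<lambda>p. 0) \<in> sball D E C"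
  by (rule sballI) simp_all

lemma single_if: "single v w p = (if p = (v, w) then 1 else 0)"
  by (simp add: indicator_def)

lemma sball_single:
  assumes "v \<in> D" "w \<in> E" shows "single v w \<in> sball D E 1"
proof -
  have *: "(\<Sum>p\<in>F. cmod (single v w p)) \<le> 1" if "finite F" for F
  proof -
    have "(\<Sum>p\<in>F. cmod (single v w p)) = (\<Sum>p\<in>F. if p = (v, w) then 1 else 0)"
      by (rule sum.cong) (simp_all add: single_if)
    then show ?thesis using that by simp
  qed
  show ?thesis
  proof (rule sballI)
    show "asum (single v w)" by (rule asum_bound(1)[OF *])
    show "nsum (single v w) \<le> 1" by (rule asum_bound(2)[OF *])
    show "p \<in> D \<times> E" if "single v w p \<noteq> 0" for p using that assms unfolding single_if by (simp split: if_splits)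
  qed
qed

locale two_born = V: born_vs V + W: born_vs W
  for V :: "('a, 'm) born_space_scheme" and W :: "('b, 'n) born_space_scheme"
begin

abbreviation "L \<equiv> summable_families V W"

lemma L_simps:
  "\<zero>\<^bsub>L\<^esub> = (\<lambda>p. 0)" "\<xi> \<oplus>\<^bsub>L\<^esub> \<eta> = (\<lambda>p. \<xi> p + \<eta> p)" "c \<odot>\<^bsub>L\<^esub> \<xi> = (\<lambda>p. c * \<xi> p)"
  by (simp_all add: summable_families_def)

lemma L_carrier: "carrier L = {\<xi>. \<exists>D\<in>bornology V. \<exists>E\<in>bornology W. \<exists>C. \<xi> \<in> sball D E C}"
  by (auto simp: summable_families_def sball_def)

lemma L_bornology: "bornology L = {S. \<exists>D\<in>bornology V. \<exists>E\<in>bornology W. \<exists>C. S \<subseteq> sball D E C}"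
  by (simp add: summable_families_def sball_def subset_iff Ball_def)

lemma L_bornologyI: "D \<in> bornology V \<Longrightarrow> E \<in> bornology W \<Longrightarrow> S \<subseteq> sball D E C \<Longrightarrow> S \<in> bornology L"
  unfolding L_bornology by (intro CollectI bexI exI)

lemma L_carrierI: "D \<in> bornology V \<Longrightarrow> E \<in> bornology W \<Longrightarrow> \<xi> \<in> sball D E C \<Longrightarrow> \<xi> \<in> carrier L"
  unfolding L_carrier by (intro CollectI bexI exI)

lemma sball_two:
  "sball D E C \<subseteq> sball (D \<union> D') (E \<union> E') (max C C')" "sball D' E' C' \<subseteq> sball (D \<union> D') (E \<union> E') (max C C')"
  by (rule sball_mono; simp)+

lemma L_carrier_add: "\<xi> \<in> carrier L \<Longrightarrow> \<eta> \<in> carrier L \<Longrightarrow> (\<lambda>p. \<xi> p + \<eta> p) \<in> carrier L"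
proof -
  assume "\<xi> \<in> carrier L" "\<eta> \<in> carrier L"
  then obtain D E C D' E' C' where b: "D \<in> bornology V" "E \<in> bornology W" "D' \<in> bornology V" "E' \<in> bornology W"
    "\<xi> \<in> sball D E C" "\<eta> \<in> sball D' E' C'" unfolding L_carrier by auto
  note t = V.bornology_Un[OF b(1,3)] W.bornology_Un[OF b(2,4)] sball_two(1)[of D E C D' E' C'] sball_two(2)[of D' E' C' D E C]
  show ?thesis
    by (rule L_carrierI[OF t(1,2) sball_add[OF subsetD[OF t(3) b(5)] subsetD[OF t(4) b(6)]]])
qed

lemma L_carrier_smult: "\<xi> \<in> carrier L \<Longrightarrow> (\<lambda>p. c * \<xi> p) \<in> carrier L"
  proof -
  assume "\<xi> \<in> carrier L"
  then obtain D E C where b: "D \<in> bornology V" "E \<in> bornology W" "\<xi> \<in> sball D E C" unfolding L_carrier by auto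
  show ?thesis by (rule L_carrierI[OF b(1,2) sball_smult[OF b(3) order_refl]])
qed

lemma L_module: "Module.module complex_ring L"
proof (rule complex_moduleI)
  show "\<zero>\<^bsub>L\<^esub> \<in> carrier L"
    unfolding L_simps by (rule L_carrierI[OF V.bornology_empty W.bornology_empty sball_zero[OF order_refl]])
qed (auto simp: L_simps L_carrier_add L_carrier_smult algebra_simps)

lemma L_born_vector_space: "born_vector_space L"
  unfolding born_vector_space_def
proof (intro conjI ballI allI)
  show "Module.module complex_ring L" by (rule L_module)
  show "is_bornology (carrier L) (bornology L)"
    unfolding is_bornology_def
  proof (intro conjI ballI allI impI)
    show "bornology L \<subseteq> Pow (carrier L)" unfolding L_carrier L_bornology by blast
    show "{} \<in> bornology L" by (rule L_bornologyI[OF V.bornology_empty W.bornology_empty empty_subsetI])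
    show "{x} \<in> bornology L" if "x \<in> carrier L" for x using that unfolding L_carrier L_bornology by simp
    fix B assume "B \<in> bornology L"
    then obtain D E C where b: "D \<in> bornology V" "E \<in> bornology W" "B \<subseteq> sball D E C" unfolding L_bornology by auto
    show "A \<in> bornology L" if "A \<subseteq> B" for A using L_bornologyI[OF b(1,2)] b(3) that by auto
    fix B' assume "B' \<in> bornology L"
    then obtain D' E' C' where b': "D' \<in> bornology V" "E' \<in> bornology W" "B' \<subseteq> sball D' E' C'" unfolding L_bornology by auto
    note t = V.bornology_Un[OF b(1) b'(1)] W.bornology_Un[OF b(2) b'(2)] sball_two(1)[of D E C D' E' C'] sball_two(2)[of D' E' C' D E C]
    show "B \<union> B' \<in> bornology L" by (rule L_bornologyI[OF t(1,2)]) (use t(3,4) b(3) b'(3) in blast)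
  qed
  fix B assume "B \<in> bornology L"
  then obtain D E C where b: "D \<in> bornology V" "E \<in> bornology W" "B \<subseteq> sball D E C" unfolding L_bornology by auto
  show "{c \<odot>\<^bsub>L\<^esub> a |a. a \<in> B} \<in> bornology L" for c
    by (rule L_bornologyI[OF b(1,2), of _ "cmod c * C"]) (use b(3) sball_smult[of _ D E C c "cmod c * C"] in \<open>auto simp: L_simps\<close>)
  show "{c \<odot>\<^bsub>L\<^esub> a |c a. cmod c \<le> 1 \<and> a \<in> B} \<in> bornology L"
  proof (rule L_bornologyI[OF b(1,2), of _ "\<bar>C\<bar>"], safe)
    fix c :: complex and a assume "cmod c \<le> 1" "a \<in> B"
    then have "cmod c * C \<le> \<bar>C\<bar>" by (metis abs_ge_self abs_ge_zero mult_left_le_one_le mult_left_mono norm_ge_zero order_trans)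
    then show "c \<odot>\<^bsub>L\<^esub> a \<in> sball D E \<bar>C\<bar>" using \<open>a \<in> B\<close> b(3) sball_smult[of a D E C c] by (auto simp: L_simps)
  qed
  fix B' assume "B' \<in> bornology L"
  then obtain D' E' C' where b': "D' \<in> bornology V" "E' \<in> bornology W" "B' \<subseteq> sball D' E' C'" unfolding L_bornology by auto
  note t = V.bornology_Un[OF b(1) b'(1)] W.bornology_Un[OF b(2) b'(2)] sball_two(1)[of D E C D' E' C'] sball_two(2)[of D' E' C' D E C]
  show "{x \<oplus>\<^bsub>L\<^esub> y |x y. x \<in> B \<and> y \<in> B'} \<in> bornology L"
  proof (rule L_bornologyI[OF t(1,2), of _ "max C C' + max C C'"], safe)
    fix x y assume "x \<in> B" "y \<in> B'"
    then have "x \<in> sball (D \<union> D') (E \<union> E') (max C C')" "y \<in> sball (D \<union> D') (E \<union> E') (max C C')"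
      using t(3,4) b(3) b'(3) by blast+
    then show "x \<oplus>\<^bsub>L\<^esub> y \<in> sball (D \<union> D') (E \<union> E') (max C C' + max C C')" unfolding L_simps by (rule sball_add)
  qed
qed

sublocale L: born_vs L
  by unfold_locales (rule L_born_vector_space)

lemma L_minus: "\<xi> \<in> carrier L \<Longrightarrow> \<eta> \<in> carrier L \<Longrightarrow> \<xi> \<ominus>\<^bsub>L\<^esub> \<eta> = (\<lambda>p. \<xi> p - \<eta> p)"
  by (simp add: L.sminus) (simp add: L_simps)

lemma sball_disk:
  assumes "D \<in> bornology V" "E \<in> bornology W"
  shows "disk L (sball D E 1)"
  unfolding disk_def
proof (intro conjI ballI allI impI)
  show "sball D E 1 \<subseteq> carrier L" using L_carrierI[OF assms] by blast
  show "sball D E 1 \<noteq> {}" using sball_zero[of 1 D E] by auto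
  fix x assume x: "x \<in> sball D E 1"
  show "c \<odot>\<^bsub>L\<^esub> x \<in> sball D E 1" if "cmod c \<le> 1" for c
    using sball_smult[OF x, of c 1] that by (simp add: L_simps)
  fix y t assume y: "y \<in> sball D E 1" and t: "t \<in> {0..1::real}"
  have "(\<lambda>p. of_real (1 - t) * x p) \<in> sball D E (1 - t)" using t by (intro sball_smult[OF x]) (auto simp del: of_real_diff)
  moreover have "(\<lambda>p. of_real t * y p) \<in> sball D E t" using t by (intro sball_smult[OF y]) auto
  ultimately have "(\<lambda>p. of_real (1 - t) * x p + of_real t * y p) \<in> sball D E (1 - t + t)" by (rule sball_add)
  then show "of_real (1 - t) \<odot>\<^bsub>L\<^esub> x \<oplus>\<^bsub>L\<^esub> of_real t \<odot>\<^bsub>L\<^esub> y \<in> sball D E 1" by (simp add: L_simps)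
qed

lemma scl_sball:
  assumes "r > 0" shows "L.scl r (sball D E 1) = sball D E r"
proof
  show "L.scl r (sball D E 1) \<subseteq> sball D E r"
    using assms sball_smult[of _ D E 1 "of_real r" r] by (auto simp: L.scl_def L_simps)
  show "sball D E r \<subseteq> L.scl r (sball D E 1)"
  proof
    fix x assume "x \<in> sball D E r"
    then have "(\<lambda>p. of_real (1/r) * x p) \<in> sball D E 1" using assms by (intro sball_smult) (auto simp: norm_divide)
    moreover have "x = of_real r \<odot>\<^bsub>L\<^esub> (\<lambda>p. of_real (1/r) * x p)" using assms by (simp add: L_simps)
    ultimately show "x \<in> L.scl r (sball D E 1)" unfolding L.scl_def by blast
  qed
qed

lemma sball_completant:
  assumes b: "D \<in> bornology V" "E \<in> bornology W"
  shows "completant L (sball D E 1)"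
  unfolding L.completant_iff[OF sball_disk[OF b]]
proof (intro conjI allI impI)
  note dk = sball_disk[OF b]
  fix x assume x: "\<forall>r>0. x \<in> L.scl r (sball D E 1)"
  show "x = \<zero>\<^bsub>L\<^esub>"
    unfolding L_simps
  proof
    fix p
    have "cmod (x p) \<le> r" if "r > 0" for r
    proof -
      have "x \<in> sball D E r" using x that scl_sball by blast
      then show ?thesis using asum_finite[OF sballD(1), of x D E r "{p}"] sballD(2)[of x D E r] by simp
    qed
    then show "x p = 0" by (metis dense_ge norm_le_zero_iff)
  qed
next
  note dk = sball_disk[OF b]
  fix s :: "nat \<Rightarrow> 'a \<times> 'b \<Rightarrow> complex"
  assume s: "range s \<subseteq> lin_span L (sball D E 1) \<and> (\<forall>r>0. \<exists>N. \<forall>m\<ge>N. \<forall>n\<ge>N. s m \<ominus>\<^bsub>L\<^esub> s n \<in> L.scl r (sball D E 1))"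
  have ssp: "s n \<in> lin_span L (sball D E 1)" for n using s by (auto dest: range_subsetD)
  then have sc: "s n \<in> carrier L" for n using L.span_sub[OF dk] by blast
  have sb: "\<exists>r. s n \<in> sball D E r" for n
  proof -
    have "\<exists>r>0. s n \<in> L.scl r (sball D E 1)" using ssp[of n] by (simp add: L.lin_span_disk[OF dk])
    then show ?thesis using scl_sball by blast
  qed
  have cau: "\<exists>N. \<forall>m\<ge>N. \<forall>n\<ge>N. (\<lambda>p. s m p - s n p) \<in> sball D E r" if "r > 0" for r
  proof -
    have "\<exists>N. \<forall>m\<ge>N. \<forall>n\<ge>N. s m \<ominus>\<^bsub>L\<^esub> s n \<in> L.scl r (sball D E 1)" using s that by simp
    then show ?thesis by (simp add: scl_sball[OF that] L_minus sc)
  qed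
  have "Cauchy (\<lambda>n. s n p)" for p
  proof (rule metric_CauchyI)
    fix e :: real assume e: "e > 0"
    from cau[of "e/2"] e obtain N where N: "\<And>m n. m \<ge> N \<Longrightarrow> n \<ge> N \<Longrightarrow> (\<lambda>p. s m p - s n p) \<in> sball D E (e/2)" by auto
    have "dist (s m p) (s n p) < e" if "m \<ge> N" "n \<ge> N" for m n
      using asum_finite[OF sballD(1)[OF N[OF that]], of "{p}"] sballD(2)[OF N[OF that]] e by (simp add: dist_norm)
    then show "\<exists>N. \<forall>m\<ge>N. \<forall>n\<ge>N. dist (s m p) (s n p) < e" by blast
  qed
  then have "\<forall>p. \<exists>l. (\<lambda>n. s n p) \<longlonglongrightarrow> l" using Cauchy_convergent convergent_def by blast
  from choice[OF this] obtain x where x: "\<And>p. (\<lambda>n. s n p) \<longlonglongrightarrow> x p" by auto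
  have supp: "p \<in> D \<times> E" if "x p \<noteq> 0" for p
  proof (rule ccontr)
    assume "p \<notin> D \<times> E"
    then have "s n p = 0" for n using sb[of n] sballD(4) by metis
    then have "(\<lambda>n. s n p) \<longlonglongrightarrow> 0" by simp
    then show False using LIMSEQ_unique[OF x] that by blast
  qed
  have lim: "\<exists>N. \<forall>n\<ge>N. (\<lambda>p. s n p - x p) \<in> sball D E r" if r: "r > 0" for r
  proof -
    from cau[OF r] obtain N where N: "\<And>m n. m \<ge> N \<Longrightarrow> n \<ge> N \<Longrightarrow> (\<lambda>p. s m p - s n p) \<in> sball D E r" by auto
    have "(\<lambda>p. s n p - x p) \<in> sball D E r" if n: "n \<ge> N" for n
    proof -
      have "(\<Sum>p\<in>F. cmod (s n p - x p)) \<le> r" if F: "finite F" for F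
      proof (rule LIMSEQ_le_const2)
        show "(\<lambda>m. \<Sum>p\<in>F. cmod (s n p - s m p)) \<longlonglongrightarrow> (\<Sum>p\<in>F. cmod (s n p - x p))"
          by (intro tendsto_intros x)
        have "(\<Sum>p\<in>F. cmod (s n p - s m p)) \<le> r" if m: "m \<ge> N" for m
          using asum_finite[OF sballD(1)[OF N[OF n m]] F] sballD(2)[OF N[OF n m]] by simp
        then show "\<exists>N. \<forall>m\<ge>N. (\<Sum>p\<in>F. cmod (s n p - s m p)) \<le> r" by blast
      qed
      from asum_bound[OF this] have "asum (\<lambda>p. s n p - x p)" "nsum (\<lambda>p. s n p - x p) \<le> r" by blast+
      moreover have "p \<in> D \<times> E" if "s n p - x p \<noteq> 0" for p
        using that supp[of p] sb[of n] sballD(3)[of "s n" D E _ p] by (cases "x p = 0") auto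
      ultimately show ?thesis by (rule sballI)
    qed
    then show ?thesis by blast
  qed
  obtain n where n: "(\<lambda>p. s n p - x p) \<in> sball D E 1" using lim[of 1] by auto
  obtain r where r: "s n \<in> sball D E r" using sb by blast
  have "(\<lambda>p. s n p + (-1) * (s n p - x p)) \<in> sball D E (r + 1)"
    by (rule sball_add[OF r sball_smult[OF n]]) simp
  then have xb: "x \<in> sball D E (r + 1)" by simp
  then have "x \<in> sball D E (\<bar>r\<bar> + 1)" by (rule subsetD[OF sball_mono, rotated -1]) auto
  then have "x \<in> L.scl (\<bar>r\<bar> + 1) (sball D E 1)" by (simp add: scl_sball)
  then have xsp: "x \<in> lin_span L (sball D E 1)" by (rule L.scl_span[OF dk])
  have xc: "x \<in> carrier L" using xb L_carrierI[OF b] by blast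
  show "\<exists>v\<in>lin_span L (sball D E 1). \<forall>r>0. \<exists>N. \<forall>n\<ge>N. s n \<ominus>\<^bsub>L\<^esub> v \<in> L.scl r (sball D E 1)"
    by (rule bexI[OF _ xsp]) (use lim in \<open>simp add: scl_sball L_minus sc xc\<close>)
qed

lemma L_complete: "complete_born_space L"
  unfolding complete_born_space_def
proof (intro conjI ballI L_born_vector_space)
  fix B assume "B \<in> bornology L"
  then obtain D E C where b: "D \<in> bornology V" "E \<in> bornology W" "B \<subseteq> sball D E C" unfolding L_bornology by auto
  let ?r = "max C 1"
  have eq: "L.scl ?r (sball D E 1) = sball D E ?r" by (rule scl_sball) simp
  have c: "completant L (sball D E ?r)"
    using L.completant_scl[OF sball_completant[OF b(1,2)], of ?r] unfolding eq by simp
  have bd: "sball D E ?r \<in> bornology L" by (rule L_bornologyI[OF b(1,2) order_refl])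
  have "B \<subseteq> sball D E ?r" using b(3) sball_mono[of D D E E C ?r] by auto
  then show "\<exists>D\<in>bornology L. B \<subseteq> D \<and> completant L D" using c bd by blast
qed

end

subsection \<open>Extension of bounded maps to summable families\<close>

definition frestrict :: "'i set \<Rightarrow> ('i \<Rightarrow> complex) \<Rightarrow> 'i \<Rightarrow> complex" where
  "frestrict S \<xi> = (\<lambda>p. if p \<in> S then \<xi> p else 0)"

context two_born
begin

lemma single_carrier: "v \<in> carrier V \<Longrightarrow> w \<in> carrier W \<Longrightarrow> single v w \<in> carrier L"
  by (rule L_carrierI[OF V.bornology_single W.bornology_single sball_single]) auto

lemma frestrict_in:
  assumes H: "submodule H complex_ring L" and s: "\<And>v w. v \<in> carrier V \<Longrightarrow> w \<in> carrier W \<Longrightarrow> single v w \<in> H"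
    and x: "\<xi> \<in> carrier L" and S: "finite S"
  shows "frestrict S \<xi> \<in> H"
  using S
proof (induction S)
  case empty
  then show ?case using L.submodule_D(2)[OF H] by (simp add: frestrict_def L_simps)
next
  case (insert p S)
  obtain D E C where b: "D \<in> bornology V" "E \<in> bornology W" "\<xi> \<in> sball D E C" using x unfolding L_carrier by auto
  show ?case
  proof (cases "\<xi> p = 0")
    case True
    then have "frestrict (insert p S) \<xi> = frestrict S \<xi>" by (auto simp: frestrict_def)
    then show ?thesis using insert by simp
  next
    case False
    then have "p \<in> D \<times> E" using sballD(3)[OF b(3)] by blast
    then have "single (fst p) (snd p) \<in> H"
      using V.bornology_carrier[OF b(1)] W.bornology_carrier[OF b(2)] by (intro s) auto
    then have "\<xi> p \<odot>\<^bsub>L\<^esub> single (fst p) (snd p) \<in> H" by (rule L.submodule_D(4)[OF H])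
    then have "frestrict S \<xi> \<oplus>\<^bsub>L\<^esub> \<xi> p \<odot>\<^bsub>L\<^esub> single (fst p) (snd p) \<in> H"
      by (rule L.submodule_D(3)[OF H insert.IH])
    moreover have "frestrict S \<xi> \<oplus>\<^bsub>L\<^esub> \<xi> p \<odot>\<^bsub>L\<^esub> single (fst p) (snd p) = frestrict (insert p S) \<xi>"
      unfolding L_simps using insert.hyps by (intro ext) (auto simp: frestrict_def indicator_def)
    ultimately show ?thesis by simp
  qed
qed

lemma L_dense:
  assumes H: "closed_subspace L H" and s: "\<And>v w. v \<in> carrier V \<Longrightarrow> w \<in> carrier W \<Longrightarrow> single v w \<in> H"
    and x: "\<xi> \<in> carrier L"
  shows "\<xi> \<in> H"
proof -
  obtain D E C where b: "D \<in> bornology V" "E \<in> bornology W" "\<xi> \<in> sball D E C" using x unfolding L_carrier by auto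
  note dk = sball_disk[OF b(1,2)]
  note sm = L.closed_subspace_submodule[OF H]
  have "\<forall>n. \<exists>S. finite S \<and> (\<forall>G. finite G \<longrightarrow> G \<inter> S = {} \<longrightarrow> (\<Sum>p\<in>G. cmod (\<xi> p)) \<le> 1 / real (Suc n))"
  proof
    fix n :: nat
    have "1 / real (Suc n) > 0" by simp
    from asum_tail[OF sballD(1)[OF b(3)] this]
    show "\<exists>S. finite S \<and> (\<forall>G. finite G \<longrightarrow> G \<inter> S = {} \<longrightarrow> (\<Sum>p\<in>G. cmod (\<xi> p)) \<le> 1 / real (Suc n))"
      by metis
  qed
  from choice[OF this] obtain S where S: "\<And>n. finite (S n)"
    "\<And>n G. finite G \<Longrightarrow> G \<inter> S n = {} \<Longrightarrow> (\<Sum>p\<in>G. cmod (\<xi> p)) \<le> 1 / real (Suc n)" by auto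
  define s where "s n = frestrict (S n) \<xi>" for n
  have sH: "s n \<in> H" for n unfolding s_def by (rule frestrict_in[OF sm assms(2) x S(1)])
  then have sc: "s n \<in> carrier L" for n using L.submodule_D(1)[OF sm] by auto
  have d: "s n \<ominus>\<^bsub>L\<^esub> \<xi> \<in> sball D E (1 / real (Suc n))" for n
  proof -
    have *: "(\<Sum>p\<in>F. cmod (s n p - \<xi> p)) \<le> 1 / real (Suc n)" if F: "finite F" for F
    proof -
      have "(\<Sum>p\<in>F. cmod (s n p - \<xi> p)) = (\<Sum>p\<in>F - S n. cmod (\<xi> p))"
        by (rule sum.mono_neutral_cong_right[OF F]) (auto simp: s_def frestrict_def)
      also have "\<dots> \<le> 1 / real (Suc n)" by (rule S(2)) (use F in auto)
      finally show ?thesis .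
    qed
    have "(\<lambda>p. s n p - \<xi> p) \<in> sball D E (1 / real (Suc n))"
    proof (rule sballI)
      show "asum (\<lambda>p. s n p - \<xi> p)" by (rule asum_bound(1)[OF *])
      show "nsum (\<lambda>p. s n p - \<xi> p) \<le> 1 / real (Suc n)" by (rule asum_bound(2)[OF *])
      show "p \<in> D \<times> E" if "s n p - \<xi> p \<noteq> 0" for p
        by (rule sballD(3)[OF b(3)]) (use that in \<open>auto simp: s_def frestrict_def split: if_splits\<close>)
    qed
    then show ?thesis by (simp add: L_minus[OF sc x])
  qed
  have xsp: "\<xi> \<in> lin_span L (sball D E 1)"
  proof -
    have "\<xi> \<in> sball D E (max C 1)" by (rule subsetD[OF sball_mono b(3)]) auto
    then have "\<xi> \<in> L.scl (max C 1) (sball D E 1)" by (simp add: scl_sball)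
    then show ?thesis by (rule L.scl_span[OF dk])
  qed
  have ssp: "s n \<in> lin_span L (sball D E 1)" for n
  proof -
    have "s n \<ominus>\<^bsub>L\<^esub> \<xi> \<in> L.scl (1 / real (Suc n)) (sball D E 1)" using d[of n] by (simp add: scl_sball)
    then have "s n \<ominus>\<^bsub>L\<^esub> \<xi> \<in> lin_span L (sball D E 1)" by (rule L.scl_span[OF dk])
    then have "(s n \<ominus>\<^bsub>L\<^esub> \<xi>) \<oplus>\<^bsub>L\<^esub> \<xi> \<in> lin_span L (sball D E 1)"
      using xsp by (rule L.submodule_D(3)[OF L.span_submodule[OF dk]])
    then show ?thesis by (simp only: L.diff_add_self[OF sc x])
  qed
  have "Mackey_converges L s \<xi>"
    unfolding L.Mackey_iff
  proof (intro bexI[of _ "sball D E 1"] conjI allI impI)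
    show "sball D E 1 \<in> bornology L" by (rule L_bornologyI[OF b(1,2) order_refl])
    show "range s \<subseteq> lin_span L (sball D E 1)" using ssp by (rule image_subsetI)
    fix r :: real assume r: "r > 0"
    then obtain k where k: "1 / real (Suc k) < r" using nat_approx_posE by metis
    have "s n \<ominus>\<^bsub>L\<^esub> \<xi> \<in> L.scl r (sball D E 1)" if "n \<ge> k" for n
    proof -
      have "1 / real (Suc n) \<le> 1 / real (Suc k)" using that by (simp add: frac_le)
      then have "sball D E (1 / real (Suc n)) \<subseteq> sball D E r" using k by (intro sball_mono) auto
      then show ?thesis using d[of n] r by (simp add: scl_sball subset_iff)
    qed
    then show "\<exists>N. \<forall>n\<ge>N. s n \<ominus>\<^bsub>L\<^esub> \<xi> \<in> L.scl r (sball D E 1)" by (intro exI[of _ k]) simp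
  qed (rule dk, rule xsp)
  moreover have "range s \<subseteq> H" using sH by (rule image_subsetI)
  ultimately show ?thesis using H x unfolding closed_subspace_def by (metis (no_types, lifting))
qed

end

locale free_lift = two_born V W + X: complete_vs X
  for V :: "('a, 'm) born_space_scheme" and W :: "('b, 'n) born_space_scheme" and X :: "('c, 'k) born_space_scheme" +
  fixes h :: "'a \<times> 'b \<Rightarrow> 'c"
  assumes h_carrier: "\<And>p. h p \<in> carrier X"
    and h_bounded: "\<And>D E. D \<in> bornology V \<Longrightarrow> E \<in> bornology W \<Longrightarrow> h ` (D \<times> E) \<in> bornology X"
begin

definition psum :: "('a \<times> 'b \<Rightarrow> complex) \<Rightarrow> ('a \<times> 'b) set \<Rightarrow> 'c" where
  "psum \<xi> S = finsum X (\<lambda>p. \<xi> p \<odot>\<^bsub>X\<^esub> h p) S"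

lemma psum_carrier: "psum \<xi> S \<in> carrier X"
  unfolding psum_def by (rule X.M.finsum_closed) (simp add: h_carrier)

lemma psum_insert: "finite S \<Longrightarrow> p \<notin> S \<Longrightarrow> psum \<xi> (insert p S) = \<xi> p \<odot>\<^bsub>X\<^esub> h p \<oplus>\<^bsub>X\<^esub> psum \<xi> S"
  unfolding psum_def by (subst X.M.finsum_insert) (simp_all add: h_carrier)

lemma psum_empty: "psum \<xi> {} = \<zero>\<^bsub>X\<^esub>"
  by (simp add: psum_def)

lemma psum_add: "finite S \<Longrightarrow> psum (\<lambda>p. \<xi> p + \<eta> p) S = psum \<xi> S \<oplus>\<^bsub>X\<^esub> psum \<eta> S"
proof (induction S rule: finite_induct)
  case (insert p S)
  then show ?case by (simp add: psum_insert h_carrier X.sdistl psum_carrier X.M.a_ac)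
qed (simp add: psum_empty)

lemma psum_smult: "finite S \<Longrightarrow> psum (\<lambda>p. c * \<xi> p) S = c \<odot>\<^bsub>X\<^esub> psum \<xi> S"
proof (induction S rule: finite_induct)
  case empty
  then show ?case using X.smult_r_null[of c] by (simp add: psum_empty)
next
  case (insert p S)
  then show ?case by (simp add: psum_insert h_carrier X.sdistr X.sassoc psum_carrier)
qed

lemma psum_Un: "finite S \<Longrightarrow> finite T \<Longrightarrow> S \<inter> T = {} \<Longrightarrow> psum \<xi> (S \<union> T) = psum \<xi> S \<oplus>\<^bsub>X\<^esub> psum \<xi> T"
  unfolding psum_def by (rule X.M.finsum_Un_disjoint) (auto simp: h_carrier)

lemma psum_scl:
  assumes K: "disk X K" and supp: "\<And>p. \<xi> p \<noteq> 0 \<Longrightarrow> h p \<in> K" and S: "finite S"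
  shows "psum \<xi> S \<in> X.scl (\<Sum>p\<in>S. cmod (\<xi> p)) K"
  using S
proof (induction S rule: finite_induct)
  case empty
  then show ?case using X.scl_zero[OF K] by (simp add: psum_empty)
next
  case (insert p S)
  have "\<xi> p \<odot>\<^bsub>X\<^esub> h p \<in> X.scl (cmod (\<xi> p)) K"
  proof (cases "\<xi> p = 0")
    case True
    then show ?thesis using X.scl_zero[OF K] by (simp add: X.szero h_carrier)
  next
    case False
    then have "h p \<in> X.scl 1 K" using supp X.scl_one[OF K] by simp
    then show ?thesis by (rule X.scl_smult[OF K]) auto
  qed
  then have "\<xi> p \<odot>\<^bsub>X\<^esub> h p \<oplus>\<^bsub>X\<^esub> psum \<xi> S \<in> X.scl (cmod (\<xi> p) + (\<Sum>p\<in>S. cmod (\<xi> p))) K"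
    using insert.IH by (rule X.scl_add[OF K]) (auto intro: sum_nonneg)
  then show ?case using insert.hyps by (simp add: psum_insert)
qed

definition is_lim :: "('a \<times> 'b \<Rightarrow> complex) \<Rightarrow> 'c \<Rightarrow> 'c set \<Rightarrow> bool" where
  "is_lim \<xi> y K \<longleftrightarrow> y \<in> carrier X \<and> K \<in> bornology X \<and> completant X K \<and>
     (\<forall>e>0. \<exists>T. finite T \<and> (\<forall>S. finite S \<longrightarrow> T \<subseteq> S \<longrightarrow> psum \<xi> S \<ominus>\<^bsub>X\<^esub> y \<in> X.scl e K))"

lemma is_lim_mono:
  assumes "is_lim \<xi> y K" "K \<subseteq> K'" "K' \<in> bornology X" "completant X K'"
  shows "is_lim \<xi> y K'"
proof -
  have "X.scl e K \<subseteq> X.scl e K'" for e using assms(2) by (auto simp: X.scl_def)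
  then show ?thesis using assms unfolding is_lim_def by (meson subsetD)
qed

lemma is_lim_common:
  assumes "is_lim \<xi> y K" "is_lim \<eta> z K'"
  obtains J where "is_lim \<xi> y J" "is_lim \<eta> z J"
proof -
  have "K \<union> K' \<in> bornology X" using assms X.bornology_Un unfolding is_lim_def by simp
  from X.completant_ex[OF this] obtain J where "J \<in> bornology X" "K \<union> K' \<subseteq> J" "completant X J" by (elim bexE conjE)
  then show ?thesis using is_lim_mono[OF assms(1)] is_lim_mono[OF assms(2)] that[of J] by simp
qed

lemma is_limD:
  "is_lim \<xi> y K \<Longrightarrow> e > 0 \<Longrightarrow>
    \<exists>T. finite T \<and> (\<forall>S. finite S \<longrightarrow> T \<subseteq> S \<longrightarrow> psum \<xi> S \<ominus>\<^bsub>X\<^esub> y \<in> X.scl e K)"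
  unfolding is_lim_def by simp

lemma is_lim_disk: "is_lim \<xi> y K \<Longrightarrow> disk X K" "is_lim \<xi> y K \<Longrightarrow> y \<in> carrier X" "is_lim \<xi> y K \<Longrightarrow> K \<in> bornology X"
  "is_lim \<xi> y K \<Longrightarrow> completant X K"
  unfolding is_lim_def using X.completant_disk by simp_all

lemma is_lim_unique:
  assumes "is_lim \<xi> y K" "is_lim \<xi> z K'"
  shows "y = z"
proof -
  obtain J where J: "is_lim \<xi> y J" "is_lim \<xi> z J" by (rule is_lim_common[OF assms])
  note dk = is_lim_disk(1)[OF J(1)]
  note c = is_lim_disk(2)[OF J(1)] is_lim_disk(2)[OF J(2)]
  have "y \<ominus>\<^bsub>X\<^esub> z \<in> X.scl e J" if e: "e > 0" for e
  proof -
    have e2: "e/2 > 0" using e by simp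
    obtain T where T: "finite T" "\<And>S. finite S \<Longrightarrow> T \<subseteq> S \<Longrightarrow> psum \<xi> S \<ominus>\<^bsub>X\<^esub> y \<in> X.scl (e/2) J"
      using is_limD[OF J(1) e2] by auto
    obtain U where U: "finite U" "\<And>S. finite S \<Longrightarrow> U \<subseteq> S \<Longrightarrow> psum \<xi> S \<ominus>\<^bsub>X\<^esub> z \<in> X.scl (e/2) J"
      using is_limD[OF J(2) e2] by auto
    have "psum \<xi> (T \<union> U) \<ominus>\<^bsub>X\<^esub> y \<in> X.scl (e/2) J" by (rule T(2)) (use T(1) U(1) in auto)
    then have "y \<ominus>\<^bsub>X\<^esub> psum \<xi> (T \<union> U) \<in> X.scl (e/2) J"
      by (rule X.scl_diff_commute[OF dk psum_carrier c(1)]) (use e in auto)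
    moreover have "psum \<xi> (T \<union> U) \<ominus>\<^bsub>X\<^esub> z \<in> X.scl (e/2) J" by (rule U(2)) (use T(1) U(1) in auto)
    ultimately have "y \<ominus>\<^bsub>X\<^esub> z \<in> X.scl (e/2 + e/2) J"
      by (rule X.scl_triangle[OF dk c(1) psum_carrier c(2)]) (use e in auto)
    then show ?thesis by simp
  qed
  then have "y \<ominus>\<^bsub>X\<^esub> z = \<zero>\<^bsub>X\<^esub>" by (rule X.complete_separated[OF is_lim_disk(3)[OF J(1)]])
  then show ?thesis using X.diff_zero_iff c by simp
qed

lemma is_lim_add:
  assumes "is_lim \<xi> y K" "is_lim \<eta> z K'"
  shows "\<exists>J. is_lim (\<lambda>p. \<xi> p + \<eta> p) (y \<oplus>\<^bsub>X\<^esub> z) J"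
proof -
  obtain J where J: "is_lim \<xi> y J" "is_lim \<eta> z J" by (rule is_lim_common[OF assms])
  note dk = is_lim_disk(1)[OF J(1)]
  note c = is_lim_disk(2)[OF J(1)] is_lim_disk(2)[OF J(2)]
  have "\<exists>T. finite T \<and> (\<forall>S. finite S \<longrightarrow> T \<subseteq> S \<longrightarrow> psum (\<lambda>p. \<xi> p + \<eta> p) S \<ominus>\<^bsub>X\<^esub> (y \<oplus>\<^bsub>X\<^esub> z) \<in> X.scl e J)"
    if e: "e > 0" for e
  proof -
    have e2: "e/2 > 0" using e by simp
    obtain T where T: "finite T" "\<And>S. finite S \<Longrightarrow> T \<subseteq> S \<Longrightarrow> psum \<xi> S \<ominus>\<^bsub>X\<^esub> y \<in> X.scl (e/2) J"
      using is_limD[OF J(1) e2] by auto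
    obtain U where U: "finite U" "\<And>S. finite S \<Longrightarrow> U \<subseteq> S \<Longrightarrow> psum \<eta> S \<ominus>\<^bsub>X\<^esub> z \<in> X.scl (e/2) J"
      using is_limD[OF J(2) e2] by auto
    have "psum (\<lambda>p. \<xi> p + \<eta> p) S \<ominus>\<^bsub>X\<^esub> (y \<oplus>\<^bsub>X\<^esub> z) \<in> X.scl e J" if S: "finite S" "T \<union> U \<subseteq> S" for S
    proof -
      have "(psum \<xi> S \<ominus>\<^bsub>X\<^esub> y) \<oplus>\<^bsub>X\<^esub> (psum \<eta> S \<ominus>\<^bsub>X\<^esub> z) \<in> X.scl (e/2 + e/2) J"
        by (rule X.scl_add[OF dk T(2) U(2)]) (use S e in auto)
      moreover have "(psum \<xi> S \<ominus>\<^bsub>X\<^esub> y) \<oplus>\<^bsub>X\<^esub> (psum \<eta> S \<ominus>\<^bsub>X\<^esub> z) = psum (\<lambda>p. \<xi> p + \<eta> p) S \<ominus>\<^bsub>X\<^esub> (y \<oplus>\<^bsub>X\<^esub> z)"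
        using c psum_carrier by (simp add: psum_add[OF S(1)] X.sminus X.sdistr X.M.a_ac)
      ultimately show ?thesis by simp
    qed
    then show ?thesis using T(1) U(1) by (intro exI[of _ "T \<union> U"]) simp
  qed
  then have "is_lim (\<lambda>p. \<xi> p + \<eta> p) (y \<oplus>\<^bsub>X\<^esub> z) J"
    using c is_lim_disk(3,4)[OF J(1)] unfolding is_lim_def by simp
  then show ?thesis by (rule exI)
qed

lemma is_lim_smult:
  assumes J: "is_lim \<xi> y J"
  shows "is_lim (\<lambda>p. k * \<xi> p) (k \<odot>\<^bsub>X\<^esub> y) J"
proof -
  note dk = is_lim_disk(1)[OF J]
  note c = is_lim_disk(2)[OF J]
  have "\<exists>T. finite T \<and> (\<forall>S. finite S \<longrightarrow> T \<subseteq> S \<longrightarrow> psum (\<lambda>p. k * \<xi> p) S \<ominus>\<^bsub>X\<^esub> (k \<odot>\<^bsub>X\<^esub> y) \<in> X.scl e J)"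
    if e: "e > 0" for e
  proof -
    have e2: "e / (cmod k + 1) > 0" using e by (simp add: add_nonneg_pos)
    obtain T where T: "finite T" "\<And>S. finite S \<Longrightarrow> T \<subseteq> S \<Longrightarrow> psum \<xi> S \<ominus>\<^bsub>X\<^esub> y \<in> X.scl (e / (cmod k + 1)) J"
      using is_limD[OF J e2] by auto
    have le: "cmod k * (e / (cmod k + 1)) \<le> e"
    proof -
      have "cmod k * (e / (cmod k + 1)) \<le> (cmod k + 1) * (e / (cmod k + 1))" using e2 by (intro mult_right_mono) auto
      also have "\<dots> = e" using norm_ge_zero[of k] by (simp add: add_nonneg_eq_0_iff)
      finally show ?thesis .
    qed
    have "psum (\<lambda>p. k * \<xi> p) S \<ominus>\<^bsub>X\<^esub> (k \<odot>\<^bsub>X\<^esub> y) \<in> X.scl e J" if S: "finite S" "T \<subseteq> S" for S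
    proof -
      have "k \<odot>\<^bsub>X\<^esub> (psum \<xi> S \<ominus>\<^bsub>X\<^esub> y) \<in> X.scl e J"
        by (rule X.scl_smult[OF dk T(2)[OF S] less_imp_le[OF e2] le])
      then show ?thesis using c psum_carrier by (simp add: psum_smult[OF S(1)] X.sdiffr)
    qed
    then show ?thesis using T(1) by (intro exI[of _ T]) simp
  qed
  then show ?thesis
    using c is_lim_disk(3,4)[OF J] unfolding is_lim_def by simp
qed

lemma is_lim_single: "\<exists>J. is_lim (single v w) (h (v, w)) J"
proof -
  have "{h (v, w)} \<in> bornology X" by (rule X.bornology_single[OF h_carrier])
  from X.completant_ex[OF this] obtain J where J: "J \<in> bornology X" "completant X J" by (elim bexE conjE)
  have "psum (single v w) S = h (v, w)" if S: "finite S" "{(v, w)} \<subseteq> S" for S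
  proof -
    have "psum (single v w) S = finsum X (\<lambda>p. if (v, w) = p then h p else \<zero>\<^bsub>X\<^esub>) S"
      unfolding psum_def by (rule X.M.finsum_cong') (auto simp: single_if h_carrier X.szero X.sone)
    also have "\<dots> = h (v, w)" by (rule X.M.add.finprod_singleton) (use S h_carrier in auto)
    finally show ?thesis .
  qed
  then have "psum (single v w) S \<ominus>\<^bsub>X\<^esub> h (v, w) \<in> X.scl e J" if S: "finite S" "{(v, w)} \<subseteq> S" for S e
    using S X.scl_zero[OF X.completant_disk[OF J(2)]] h_carrier by (simp add: X.M.minus_eq X.M.r_neg)
  then have "is_lim (single v w) (h (v, w)) J"
    unfolding is_lim_def using J h_carrier by (metis finite.emptyI finite_insert)
  then show ?thesis by (rule exI)
qed

lemma is_lim_exists':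
  assumes b: "D \<in> bornology V" "E \<in> bornology W"
    and K: "K \<in> bornology X" "h ` (D \<times> E) \<subseteq> K" "completant X K" and x: "\<xi> \<in> sball D E C"
  shows "\<exists>y. is_lim \<xi> y K \<and> y \<in> X.scl (\<bar>C\<bar> + 1) K"
proof -
  note dk = X.completant_disk[OF K(3)]
  show ?thesis
  proof -
    note sb = sballD[OF x]
    have hK: "h p \<in> K" if "\<xi> p \<noteq> 0" for p using sb(3)[OF that] K(2) by (auto simp: image_subset_iff)
    have ps: "psum \<xi> T \<in> X.scl (\<Sum>p\<in>T. cmod (\<xi> p)) K" if "finite T" for T
      by (rule psum_scl[OF dk hK that])
    have "\<forall>n. \<exists>S. finite S \<and> (\<forall>G. finite G \<longrightarrow> G \<inter> S = {} \<longrightarrow> (\<Sum>p\<in>G. cmod (\<xi> p)) \<le> 1 / real (Suc n))"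
    proof
      fix n :: nat
      have "1 / real (Suc n) > 0" by simp
      from asum_tail[OF sb(1) this]
      show "\<exists>S. finite S \<and> (\<forall>G. finite G \<longrightarrow> G \<inter> S = {} \<longrightarrow> (\<Sum>p\<in>G. cmod (\<xi> p)) \<le> 1 / real (Suc n))"
        by metis
    qed
    from choice[OF this] obtain S where S: "\<And>n. finite (S n)"
      "\<And>n G. finite G \<Longrightarrow> G \<inter> S n = {} \<Longrightarrow> (\<Sum>p\<in>G. cmod (\<xi> p)) \<le> 1 / real (Suc n)" by auto
    define t where "t n = psum \<xi> (S n)" for n
    have tc: "t n \<in> carrier X" for n by (simp add: t_def psum_carrier)
    have near: "psum \<xi> T \<ominus>\<^bsub>X\<^esub> t n \<in> X.scl (1 / real (Suc n)) K" if T: "finite T" "S n \<subseteq> T" for T n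
    proof -
      have "psum \<xi> (S n \<union> (T - S n)) = t n \<oplus>\<^bsub>X\<^esub> psum \<xi> (T - S n)"
        unfolding t_def by (rule psum_Un) (use T S(1) in auto)
      moreover have "S n \<union> (T - S n) = T" using T by auto
      ultimately have "psum \<xi> T \<ominus>\<^bsub>X\<^esub> t n = psum \<xi> (T - S n)"
        using X.add_diff_self[OF tc psum_carrier] by simp
      moreover have "psum \<xi> (T - S n) \<in> X.scl (\<Sum>p\<in>T - S n. cmod (\<xi> p)) K" by (rule ps) (use T in auto)
      moreover have "(\<Sum>p\<in>T - S n. cmod (\<xi> p)) \<le> 1 / real (Suc n)" by (rule S(2)) (use T in auto)
      ultimately show ?thesis using X.scl_mono[OF dk] by (simp add: sum_nonneg)
    qed
    have tt: "t m \<ominus>\<^bsub>X\<^esub> t n \<in> X.scl (1 / real (Suc m) + 1 / real (Suc n)) K" for m n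
    proof (rule X.scl_triangle[OF dk tc psum_carrier tc])
      have "psum \<xi> (S m \<union> S n) \<ominus>\<^bsub>X\<^esub> t m \<in> X.scl (1 / real (Suc m)) K" by (rule near) (use S(1) in auto)
      then show "t m \<ominus>\<^bsub>X\<^esub> psum \<xi> (S m \<union> S n) \<in> X.scl (1 / real (Suc m)) K"
        by (rule X.scl_diff_commute[OF dk psum_carrier tc]) simp
      show "psum \<xi> (S m \<union> S n) \<ominus>\<^bsub>X\<^esub> t n \<in> X.scl (1 / real (Suc n)) K" by (rule near) (use S(1) in auto)
    qed auto
    have small: "\<exists>k. \<forall>n\<ge>k. 1 / real (Suc n) \<le> r" if r: "r > 0" for r
    proof -
      obtain k where "1 / real (Suc k) < r" using nat_approx_posE[OF r] by metis
      moreover have "1 / real (Suc n) \<le> 1 / real (Suc k)" if "n \<ge> k" for n using that by (simp add: frac_le)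
      ultimately show ?thesis by (meson less_imp_le order_trans)
    qed
    have "\<forall>r>0. \<exists>N. \<forall>m\<ge>N. \<forall>n\<ge>N. t m \<ominus>\<^bsub>X\<^esub> t n \<in> X.scl r K"
    proof (intro allI impI)
      fix r :: real assume r: "r > 0"
      then obtain k where k: "\<And>n. n \<ge> k \<Longrightarrow> 1 / real (Suc n) \<le> r/2" using small[of "r/2"] by auto
      have "t m \<ominus>\<^bsub>X\<^esub> t n \<in> X.scl r K" if "m \<ge> k" "n \<ge> k" for m n
        by (rule X.scl_mono[OF dk tt]) (use k[OF that(1)] k[OF that(2)] in auto)
      then show "\<exists>N. \<forall>m\<ge>N. \<forall>n\<ge>N. t m \<ominus>\<^bsub>X\<^esub> t n \<in> X.scl r K" by (intro exI[of _ k]) simp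
    qed
    moreover have "range t \<subseteq> lin_span X K"
    proof (rule image_subsetI)
      show "t n \<in> lin_span X K" for n unfolding t_def by (rule X.scl_span[OF dk ps[OF S(1)]])
    qed
    ultimately obtain y where y: "y \<in> lin_span X K" "\<forall>r>0. \<exists>N. \<forall>n\<ge>N. t n \<ominus>\<^bsub>X\<^esub> y \<in> X.scl r K"
      using K(3) unfolding X.completant_iff[OF dk] by metis
    have yc: "y \<in> carrier X" using y(1) X.span_sub[OF dk] by (rule_tac subsetD)
    have lim: "\<exists>T. finite T \<and> (\<forall>S. finite S \<longrightarrow> T \<subseteq> S \<longrightarrow> psum \<xi> S \<ominus>\<^bsub>X\<^esub> y \<in> X.scl e K)" if e: "e > 0" for e
    proof -
      have e2: "e/2 > 0" using e by simp
      obtain k where k: "\<And>n. n \<ge> k \<Longrightarrow> 1 / real (Suc n) \<le> e/2" using small[OF e2] by auto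
      obtain N where N: "\<And>n. n \<ge> N \<Longrightarrow> t n \<ominus>\<^bsub>X\<^esub> y \<in> X.scl (e/2) K" using y(2) e2 by metis
      let ?n = "max k N"
      have "psum \<xi> T \<ominus>\<^bsub>X\<^esub> y \<in> X.scl e K" if T: "finite T" "S ?n \<subseteq> T" for T
      proof -
        have "psum \<xi> T \<ominus>\<^bsub>X\<^esub> y \<in> X.scl (1 / real (Suc ?n) + e/2) K"
          by (rule X.scl_triangle[OF dk psum_carrier tc yc near[OF T] N]) (use e in auto)
        then show ?thesis by (rule X.scl_mono[OF dk]) (use k[of ?n] e in auto)
      qed
      then show ?thesis using S(1) by (intro exI[of _ "S ?n"]) simp
    qed
    have "y \<in> X.scl (\<bar>C\<bar> + 1) K"
    proof -
      obtain T where T: "finite T" "psum \<xi> T \<ominus>\<^bsub>X\<^esub> y \<in> X.scl 1 K" using lim[of 1] by auto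
      have "psum \<xi> T \<in> X.scl \<bar>C\<bar> K"
        by (rule X.scl_mono[OF dk ps[OF T(1)]]) (use asum_finite[OF sb(1) T(1)] sb(2) in \<open>auto intro: sum_nonneg\<close>)
      then have "psum \<xi> T \<ominus>\<^bsub>X\<^esub> (psum \<xi> T \<ominus>\<^bsub>X\<^esub> y) \<in> X.scl (\<bar>C\<bar> + 1) K"
        using T(2) by (rule X.scl_diff[OF dk]) auto
      moreover have "psum \<xi> T \<ominus>\<^bsub>X\<^esub> (psum \<xi> T \<ominus>\<^bsub>X\<^esub> y) = y"
        using X.diff_add_self[of "psum \<xi> T \<ominus>\<^bsub>X\<^esub> (psum \<xi> T \<ominus>\<^bsub>X\<^esub> y)" "psum \<xi> T"] psum_carrier[of \<xi> T] yc
        by (simp add: X.M.minus_eq X.M.minus_add X.M.r_neg1 X.M.r_neg2)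
      ultimately show ?thesis by simp
    qed
    moreover have "is_lim \<xi> y K" unfolding is_lim_def using yc K(1,3) lim by simp
    ultimately show ?thesis by (intro exI[of _ y] conjI)
  qed
qed

lemma is_lim_exists:
  assumes b: "D \<in> bornology V" "E \<in> bornology W"
  shows "\<exists>K\<in>bornology X. disk X K \<and> (\<forall>C. \<forall>\<xi>\<in>sball D E C. \<exists>y. is_lim \<xi> y K \<and> y \<in> X.scl (\<bar>C\<bar> + 1) K)"
proof -
  from X.completant_ex[OF h_bounded[OF b]] obtain K where K: "K \<in> bornology X" "h ` (D \<times> E) \<subseteq> K" "completant X K"
    by (elim bexE conjE)
  show ?thesis
    using K(1) X.completant_disk[OF K(3)] is_lim_exists'[OF b K] by (intro bexI[of _ K] conjI) simp_all
qed

lemma free_lift: "\<exists>g. bounded_linear_map L X g \<and> (\<forall>v w. g (single v w) = h (v, w)) \<and>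
    (\<forall>D E K C \<xi>. D \<in> bornology V \<longrightarrow> E \<in> bornology W \<longrightarrow> K \<in> bornology X \<longrightarrow> completant X K
       \<longrightarrow> h ` (D \<times> E) \<subseteq> K \<longrightarrow> \<xi> \<in> sball D E C \<longrightarrow> g \<xi> \<in> X.scl (\<bar>C\<bar> + 1) K)"
proof -
  define g where "g \<xi> = (THE y. \<exists>K. is_lim \<xi> y K)" for \<xi>
  have g: "g \<xi> = y" if "is_lim \<xi> y K" for \<xi> y K
    unfolding g_def by (rule the_equality) (use that is_lim_unique in auto)
  have ex: "\<exists>y K. is_lim \<xi> y K" if x: "\<xi> \<in> carrier L" for \<xi>
  proof -
    obtain D E C where b: "D \<in> bornology V" "E \<in> bornology W" "\<xi> \<in> sball D E C" using x unfolding L_carrier by auto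
    from is_lim_exists[OF b(1,2)] b(3) show ?thesis by meson
  qed
  have "bounded_linear_map L X g"
    unfolding bounded_linear_map_def
  proof (intro conjI ballI allI)
    show "g \<in> carrier L \<rightarrow> carrier X"
    proof
      fix x assume "x \<in> carrier L"
      from ex[OF this] obtain y K where y: "is_lim x y K" by (elim exE)
      show "g x \<in> carrier X" using is_lim_disk(2)[OF y] g[OF y] by simp
    qed
    fix x assume "x \<in> carrier L"
    from ex[OF this] obtain y K where y: "is_lim x y K" by (elim exE)
    show "g (c \<odot>\<^bsub>L\<^esub> x) = c \<odot>\<^bsub>X\<^esub> g x" for c
      unfolding L_simps using g[OF is_lim_smult[OF y]] g[OF y] by simp
    fix x' assume "x' \<in> carrier L"
    from ex[OF this] obtain y' K' where y': "is_lim x' y' K'" by (elim exE)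
    from is_lim_add[OF y y'] obtain J where "is_lim (\<lambda>p. x p + x' p) (y \<oplus>\<^bsub>X\<^esub> y') J" by (rule exE)
    then show "g (x \<oplus>\<^bsub>L\<^esub> x') = g x \<oplus>\<^bsub>X\<^esub> g x'"
      unfolding L_simps using g[OF y] g[OF y'] g by simp
  next
    fix B assume "B \<in> bornology L"
    then obtain D E C where b: "D \<in> bornology V" "E \<in> bornology W" "B \<subseteq> sball D E C" unfolding L_bornology by auto
    from is_lim_exists[OF b(1,2)] obtain K where K: "K \<in> bornology X" "disk X K"
      "\<forall>C. \<forall>\<xi>\<in>sball D E C. \<exists>y. is_lim \<xi> y K \<and> y \<in> X.scl (\<bar>C\<bar> + 1) K" by (elim bexE conjE)
    have "g ` B \<subseteq> X.scl (\<bar>C\<bar> + 1) K"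
    proof (rule image_subsetI)
      fix x assume "x \<in> B"
      then have "x \<in> sball D E C" using b(3) by (rule_tac subsetD)
      then obtain y where "is_lim x y K" "y \<in> X.scl (\<bar>C\<bar> + 1) K" using K(3) by meson
      then show "g x \<in> X.scl (\<bar>C\<bar> + 1) K" using g by simp
    qed
    moreover have "X.scl (\<bar>C\<bar> + 1) K \<in> bornology X" unfolding X.scl_def by (rule X.bornD(3)[OF K(1)])
    ultimately show "g ` B \<in> bornology X" using X.bornology_subset by simp
  qed
  moreover have "g (single v w) = h (v, w)" for v w
    using is_lim_single[of v w] g by (elim exE) simp
  moreover have "g \<xi> \<in> X.scl (\<bar>C\<bar> + 1) K"
    if "D \<in> bornology V" "E \<in> bornology W" "K \<in> bornology X" "completant X K"
       "h ` (D \<times> E) \<subseteq> K" "\<xi> \<in> sball D E C" for D E K C \<xi>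
    using is_lim_exists'[OF that(1-3,5,4,6)] g by (elim exE conjE) simp
  ultimately show ?thesis by (intro exI[of _ g] conjI allI impI)
qed

end

section \<open>Universal property of the completed tensor product\<close>

lemma bounded_linear_mapD:
  assumes "bounded_linear_map V W f"
  shows "x \<in> carrier V \<Longrightarrow> f x \<in> carrier W"
    "x \<in> carrier V \<Longrightarrow> y \<in> carrier V \<Longrightarrow> f (x \<oplus>\<^bsub>V\<^esub> y) = f x \<oplus>\<^bsub>W\<^esub> f y"
    "x \<in> carrier V \<Longrightarrow> f (c \<odot>\<^bsub>V\<^esub> x) = c \<odot>\<^bsub>W\<^esub> f x"
    "B \<in> bornology V \<Longrightarrow> f ` B \<in> bornology W"
  using assms by (auto simp: bounded_linear_map_def)

lemma bounded_bilinear_mapD: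
  assumes "bounded_bilinear_map V W X f"
  shows "v \<in> carrier V \<Longrightarrow> w \<in> carrier W \<Longrightarrow> f v w \<in> carrier X"
    "v \<in> carrier V \<Longrightarrow> v' \<in> carrier V \<Longrightarrow> w \<in> carrier W \<Longrightarrow> f (v \<oplus>\<^bsub>V\<^esub> v') w = f v w \<oplus>\<^bsub>X\<^esub> f v' w"
    "v \<in> carrier V \<Longrightarrow> w \<in> carrier W \<Longrightarrow> w' \<in> carrier W \<Longrightarrow> f v (w \<oplus>\<^bsub>W\<^esub> w') = f v w \<oplus>\<^bsub>X\<^esub> f v w'"
    "v \<in> carrier V \<Longrightarrow> w \<in> carrier W \<Longrightarrow> f (c \<odot>\<^bsub>V\<^esub> v) w = c \<odot>\<^bsub>X\<^esub> f v w"
    "v \<in> carrier V \<Longrightarrow> w \<in> carrier W \<Longrightarrow> f v (c \<odot>\<^bsub>W\<^esub> w) = c \<odot>\<^bsub>X\<^esub> f v w"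
    "A \<in> bornology V \<Longrightarrow> B \<in> bornology W \<Longrightarrow> (\<lambda>(a, b). f a b) ` (A \<times> B) \<in> bornology X"
  using assms unfolding bounded_bilinear_map_def setcompr2' by simp_all

lemma closed_equalizer:
  assumes V: "born_vector_space V" and W: "complete_born_space W"
    and f: "bounded_linear_map V W f" and g: "bounded_linear_map V W g"
  shows "closed_subspace V {v \<in> carrier V. f v = g v}"
proof -
  interpret V: born_vs V by (rule born_vs.intro[OF V])
  interpret W: complete_vs W by (rule complete_vsI[OF W])
  interpret f: born_lin V W f by unfold_locales (rule f)
  interpret g: born_lin V W g by unfold_locales (rule g)
  have "bounded_linear_map V W (\<lambda>v. f v \<ominus>\<^bsub>W\<^esub> g v)"
    unfolding bounded_linear_map_def
  proof (intro conjI ballI allI)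
    show "(\<lambda>v. f v \<ominus>\<^bsub>W\<^esub> g v) \<in> carrier V \<rightarrow> carrier W" by simp
    show "f (x \<oplus>\<^bsub>V\<^esub> y) \<ominus>\<^bsub>W\<^esub> g (x \<oplus>\<^bsub>V\<^esub> y) = (f x \<ominus>\<^bsub>W\<^esub> g x) \<oplus>\<^bsub>W\<^esub> (f y \<ominus>\<^bsub>W\<^esub> g y)"
      if "x \<in> carrier V" "y \<in> carrier V" for x y
      using that by (simp add: f.lin_add g.lin_add W.sminus W.sdistr W.M.a_ac)
    show "f (c \<odot>\<^bsub>V\<^esub> x) \<ominus>\<^bsub>W\<^esub> g (c \<odot>\<^bsub>V\<^esub> x) = c \<odot>\<^bsub>W\<^esub> (f x \<ominus>\<^bsub>W\<^esub> g x)" if "x \<in> carrier V" for c x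
      using that by (simp add: f.lin_smult g.lin_smult W.sdiffr)
    fix B assume B: "B \<in> bornology V"
    have Bc: "b \<in> carrier V" if "b \<in> B" for b using V.bornology_carrier[OF B] that by (rule subsetD)
    have "(\<lambda>v. f v \<ominus>\<^bsub>W\<^esub> g v) ` B \<subseteq> {a \<oplus>\<^bsub>W\<^esub> b |a b. a \<in> f ` B \<and> b \<in> {(-1) \<odot>\<^bsub>W\<^esub> a |a. a \<in> g ` B}}"
    proof (rule image_subsetI)
      fix b assume b: "b \<in> B"
      have "f b \<ominus>\<^bsub>W\<^esub> g b = f b \<oplus>\<^bsub>W\<^esub> (-1) \<odot>\<^bsub>W\<^esub> g b" using Bc[OF b] by (simp add: W.sminus)
      then show "f b \<ominus>\<^bsub>W\<^esub> g b \<in> {a \<oplus>\<^bsub>W\<^esub> b |a b. a \<in> f ` B \<and> b \<in> {(-1) \<odot>\<^bsub>W\<^esub> a |a. a \<in> g ` B}}"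
        using b by auto
    qed
    then show "(\<lambda>v. f v \<ominus>\<^bsub>W\<^esub> g v) ` B \<in> bornology W"
      by (rule W.bornology_subset[OF W.bornD(2)[OF f.lin_bounded[OF B] W.bornD(3)[OF g.lin_bounded[OF B]]]])
  qed
  then interpret d: born_lin V W "\<lambda>v. f v \<ominus>\<^bsub>W\<^esub> g v" by unfold_locales
  have "{v \<in> carrier V. f v = g v} = {v \<in> carrier V. f v \<ominus>\<^bsub>W\<^esub> g v = \<zero>\<^bsub>W\<^esub>}"
    using W.diff_zero_iff by auto
  then show ?thesis using d.kernel_closed[OF W] by simp
qed

lemma bounded_linear_map_comp:
  assumes "bounded_linear_map V W f" "bounded_linear_map W X g"
  shows "bounded_linear_map V X (\<lambda>x. g (f x))"
  using assms unfolding bounded_linear_map_def by (auto simp: image_image[symmetric] Pi_iff)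

context two_born
begin

lemma relations_carrier: "bilinear_relations V W \<subseteq> carrier L"
proof -
  have d: "(\<lambda>p. \<xi> p - \<eta> p) \<in> carrier L" if "\<xi> \<in> carrier L" "\<eta> \<in> carrier L" for \<xi> \<eta>
    using L.M.minus_closed[OF that] L_minus[OF that] by simp
  show ?thesis unfolding bilinear_relations_def
    by (intro Un_least subsetI; elim CollectE exE conjE; hypsubst;
        intro d single_carrier L_carrier_smult V.M.a_closed W.M.a_closed V.smult_l W.smult_l; assumption)
qed

lemma bilinear_kernel_closed: "closed_subspace L (bilinear_kernel V W)"
  unfolding bilinear_kernel_def by (rule L.closed_span_closed[OF relations_carrier])

sublocale T: born_quot L "tensor_space V W" "\<lambda>\<xi>. bilinear_kernel V W +>\<^bsub>L\<^esub> \<xi>" "bilinear_kernel V W"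
  unfolding tensor_space_def
  by (rule L.quotient_space_quot[OF L.closed_subspace_submodule[OF bilinear_kernel_closed]])

lemma T_complete: "complete_born_space (tensor_space V W)"
  by (rule T.Q_complete[OF L_complete bilinear_kernel_closed])

lemma relations_kernel: "bilinear_relations V W \<subseteq> bilinear_kernel V W"
  unfolding bilinear_kernel_def by (rule L.closed_span_superset)

lemma tensor_eqI:
  assumes "\<xi> \<in> carrier L" "\<eta> \<in> carrier L" "(\<lambda>p. \<xi> p - \<eta> p) \<in> bilinear_relations V W"
  shows "bilinear_kernel V W +>\<^bsub>L\<^esub> \<xi> = bilinear_kernel V W +>\<^bsub>L\<^esub> \<eta>"
  using T.pi_eq_iff[OF assms(1,2)] L_minus[OF assms(1,2)] subsetD[OF relations_kernel assms(3)] by simp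

lemma tensor_carrier: "v \<in> carrier V \<Longrightarrow> w \<in> carrier W \<Longrightarrow> tensor V W v w \<in> carrier (tensor_space V W)"
  unfolding tensor_def by (rule T.pi.lin_carrier[OF single_carrier])

lemma tensor_add_left:
  assumes "v \<in> carrier V" "v' \<in> carrier V" "w \<in> carrier W"
  shows "tensor V W (v \<oplus>\<^bsub>V\<^esub> v') w = tensor V W v w \<oplus>\<^bsub>tensor_space V W\<^esub> tensor V W v' w"
  unfolding tensor_def T.Qadd[OF single_carrier[OF assms(1,3)] single_carrier[OF assms(2,3)], symmetric]
proof (rule tensor_eqI)
  show "(\<lambda>p. single (v \<oplus>\<^bsub>V\<^esub> v') w p - (single v w \<oplus>\<^bsub>L\<^esub> single v' w) p) \<in> bilinear_relations V W"
    unfolding L_simps diff_diff_eq[symmetric] bilinear_relations_def using assms by blast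
qed (use assms in \<open>auto intro: single_carrier L.M.a_closed\<close>)

lemma tensor_add_right:
  assumes "v \<in> carrier V" "w \<in> carrier W" "w' \<in> carrier W"
  shows "tensor V W v (w \<oplus>\<^bsub>W\<^esub> w') = tensor V W v w \<oplus>\<^bsub>tensor_space V W\<^esub> tensor V W v w'"
  unfolding tensor_def T.Qadd[OF single_carrier[OF assms(1,2)] single_carrier[OF assms(1,3)], symmetric]
proof (rule tensor_eqI)
  show "(\<lambda>p. single v (w \<oplus>\<^bsub>W\<^esub> w') p - (single v w \<oplus>\<^bsub>L\<^esub> single v w') p) \<in> bilinear_relations V W"
    unfolding L_simps diff_diff_eq[symmetric] bilinear_relations_def using assms by blast
qed (use assms in \<open>auto intro: single_carrier L.M.a_closed\<close>)

lemma tensor_smult_left: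
  assumes "v \<in> carrier V" "w \<in> carrier W"
  shows "tensor V W (c \<odot>\<^bsub>V\<^esub> v) w = c \<odot>\<^bsub>tensor_space V W\<^esub> tensor V W v w"
  unfolding tensor_def T.Qsmult[OF single_carrier[OF assms], symmetric]
proof (rule tensor_eqI)
  show "(\<lambda>p. single (c \<odot>\<^bsub>V\<^esub> v) w p - (c \<odot>\<^bsub>L\<^esub> single v w) p) \<in> bilinear_relations V W"
    unfolding L_simps bilinear_relations_def using assms by blast
qed (use assms in \<open>auto intro: single_carrier L.smult_l\<close>)

lemma tensor_smult_right:
  assumes "v \<in> carrier V" "w \<in> carrier W"
  shows "tensor V W v (c \<odot>\<^bsub>W\<^esub> w) = c \<odot>\<^bsub>tensor_space V W\<^esub> tensor V W v w"
  unfolding tensor_def T.Qsmult[OF single_carrier[OF assms], symmetric]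
proof (rule tensor_eqI)
  show "(\<lambda>p. single v (c \<odot>\<^bsub>W\<^esub> w) p - (c \<odot>\<^bsub>L\<^esub> single v w) p) \<in> bilinear_relations V W"
    unfolding L_simps bilinear_relations_def using assms by blast
qed (use assms in \<open>auto intro: single_carrier L.smult_l\<close>)

lemma tensor_bounded:
  assumes "D \<in> bornology V" "E \<in> bornology W"
  shows "{tensor V W a b |a b. a \<in> D \<and> b \<in> E} \<in> bornology (tensor_space V W)"
proof -
  have "(\<lambda>(a, b). single a b) ` (D \<times> E) \<subseteq> sball D E 1"
    by (rule image_subsetI) (use sball_single in auto)
  then have "(\<lambda>(a, b). single a b) ` (D \<times> E) \<in> bornology L" by (rule L_bornologyI[OF assms])
  then have "(\<lambda>\<xi>. bilinear_kernel V W +>\<^bsub>L\<^esub> \<xi>) ` (\<lambda>(a, b). single a b) ` (D \<times> E) \<in> bornology (tensor_space V W)"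
    by (rule T.pi.lin_bounded)
  also have "(\<lambda>\<xi>. bilinear_kernel V W +>\<^bsub>L\<^esub> \<xi>) ` (\<lambda>(a, b). single a b) ` (D \<times> E)
      = (\<lambda>(a, b). tensor V W a b) ` (D \<times> E)"
    unfolding image_image by (rule image_cong) (auto simp: tensor_def)
  finally show ?thesis unfolding setcompr2' .
qed

lemma tensor_bilinear: "bounded_bilinear_map V W (tensor_space V W) (tensor V W)"
  unfolding bounded_bilinear_map_def
  using tensor_carrier tensor_add_left tensor_add_right tensor_smult_left tensor_smult_right tensor_bounded
  by simp

lemma T_lift:
  assumes X: "complete_born_space X" and f: "bounded_bilinear_map V W X f"
  shows "\<exists>g. bounded_linear_map (tensor_space V W) X g \<and>
    (\<forall>v\<in>carrier V. \<forall>w\<in>carrier W. g (tensor V W v w) = f v w) \<and>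
    (\<forall>D E K C \<xi>. D \<in> bornology V \<and> E \<in> bornology W \<and> K \<in> bornology X \<and> completant X K
       \<and> (\<lambda>(v, w). f v w) ` (D \<times> E) \<subseteq> K \<and> \<xi> \<in> sball D E C
       \<longrightarrow> g (bilinear_kernel V W +>\<^bsub>L\<^esub> \<xi>) \<in> born_vs.scl X (\<bar>C\<bar> + 1) K)"
proof -
  interpret X: complete_vs X by (rule complete_vsI[OF X])
  note fD = bounded_bilinear_mapD[OF f]
  define h where "h p = (if p \<in> carrier V \<times> carrier W then f (fst p) (snd p) else \<zero>\<^bsub>X\<^esub>)" for p
  have hf: "h ` (D \<times> E) = (\<lambda>(a, b). f a b) ` (D \<times> E)" if b: "D \<in> bornology V" "E \<in> bornology W" for D E
    by (rule image_cong[OF refl])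
      (use V.bornology_carrier[OF b(1)] W.bornology_carrier[OF b(2)] in \<open>auto simp: h_def\<close>)
  interpret F: free_lift V W X h
  proof
    show "h p \<in> carrier X" for p using fD(1) by (auto simp: h_def)
    fix D E assume b: "D \<in> bornology V" "E \<in> bornology W"
    show "h ` (D \<times> E) \<in> bornology X" using fD(6)[OF b] hf[OF b] by simp
  qed
  from F.free_lift obtain g where g: "bounded_linear_map L X g" "\<And>v w. g (single v w) = h (v, w)"
    and gK: "\<And>D E K C \<xi>. D \<in> bornology V \<Longrightarrow> E \<in> bornology W \<Longrightarrow> K \<in> bornology X \<Longrightarrow> completant X K
       \<Longrightarrow> h ` (D \<times> E) \<subseteq> K \<Longrightarrow> \<xi> \<in> sball D E C \<Longrightarrow> g \<xi> \<in> X.scl (\<bar>C\<bar> + 1) K" by auto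
  interpret g: born_lin L X g by unfold_locales (rule g)
  have gs: "g (single v w) = f v w" if "v \<in> carrier V" "w \<in> carrier W" for v w
    using g(2)[of v w] that by (simp add: h_def)
  have gd: "g (\<lambda>p. \<xi> p - \<eta> p) = g \<xi> \<ominus>\<^bsub>X\<^esub> g \<eta>" if "\<xi> \<in> carrier L" "\<eta> \<in> carrier L" for \<xi> \<eta>
    using g.lin_diff[OF that] L_minus[OF that] by simp
  have dc: "(\<lambda>p. \<xi> p - \<eta> p) \<in> carrier L" if "\<xi> \<in> carrier L" "\<eta> \<in> carrier L" for \<xi> \<eta>
    using L.M.minus_closed[OF that] L_minus[OF that] by simp
  have gm: "g (\<lambda>p. c * \<xi> p) = c \<odot>\<^bsub>X\<^esub> g \<xi>" if "\<xi> \<in> carrier L" for c \<xi>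
    using g.lin_smult[OF that, of c] by (simp add: L_simps)
  have zero: "g r = \<zero>\<^bsub>X\<^esub>" if r: "r \<in> bilinear_relations V W" for r
    using r unfolding bilinear_relations_def
  proof (elim UnE CollectE exE conjE)
    fix v v' w assume c: "v \<in> carrier V" "v' \<in> carrier V" "w \<in> carrier W"
      and r: "r = (\<lambda>p. single (v \<oplus>\<^bsub>V\<^esub> v') w p - single v w p - single v' w p)"
    have "g r = g (single (v \<oplus>\<^bsub>V\<^esub> v') w) \<ominus>\<^bsub>X\<^esub> g (single v w) \<ominus>\<^bsub>X\<^esub> g (single v' w)"
      using c by (simp add: r gd single_carrier dc)
    also have "\<dots> = \<zero>\<^bsub>X\<^esub>"
      using c by (simp add: gs fD(1,2) X.add_diff_self X.diff_zero_iff)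
    finally show ?thesis .
  next
    fix v w w' assume c: "v \<in> carrier V" "w \<in> carrier W" "w' \<in> carrier W"
      and r: "r = (\<lambda>p. single v (w \<oplus>\<^bsub>W\<^esub> w') p - single v w p - single v w' p)"
    have "g r = g (single v (w \<oplus>\<^bsub>W\<^esub> w')) \<ominus>\<^bsub>X\<^esub> g (single v w) \<ominus>\<^bsub>X\<^esub> g (single v w')"
      using c by (simp add: r gd single_carrier dc)
    also have "\<dots> = \<zero>\<^bsub>X\<^esub>"
      using c by (simp add: gs fD(1,3) X.add_diff_self X.diff_zero_iff)
    finally show ?thesis .
  next
    fix c v w assume c: "v \<in> carrier V" "w \<in> carrier W"
      and r: "r = (\<lambda>p. single (c \<odot>\<^bsub>V\<^esub> v) w p - c * single v w p)"
    then show ?thesis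
      by (simp add: r gd gm single_carrier L_carrier_smult gs fD(1,4) X.M.minus_eq X.M.r_neg)
  next
    fix c v w assume c: "v \<in> carrier V" "w \<in> carrier W"
      and r: "r = (\<lambda>p. single v (c \<odot>\<^bsub>W\<^esub> w) p - c * single v w p)"
    then show ?thesis
      by (simp add: r gd gm single_carrier L_carrier_smult gs fD(1,5) X.M.minus_eq X.M.r_neg)
  qed
  have "bilinear_kernel V W \<subseteq> {\<xi> \<in> carrier L. g \<xi> = \<zero>\<^bsub>X\<^esub>}"
    unfolding bilinear_kernel_def
    by (rule L.closed_span_least[OF g.kernel_closed[OF X]]) (use zero relations_carrier in auto)
  then have "g \<xi> = \<zero>\<^bsub>X\<^esub>" if "\<xi> \<in> bilinear_kernel V W" for \<xi> using that by auto
  from T.quotient_lift[OF X.born g(1) this]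
  obtain k where k: "bounded_linear_map (tensor_space V W) X k"
    "\<And>\<xi>. \<xi> \<in> carrier L \<Longrightarrow> k (bilinear_kernel V W +>\<^bsub>L\<^esub> \<xi>) = g \<xi>" by auto
  have kK: "k (bilinear_kernel V W +>\<^bsub>L\<^esub> \<xi>) \<in> X.scl (\<bar>C\<bar> + 1) K"
    if "D \<in> bornology V \<and> E \<in> bornology W \<and> K \<in> bornology X \<and> completant X K
       \<and> (\<lambda>(v, w). f v w) ` (D \<times> E) \<subseteq> K \<and> \<xi> \<in> sball D E C" for D E K C \<xi>
  proof -
    have "\<xi> \<in> carrier L" by (rule L_carrierI[of D E]) (use that in auto)
    then show ?thesis using gK[of D E K \<xi> C] hf[of D E] that by (simp add: k(2))
  qed
  show ?thesis
  proof (intro exI[of _ k] conjI)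
    show "bounded_linear_map (tensor_space V W) X k" by (rule k)
    show "\<forall>v\<in>carrier V. \<forall>w\<in>carrier W. k (tensor V W v w) = f v w"
      by (simp add: tensor_def single_carrier gs k(2))
  qed (intro allI impI, rule kK, assumption)
qed

lemma T_ext:
  assumes X: "complete_born_space X" and g: "bounded_linear_map (tensor_space V W) X g"
    and g': "bounded_linear_map (tensor_space V W) X g'"
    and eq: "\<And>v w. v \<in> carrier V \<Longrightarrow> w \<in> carrier W \<Longrightarrow> g (tensor V W v w) = g' (tensor V W v w)"
    and t: "t \<in> carrier (tensor_space V W)"
  shows "g t = g' t"
proof -
  let ?\<pi> = "\<lambda>\<xi>. bilinear_kernel V W +>\<^bsub>L\<^esub> \<xi>"
  let ?H = "{\<xi> \<in> carrier L. g (?\<pi> \<xi>) = g' (?\<pi> \<xi>)}"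
  obtain \<xi> where x: "\<xi> \<in> carrier L" "t = ?\<pi> \<xi>" using t unfolding T.Qcarrier by (rule imageE)
  have cl: "closed_subspace L ?H"
    by (rule closed_equalizer[OF L_born_vector_space X
          bounded_linear_map_comp[OF T.pi_linear g] bounded_linear_map_comp[OF T.pi_linear g']])
  have "\<xi> \<in> ?H"
    by (rule L_dense[OF cl _ x(1)]) (simp add: single_carrier eq[unfolded tensor_def])
  then show ?thesis using x by simp
qed

end

lemma two_bornI: "complete_born_space V \<Longrightarrow> complete_born_space W \<Longrightarrow> two_born V W"
  by (simp add: two_born_def born_vs_def complete_born_space_def)

theorem complete_tensor_space:
  "complete_born_space V \<Longrightarrow> complete_born_space W \<Longrightarrow> complete_born_space (tensor_space V W)"
  by (rule two_born.T_complete[OF two_bornI])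

theorem bounded_bilinear_tensor:
  "complete_born_space V \<Longrightarrow> complete_born_space W
    \<Longrightarrow> bounded_bilinear_map V W (tensor_space V W) (tensor V W)"
  by (rule two_born.tensor_bilinear[OF two_bornI])

theorem tensor_space_lift:
  assumes "complete_born_space V" "complete_born_space W" "complete_born_space X"
    and "bounded_bilinear_map V W X f"
  shows "bounded_linear_map (tensor_space V W) X (tensor_lift V W X f)"
    and "\<And>v w. v \<in> carrier V \<Longrightarrow> w \<in> carrier W \<Longrightarrow> tensor_lift V W X f (tensor V W v w) = f v w"
proof -
  have "\<exists>g. bounded_linear_map (tensor_space V W) X g \<and>
    (\<forall>v\<in>carrier V. \<forall>w\<in>carrier W. g (tensor V W v w) = f v w)"
    using two_born.T_lift[OF two_bornI[OF assms(1,2)] assms(3,4)] by (elim exE conjE) (intro exI conjI)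
  from someI_ex[OF this]
  show "bounded_linear_map (tensor_space V W) X (tensor_lift V W X f)"
    and "\<And>v w. v \<in> carrier V \<Longrightarrow> w \<in> carrier W \<Longrightarrow> tensor_lift V W X f (tensor V W v w) = f v w"
    unfolding tensor_lift_def by simp_all
qed

lemma tensor_lift_bound:
  assumes "complete_born_space V" "complete_born_space W" "complete_born_space X"
    and "bounded_bilinear_map V W X f"
    and "D \<in> bornology V" "E \<in> bornology W" "K \<in> bornology X" "completant X K"
    and "(\<lambda>(v, w). f v w) ` (D \<times> E) \<subseteq> K" "\<xi> \<in> sball D E C"
  shows "tensor_lift V W X f (bilinear_kernel V W +>\<^bsub>summable_families V W\<^esub> \<xi>) \<in> born_vs.scl X (\<bar>C\<bar> + 1) K"
proof -
  interpret two_born V W by (rule two_bornI[OF assms(1,2)])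
  from T_lift[OF assms(3,4)] obtain g where g: "bounded_linear_map (tensor_space V W) X g"
    "\<And>v w. v \<in> carrier V \<Longrightarrow> w \<in> carrier W \<Longrightarrow> g (tensor V W v w) = f v w"
    "g (bilinear_kernel V W +>\<^bsub>L\<^esub> \<xi>) \<in> born_vs.scl X (\<bar>C\<bar> + 1) K" using assms(5-) by blast
  have "tensor_lift V W X f (bilinear_kernel V W +>\<^bsub>L\<^esub> \<xi>) = g (bilinear_kernel V W +>\<^bsub>L\<^esub> \<xi>)"
  proof (rule T_ext[OF assms(3) tensor_space_lift(1)[OF assms(1-4)] g(1)])
    show "bilinear_kernel V W +>\<^bsub>L\<^esub> \<xi> \<in> carrier (tensor_space V W)"
      by (rule T.pi.lin_carrier[OF L_carrierI[OF assms(5,6,10)]])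
  qed (simp add: tensor_space_lift(2)[OF assms(1-4)] g(2))
  then show ?thesis using g(3) by simp
qed

theorem tensor_space_ext:
  assumes "complete_born_space V" "complete_born_space W" "complete_born_space X"
    and "bounded_linear_map (tensor_space V W) X g" "bounded_linear_map (tensor_space V W) X g'"
    and "\<And>v w. v \<in> carrier V \<Longrightarrow> w \<in> carrier W \<Longrightarrow> g (tensor V W v w) = g' (tensor V W v w)"
    and "t \<in> carrier (tensor_space V W)"
  shows "g t = g' t"
  by (rule two_born.T_ext[OF two_bornI[OF assms(1,2)] assms(3-7)])

section \<open>Universal property of the balanced tensor product\<close>

lemma bounded_bilinear_map_comp_left:
  assumes b: "bounded_bilinear_map V W X b" and f: "bounded_linear_map U V f"
  shows "bounded_bilinear_map U W X (\<lambda>u w. b (f u) w)"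
proof -
  have "(\<lambda>(u, w). b (f u) w) ` (A \<times> B) \<in> bornology X" if "A \<in> bornology U" "B \<in> bornology W" for A B
  proof -
    have "(\<lambda>(u, w). b (f u) w) ` (A \<times> B) = (\<lambda>(v, w). b v w) ` (f ` A \<times> B)" by force
    then show ?thesis using bounded_bilinear_mapD(6)[OF b bounded_linear_mapD(4)[OF f that(1)] that(2)] by simp
  qed
  then show ?thesis
    unfolding bounded_bilinear_map_def setcompr2'
    by (simp add: bounded_bilinear_mapD[OF b] bounded_linear_mapD[OF f])
qed

lemma bounded_linear_map_left:
  assumes V: "born_vector_space W" and b: "bounded_bilinear_map V W X b" and w: "w \<in> carrier W"
  shows "bounded_linear_map V X (\<lambda>v. b v w)"
proof -
  interpret W: born_vs W by (rule born_vs.intro[OF V])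
  have "(\<lambda>v. b v w) ` A \<in> bornology X" if "A \<in> bornology V" for A
  proof -
    have "(\<lambda>v. b v w) ` A = (\<lambda>(v, w). b v w) ` (A \<times> {w})" by force
    then show ?thesis using bounded_bilinear_mapD(6)[OF b that W.bornology_single[OF w]] by simp
  qed
  then show ?thesis using w by (simp add: bounded_linear_map_def bounded_bilinear_mapD[OF b])
qed

lemma bounded_bilinear_map_comp_right:
  assumes b: "bounded_bilinear_map V W X b" and f: "bounded_linear_map U W f"
  shows "bounded_bilinear_map V U X (\<lambda>v u. b v (f u))"
proof -
  have "(\<lambda>(v, u). b v (f u)) ` (A \<times> B) \<in> bornology X" if "A \<in> bornology V" "B \<in> bornology U" for A B
  proof -
    have "(\<lambda>(v, u). b v (f u)) ` (A \<times> B) = (\<lambda>(v, w). b v w) ` (A \<times> f ` B)" by force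
    then show ?thesis using bounded_bilinear_mapD(6)[OF b that(1) bounded_linear_mapD(4)[OF f that(2)]] by simp
  qed
  then show ?thesis
    unfolding bounded_bilinear_map_def setcompr2'
    by (simp add: bounded_bilinear_mapD[OF b] bounded_linear_mapD[OF f])
qed

lemma bounded_linear_map_add:
  assumes W: "born_vector_space W" and f: "bounded_linear_map V W f" and g: "bounded_linear_map V W g"
  shows "bounded_linear_map V W (\<lambda>v. f v \<oplus>\<^bsub>W\<^esub> g v)"
  unfolding bounded_linear_map_def
proof (intro conjI ballI allI)
  interpret W: born_vs W by (rule born_vs.intro[OF W])
  note f = bounded_linear_mapD[OF f] and g = bounded_linear_mapD[OF g]
  show "(\<lambda>v. f v \<oplus>\<^bsub>W\<^esub> g v) \<in> carrier V \<rightarrow> carrier W" by (simp add: f g)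
  show "f (x \<oplus>\<^bsub>V\<^esub> y) \<oplus>\<^bsub>W\<^esub> g (x \<oplus>\<^bsub>V\<^esub> y) = f x \<oplus>\<^bsub>W\<^esub> g x \<oplus>\<^bsub>W\<^esub> (f y \<oplus>\<^bsub>W\<^esub> g y)"
    if "x \<in> carrier V" "y \<in> carrier V" for x y using that by (simp add: f g W.M.a_ac)
  show "f (c \<odot>\<^bsub>V\<^esub> x) \<oplus>\<^bsub>W\<^esub> g (c \<odot>\<^bsub>V\<^esub> x) = c \<odot>\<^bsub>W\<^esub> (f x \<oplus>\<^bsub>W\<^esub> g x)" if "x \<in> carrier V" for c x
    using that by (simp add: f g W.sdistr)
  fix B assume B: "B \<in> bornology V"
  show "(\<lambda>v. f v \<oplus>\<^bsub>W\<^esub> g v) ` B \<in> bornology W"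
    by (rule W.bornology_subset[OF W.bornD(2)[OF f(4)[OF B] g(4)[OF B]]]) auto
qed

lemma bounded_linear_map_smult:
  assumes W: "born_vector_space W" and f: "bounded_linear_map V W f"
  shows "bounded_linear_map V W (\<lambda>v. c \<odot>\<^bsub>W\<^esub> f v)"
  unfolding bounded_linear_map_def
proof (intro conjI ballI allI)
  interpret W: born_vs W by (rule born_vs.intro[OF W])
  note f = bounded_linear_mapD[OF f]
  show "(\<lambda>v. c \<odot>\<^bsub>W\<^esub> f v) \<in> carrier V \<rightarrow> carrier W" by (simp add: f)
  show "c \<odot>\<^bsub>W\<^esub> f (x \<oplus>\<^bsub>V\<^esub> y) = c \<odot>\<^bsub>W\<^esub> f x \<oplus>\<^bsub>W\<^esub> c \<odot>\<^bsub>W\<^esub> f y"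
    if "x \<in> carrier V" "y \<in> carrier V" for x y using that by (simp add: f W.sdistr)
  show "c \<odot>\<^bsub>W\<^esub> f (k \<odot>\<^bsub>V\<^esub> x) = k \<odot>\<^bsub>W\<^esub> (c \<odot>\<^bsub>W\<^esub> f x)" if "x \<in> carrier V" for k x
    using that by (simp add: f W.sassoc mult.commute)
  fix B assume B: "B \<in> bornology V"
  show "(\<lambda>v. c \<odot>\<^bsub>W\<^esub> f v) ` B \<in> bornology W"
    by (rule W.bornology_subset[OF W.bornD(3)[OF f(4)[OF B]]]) auto
qed

locale balanced =
  fixes M :: "('a, 'm) born_space_scheme" and A :: "('b, 'n) born_space_scheme"
    and N :: "('c, 'k) born_space_scheme" and r l
  assumes cM: "complete_born_space M" and cA: "complete_born_space A" and cN: "complete_born_space N"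
    and r: "bounded_bilinear_map M A M r" and l: "bounded_bilinear_map A N N l"
begin

abbreviation "MA \<equiv> tensor_space M A"
abbreviation "MN \<equiv> tensor_space M N"
abbreviation "MAN \<equiv> tensor_space MA N"

lemma cMA: "complete_born_space MA" by (rule complete_tensor_space[OF cM cA])
lemma cMN: "complete_born_space MN" by (rule complete_tensor_space[OF cM cN])
lemma cMAN: "complete_born_space MAN" by (rule complete_tensor_space[OF cMA cN])

lemma bvs: "complete_born_space V \<Longrightarrow> born_vector_space V"
  by (simp add: complete_born_space_def)

lemma bMA: "bounded_bilinear_map M A MA (tensor M A)" by (rule bounded_bilinear_tensor[OF cM cA])
lemma bMN: "bounded_bilinear_map M N MN (tensor M N)" by (rule bounded_bilinear_tensor[OF cM cN])
lemma bMAN: "bounded_bilinear_map MA N MAN (tensor MA N)" by (rule bounded_bilinear_tensor[OF cMA cN])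

lemma right_bilinear: "bounded_bilinear_map MA N MN (\<lambda>t n. tensor M N (tensor_lift M A M r t) n)"
  by (rule bounded_bilinear_map_comp_left[OF bMN tensor_space_lift(1)[OF cM cA cM r]])

lemma right_act_linear: "bounded_linear_map MAN MN (right_act M A N r)"
  unfolding right_act_def by (rule tensor_space_lift(1)[OF cMA cN cMN right_bilinear])

lemma right_act_tensor:
  assumes "m \<in> carrier M" "a \<in> carrier A" "n \<in> carrier N"
  shows "right_act M A N r (tensor MA N (tensor M A m a) n) = tensor M N (r m a) n"
  unfolding right_act_def
  using tensor_space_lift(2)[OF cMA cN cMN right_bilinear bounded_bilinear_mapD(1)[OF bMA assms(1,2)] assms(3)]
    tensor_space_lift(2)[OF cM cA cM r assms(1,2)] by simp

definition inner :: "'c \<Rightarrow> 'a \<Rightarrow> 'b \<Rightarrow> ('a \<times> 'c \<Rightarrow> complex) set" where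
  "inner n m a = tensor M N m (l a n)"

lemma inner_bilinear:
  assumes "n \<in> carrier N" shows "bounded_bilinear_map M A MN (inner n)"
  unfolding inner_def
  by (rule bounded_bilinear_map_comp_right[OF bMN bounded_linear_map_left[OF bvs[OF cN] l assms]])

lemma left_bilinear: "bounded_bilinear_map MA N MN (\<lambda>t n. tensor_lift M A MN (inner n) t)"
proof -
  let ?g = "\<lambda>n. tensor_lift M A MN (inner n)"
  interpret N: complete_vs N by (rule complete_vsI[OF cN])
  interpret MN: complete_vs MN by (rule complete_vsI[OF cMN])
  note g = tensor_space_lift[OF cM cA cMN inner_bilinear]
  note gD = bounded_linear_mapD[OF g(1)]
  note tD = bounded_bilinear_mapD[OF bMN]
  note lD = bounded_bilinear_mapD[OF l]
  have add: "?g (n \<oplus>\<^bsub>N\<^esub> n') t = ?g n t \<oplus>\<^bsub>MN\<^esub> ?g n' t"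
    if n: "n \<in> carrier N" "n' \<in> carrier N" and t: "t \<in> carrier MA" for n n' t
    by (rule tensor_space_ext[OF cM cA cMN g(1) bounded_linear_map_add[OF bvs[OF cMN] g(1) g(1)] _ t])
      (use n in \<open>simp_all add: g(2)\<close>, simp add: inner_def tD lD)
  have smult: "?g (c \<odot>\<^bsub>N\<^esub> n) t = c \<odot>\<^bsub>MN\<^esub> ?g n t" if n: "n \<in> carrier N" and t: "t \<in> carrier MA" for c n t
    by (rule tensor_space_ext[OF cM cA cMN g(1) bounded_linear_map_smult[OF bvs[OF cMN] g(1)] _ t])
      (use n in \<open>simp_all add: g(2)\<close>, simp add: inner_def tD lD)
  have bd: "(\<lambda>(t, n). ?g n t) ` (S \<times> B) \<in> bornology MN" if S: "S \<in> bornology MA" and B: "B \<in> bornology N" for S B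
  proof -
    interpret P: two_born M A by (rule two_bornI[OF cM cA])
    from S obtain S' where S': "S' \<in> bornology P.L" "S = (\<lambda>\<xi>. bilinear_kernel M A +>\<^bsub>P.L\<^esub> \<xi>) ` S'"
      unfolding P.T.Qborn by auto
    from S'(1) obtain D E C where b: "D \<in> bornology M" "E \<in> bornology A" "S' \<subseteq> sball D E C"
      unfolding P.L_bornology by auto
    let ?F = "(\<lambda>(m, n). tensor M N m n) ` (D \<times> (\<lambda>(a, n). l a n) ` (E \<times> B))"
    have "?F \<in> bornology MN" by (rule tD(6)[OF b(1) lD(6)[OF b(2) B]])
    from MN.completant_ex[OF this] obtain K where K: "K \<in> bornology MN" "?F \<subseteq> K" "completant MN K" by (elim bexE conjE)
    have "(\<lambda>(t, n). ?g n t) ` (S \<times> B) \<subseteq> MN.scl (\<bar>C\<bar> + 1) K"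
    proof (rule image_subsetI)
      fix z assume "z \<in> S \<times> B"
      then obtain \<xi> n where z: "z = (bilinear_kernel M A +>\<^bsub>P.L\<^esub> \<xi>, n)" "\<xi> \<in> S'" "n \<in> B" using S'(2) by auto
      have n: "n \<in> carrier N" using N.bornology_carrier[OF B] z(3) by (rule subsetD)
      have "(\<lambda>(m, a). inner n m a) ` (D \<times> E) \<subseteq> ?F"
      proof (rule image_subsetI)
        fix p assume "p \<in> D \<times> E"
        then show "(\<lambda>(m, a). inner n m a) p \<in> ?F"
          using z(3) by (intro image_eqI[of _ _ "(fst p, l (snd p) n)"]) (auto simp: inner_def)
      qed
      then have "(\<lambda>(m, a). inner n m a) ` (D \<times> E) \<subseteq> K" using K(2) by (rule subset_trans)
      from tensor_lift_bound[OF cM cA cMN inner_bilinear[OF n] b(1,2) K(1,3) this subsetD[OF b(3) z(2)]]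
      show "(\<lambda>(t, n). ?g n t) z \<in> MN.scl (\<bar>C\<bar> + 1) K" by (simp add: z(1))
    qed
    moreover have "MN.scl (\<bar>C\<bar> + 1) K \<in> bornology MN" unfolding MN.scl_def by (rule MN.bornD(3)[OF K(1)])
    ultimately show ?thesis using MN.bornology_subset by simp
  qed
  show ?thesis
    unfolding bounded_bilinear_map_def setcompr2'
    by (intro conjI ballI allI add smult bd) (simp_all add: gD)
qed

lemma left_act_linear: "bounded_linear_map MAN MN (left_act M A N l)"
  unfolding left_act_def by (rule tensor_space_lift(1)[OF cMA cN cMN left_bilinear[unfolded inner_def]])

lemma left_act_tensor:
  assumes "m \<in> carrier M" "a \<in> carrier A" "n \<in> carrier N"
  shows "left_act M A N l (tensor MA N (tensor M A m a) n) = tensor M N m (l a n)"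
  unfolding left_act_def
  using tensor_space_lift(2)[OF cMA cN cMN left_bilinear[unfolded inner_def] bounded_bilinear_mapD(1)[OF bMA assms(1,2)] assms(3)]
    tensor_space_lift(2)[OF cM cA cMN inner_bilinear[OF assms(3), unfolded inner_def] assms(1,2)] by simp

abbreviation "acts \<equiv> {right_act M A N r x \<ominus>\<^bsub>MN\<^esub> left_act M A N l x |x. x \<in> carrier MAN}"

sublocale MN: complete_vs MN by (rule complete_vsI[OF cMN])

lemma acts_carrier: "acts \<subseteq> carrier MN"
  using bounded_linear_mapD(1)[OF right_act_linear] bounded_linear_mapD(1)[OF left_act_linear] by auto

lemma balanced_kernel_eq: "balanced_kernel M A N r l = closed_span MN acts"
  by (simp add: balanced_kernel_def coequalizer_kernel_def)

lemma balanced_kernel_closed: "closed_subspace MN (balanced_kernel M A N r l)"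
  unfolding balanced_kernel_eq by (rule MN.closed_span_closed[OF acts_carrier])

sublocale B: born_quot MN "balanced_tensor_space M A N r l"
  "\<lambda>x. balanced_kernel M A N r l +>\<^bsub>MN\<^esub> x" "balanced_kernel M A N r l"
  unfolding balanced_tensor_space_def
  by (rule MN.quotient_space_quot[OF MN.closed_subspace_submodule[OF balanced_kernel_closed]])

theorem complete_balanced_tensor_space: "complete_born_space (balanced_tensor_space M A N r l)"
  by (rule B.Q_complete[OF cMN balanced_kernel_closed])

theorem bounded_bilinear_balanced_tensor:
  "bounded_bilinear_map M N (balanced_tensor_space M A N r l) (balanced_tensor M A N r l)"
proof -
  note tD = bounded_bilinear_mapD[OF bMN]
  note pD = bounded_linear_mapD[OF B.pi_linear]
  have "(\<lambda>(m, n). balanced_tensor M A N r l m n) ` (S \<times> T) \<in> bornology (balanced_tensor_space M A N r l)"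
    if "S \<in> bornology M" "T \<in> bornology N" for S T
  proof -
    have "(\<lambda>(m, n). balanced_tensor M A N r l m n) ` (S \<times> T)
       = (\<lambda>x. balanced_kernel M A N r l +>\<^bsub>MN\<^esub> x) ` (\<lambda>(m, n). tensor M N m n) ` (S \<times> T)"
      unfolding image_image by (rule image_cong) (auto simp: balanced_tensor_def)
    then show ?thesis using pD(4)[OF tD(6)[OF that]] by simp
  qed
  then show ?thesis
    unfolding bounded_bilinear_map_def setcompr2' by (simp add: balanced_tensor_def tD pD)
qed

theorem balanced_tensor_balanced:
  assumes "m \<in> carrier M" "a \<in> carrier A" "n \<in> carrier N"
  shows "balanced_tensor M A N r l (r m a) n = balanced_tensor M A N r l m (l a n)"
proof -
  let ?x = "tensor MA N (tensor M A m a) n"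
  have x: "?x \<in> carrier MAN"
    using assms by (intro bounded_bilinear_mapD(1)[OF bMAN] bounded_bilinear_mapD(1)[OF bMA])
  have "right_act M A N r ?x \<ominus>\<^bsub>MN\<^esub> left_act M A N l ?x \<in> balanced_kernel M A N r l"
    unfolding balanced_kernel_eq by (rule subsetD[OF MN.closed_span_superset]) (use x in blast)
  then show ?thesis
    unfolding balanced_tensor_def
    using B.pi_eq_iff[OF bounded_linear_mapD(1)[OF right_act_linear x] bounded_linear_mapD(1)[OF left_act_linear x]]
    by (simp add: right_act_tensor[OF assms] left_act_tensor[OF assms])
qed

theorem balanced_tensor_lift:
  assumes X: "complete_born_space X" and f: "bounded_bilinear_map M N X f"
    and bal: "\<And>m a n. m \<in> carrier M \<Longrightarrow> a \<in> carrier A \<Longrightarrow> n \<in> carrier N \<Longrightarrow> f (r m a) n = f m (l a n)"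
  shows "\<exists>g. bounded_linear_map (balanced_tensor_space M A N r l) X g \<and>
    (\<forall>m\<in>carrier M. \<forall>n\<in>carrier N. g (balanced_tensor M A N r l m n) = f m n)"
proof -
  let ?F = "tensor_lift M N X f"
  let ?R = "right_act M A N r" and ?L = "left_act M A N l"
  note F = tensor_space_lift[OF cM cN X f]
  interpret X: complete_vs X by (rule complete_vsI[OF X])
  interpret F: born_lin MN X ?F by unfold_locales (rule F(1))
  note rD = bounded_bilinear_mapD[OF r] and lD = bounded_bilinear_mapD[OF l]
  note FR = bounded_linear_map_comp[OF right_act_linear F(1)]
  note FL = bounded_linear_map_comp[OF left_act_linear F(1)]
  have eq1: "?F (?R (tensor MA N t n)) = ?F (?L (tensor MA N t n))"
    if t: "t \<in> carrier MA" and n: "n \<in> carrier N" for t n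
  proof (rule tensor_space_ext[OF cM cA X _ _ _ t])
    note ln = bounded_linear_map_left[OF bvs[OF cN] bMAN n]
    show "bounded_linear_map MA X (\<lambda>t. ?F (?R (tensor MA N t n)))" by (rule bounded_linear_map_comp[OF ln FR])
    show "bounded_linear_map MA X (\<lambda>t. ?F (?L (tensor MA N t n)))" by (rule bounded_linear_map_comp[OF ln FL])
    fix m a assume "m \<in> carrier M" "a \<in> carrier A"
    then show "?F (?R (tensor MA N (tensor M A m a) n)) = ?F (?L (tensor MA N (tensor M A m a) n))"
      using n by (simp add: right_act_tensor left_act_tensor F(2) rD(1) lD(1) bal)
  qed
  have eq: "?F (?R x) = ?F (?L x)" if "x \<in> carrier MAN" for x
    by (rule tensor_space_ext[OF cMA cN X FR FL eq1 that])
  have "balanced_kernel M A N r l \<subseteq> {x \<in> carrier MN. ?F x = \<zero>\<^bsub>X\<^esub>}"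
    unfolding balanced_kernel_eq
  proof (rule MN.closed_span_least[OF F.kernel_closed[OF X]], rule subsetI)
    fix y assume y: "y \<in> acts"
    then obtain x where x: "x \<in> carrier MAN" "y = ?R x \<ominus>\<^bsub>MN\<^esub> ?L x" by auto
    note c = bounded_linear_mapD(1)[OF right_act_linear x(1)] bounded_linear_mapD(1)[OF left_act_linear x(1)]
    have "?F y = \<zero>\<^bsub>X\<^esub>"
      unfolding x(2) F.lin_diff[OF c] using eq[OF x(1)] X.diff_zero_iff F.lin_carrier c by simp
    then show "y \<in> {x \<in> carrier MN. ?F x = \<zero>\<^bsub>X\<^esub>}" using subsetD[OF acts_carrier y] by simp
  qed
  then have "?F x = \<zero>\<^bsub>X\<^esub>" if "x \<in> balanced_kernel M A N r l" for x using that by auto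
  from B.quotient_lift[OF X.born F(1) this]
  obtain g where g: "bounded_linear_map (balanced_tensor_space M A N r l) X g"
    "\<And>x. x \<in> carrier MN \<Longrightarrow> g (balanced_kernel M A N r l +>\<^bsub>MN\<^esub> x) = ?F x" by auto
  then show ?thesis
    by (intro exI[of _ g]) (simp add: balanced_tensor_def bounded_bilinear_mapD(1)[OF bMN] F(2))
qed

theorem balanced_tensor_ext:
  assumes X: "complete_born_space X"
    and g: "bounded_linear_map (balanced_tensor_space M A N r l) X g"
    and g': "bounded_linear_map (balanced_tensor_space M A N r l) X g'"
    and eq: "\<And>m n. m \<in> carrier M \<Longrightarrow> n \<in> carrier N
      \<Longrightarrow> g (balanced_tensor M A N r l m n) = g' (balanced_tensor M A N r l m n)"
    and t: "t \<in> carrier (balanced_tensor_space M A N r l)"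
  shows "g t = g' t"
proof -
  obtain x where x: "x \<in> carrier MN" "t = balanced_kernel M A N r l +>\<^bsub>MN\<^esub> x"
    using t unfolding B.Qcarrier by (rule imageE)
  show ?thesis unfolding x(2)
    by (rule tensor_space_ext[OF cM cN X bounded_linear_map_comp[OF B.pi_linear g]
          bounded_linear_map_comp[OF B.pi_linear g'] _ x(1)]) (rule eq[unfolded balanced_tensor_def])
qed

end

end

theory Submission
  imports Defs
begin

text \<open>
  Since the object space of the groupoid is compact, the algebra has a unit \<open>1\<close>, and for a unital
  bimodule \<open>M\<close> the map \<open>m \<mapsto> 1 \<otimes> m\<close> inverts the action map; so every closed ideal that is complete
  is automatically smooth.

  An element \<open>a\<close> of a nonzero ideal \<open>I\<close> has finite support in \<open>\<int>\<close>, and after a translation its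
  component \<open>a\<^sub>0\<close> over \<open>0\<close> is nonzero.  Conjugation by the function \<open>exp (2 \<pi> i x)\<close> multiplies the
  component over \<open>k\<close> by \<open>exp (2 \<pi> i k \<theta>)\<close>; for irrational \<open>\<theta>\<close> these numbers are distinct from \<open>1\<close>
  for \<open>k \<noteq> 0\<close>, so the other components can be removed one at a time and \<open>a\<^sub>0\<close> itself lies in \<open>I\<close>.
  Orbits of the rotation are dense and the circle is compact, so a finite sum of translates of
  \<open>\<bar>a\<^sub>0\<bar>\<^sup>2\<close> is a strictly positive function in \<open>I\<close>, which is invertible.
\<close>

section \<open>Smooth functions\<close>

abbreviation vderiv :: "(real \<Rightarrow> complex) \<Rightarrow> real \<Rightarrow> complex" where
  "vderiv f \<equiv> \<lambda>t. vector_derivative f (at t)"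

lemma nth_derivative_0 [simp]: "nth_derivative 0 f = f"
  by (simp add: nth_derivative_def)

lemma nth_derivative_Suc: "nth_derivative (Suc n) f = vderiv (nth_derivative n f)"
  by (simp add: nth_derivative_def)

text \<open>Peels off the innermost derivative rather than the outermost, which suits inductions
  that generalise over the function.\<close>

lemma nth_derivative_Suc': "nth_derivative (Suc n) f = nth_derivative n (vderiv f)"
  unfolding nth_derivative_def funpow_Suc_right by simp

lemma smooth_fun_iff:
  "smooth_fun f \<longleftrightarrow> (\<forall>t. f differentiable at t) \<and> smooth_fun (vderiv f)"
proof
  assume f: "smooth_fun f"
  have "f differentiable at t" for t
    using f[unfolded smooth_fun_def, rule_format, of 0 t] by simp
  moreover have "nth_derivative n (vderiv f) differentiable at t" for n t
    using f[unfolded smooth_fun_def, rule_format, of "Suc n" t] by (simp add: nth_derivative_Suc')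
  ultimately show "(\<forall>t. f differentiable at t) \<and> smooth_fun (vderiv f)"
    by (simp add: smooth_fun_def)
next
  assume f: "(\<forall>t. f differentiable at t) \<and> smooth_fun (vderiv f)"
  show "smooth_fun f"
    unfolding smooth_fun_def
  proof (intro allI)
    fix n t show "nth_derivative n f differentiable at t"
      using f by (cases n) (simp_all add: nth_derivative_Suc' smooth_fun_def)
  qed
qed

lemma smooth_funD:
  assumes "smooth_fun f"
  shows "(f has_vector_derivative vderiv f t) (at t)" "smooth_fun (vderiv f)"
  using assms smooth_fun_iff[of f] by (auto simp: vector_derivative_works[symmetric])

lemma smooth_fun_nth_derivative:
  assumes "smooth_fun f" shows "smooth_fun (nth_derivative n f)"
  using assms by (induction n) (auto simp: nth_derivative_Suc smooth_funD(2))

lemma smooth_fun_continuous: "smooth_fun f \<Longrightarrow> continuous_on S f"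
  by (meson continuous_at_imp_continuous_on has_vector_derivative_continuous smooth_funD(1))

lemma vderiv_eqI: "(\<And>t. (f has_vector_derivative f' t) (at t)) \<Longrightarrow> vderiv f = f'"
  by (auto intro!: vector_derivative_at)

text \<open>
  The derivatives of products and inverses involve the factors themselves, so closure of smooth
  functions under these operations is shown order by order.
\<close>

primrec smooth_upto :: "nat \<Rightarrow> (real \<Rightarrow> complex) \<Rightarrow> bool" where
  "smooth_upto 0 f = True"
| "smooth_upto (Suc n) f = ((\<forall>t. f differentiable at t) \<and> smooth_upto n (vderiv f))"

lemma smooth_fun_upto: "smooth_fun f \<longleftrightarrow> (\<forall>n. smooth_upto n f)"
proof
  show "\<forall>n. smooth_upto n f" if "smooth_fun f"
  proof
    fix n show "smooth_upto n f" using that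
    proof (induction n arbitrary: f)
      case (Suc n)
      then show ?case using smooth_fun_iff[of f] by simp
    qed simp
  qed
  assume f: "\<forall>n. smooth_upto n f"
  have "nth_derivative n f differentiable at t" if "smooth_upto (Suc n) f" for n t f
    using that by (induction n arbitrary: f) (auto simp: nth_derivative_Suc')
  then show "smooth_fun f" using f unfolding smooth_fun_def by blast
qed

lemma smooth_upto_SucI:
  assumes "\<And>t. (f has_vector_derivative f' t) (at t)" "smooth_upto n f'"
  shows "smooth_upto (Suc n) f"
proof -
  have "vderiv f = f'" using assms(1) by (rule vderiv_eqI)
  moreover have "f differentiable at t" for t using assms(1) by (rule differentiableI_vector)
  ultimately show ?thesis using assms(2) by simp
qed

lemma smooth_upto_SucD:
  assumes "smooth_upto (Suc n) f"
  shows "(f has_vector_derivative vderiv f t) (at t)" "smooth_upto n (vderiv f)"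
  using assms by (auto simp: vector_derivative_works[symmetric])

lemma smooth_upto_Suc: "smooth_upto (Suc n) f \<Longrightarrow> smooth_upto n f"
proof (induction n arbitrary: f)
  case (Suc n)
  show ?case
    by (rule smooth_upto_SucI[OF smooth_upto_SucD(1)[OF Suc.prems] Suc.IH[OF smooth_upto_SucD(2)[OF Suc.prems]]])
qed simp

lemma smooth_upto_add: "smooth_upto n f \<Longrightarrow> smooth_upto n g \<Longrightarrow> smooth_upto n (\<lambda>t. f t + g t)"
proof (induction n arbitrary: f g)
  case (Suc n)
  note d = smooth_upto_SucD[OF Suc.prems(1)] smooth_upto_SucD[OF Suc.prems(2)]
  show ?case
    by (rule smooth_upto_SucI[OF has_vector_derivative_add[OF d(1,3)] Suc.IH[OF d(2,4)]])
qed simp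

lemma smooth_upto_mult: "smooth_upto n f \<Longrightarrow> smooth_upto n g \<Longrightarrow> smooth_upto n (\<lambda>t. f t * g t)"
proof (induction n arbitrary: f g)
  case (Suc n)
  note d = smooth_upto_SucD[OF Suc.prems(1)] smooth_upto_SucD[OF Suc.prems(2)]
  \<comment> \<open>Each term of the product rule keeps one factor undifferentiated;
    \<open>smooth_upto_Suc\<close> lowers its order to that of the induction hypothesis.\<close>
  show ?case
    by (rule smooth_upto_SucI[OF has_vector_derivative_mult[OF d(1,3)] smooth_upto_add])
      (rule Suc.IH[OF smooth_upto_Suc[OF Suc.prems(1)] d(4)] Suc.IH[OF d(2) smooth_upto_Suc[OF Suc.prems(2)]])+
qed simp

lemma smooth_upto_const: "smooth_upto n (\<lambda>t. c)"
  by (induction n arbitrary: c) auto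

lemma smooth_fun_const: "smooth_fun (\<lambda>t. c)"
  by (simp add: smooth_fun_upto smooth_upto_const)

lemma smooth_fun_add: "smooth_fun f \<Longrightarrow> smooth_fun g \<Longrightarrow> smooth_fun (\<lambda>t. f t + g t)"
  and smooth_fun_mult: "smooth_fun f \<Longrightarrow> smooth_fun g \<Longrightarrow> smooth_fun (\<lambda>t. f t * g t)"
  by (simp_all add: smooth_fun_upto smooth_upto_add smooth_upto_mult)

lemma smooth_fun_sum: "(\<And>i. i \<in> I \<Longrightarrow> smooth_fun (f i)) \<Longrightarrow> smooth_fun (\<lambda>t. \<Sum>i\<in>I. f i t)"
  by (induction I rule: infinite_finite_induct) (simp_all add: smooth_fun_const smooth_fun_add)

text \<open>The derivative is \<open>- f' / f^2\<close>. In an induction on the order,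
  \<open>f'\<close> is smooth to every order by assumption and the two factors \<open>1 / f\<close>
  are covered by the induction hypothesis.\<close>

lemma smooth_fun_inverse:
  assumes f: "smooth_fun f" and nz: "\<And>t. f t \<noteq> 0"
  shows "smooth_fun (\<lambda>t. inverse (f t))"
proof -
  have "smooth_upto n (\<lambda>t. inverse (f t))" for n
  proof (induction n)
    case (Suc n)
    show ?case
    proof (rule smooth_upto_SucI)
      fix t
      have "((\<lambda>t. inverse (f t)) has_derivative (\<lambda>h. - (inverse (f t) * (h *\<^sub>R vderiv f t) * inverse (f t)))) (at t)"
        by (rule Deriv.has_derivative_inverse[OF nz smooth_funD(1)[OF f, unfolded has_vector_derivative_def]])
      \<comment> \<open>The Frechet derivative is put into the shape of a product of functions of
        \<open>t\<close>, to which \<open>smooth_upto_mult\<close> applies.\<close>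
      moreover have "(\<lambda>h. - (inverse (f t) * (h *\<^sub>R vderiv f t) * inverse (f t)))
          = (\<lambda>h. h *\<^sub>R ((-1) * vderiv f t * (inverse (f t) * inverse (f t))))"
        by (auto simp: algebra_simps scaleR_conv_of_real)
      ultimately show "((\<lambda>t. inverse (f t)) has_vector_derivative
          (-1) * vderiv f t * (inverse (f t) * inverse (f t))) (at t)"
        unfolding has_vector_derivative_def by simp
      show "smooth_upto n (\<lambda>t. (-1) * vderiv f t * (inverse (f t) * inverse (f t)))"
        using smooth_funD(2)[OF f] by (intro smooth_upto_mult smooth_upto_const Suc) (simp add: smooth_fun_upto)
    qed
  qed simp
  then show ?thesis by (simp add: smooth_fun_upto)
qed

lemma smooth_fun_cnj:
  assumes "smooth_fun f" shows "smooth_fun (\<lambda>t. cnj (f t))"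
proof -
  have "smooth_upto n (\<lambda>t. cnj (f t))" if "smooth_upto n f" for n using that
  proof (induction n arbitrary: f)
    case (Suc n)
    show ?case
      by (rule smooth_upto_SucI[OF has_vector_derivative_cnj[OF smooth_upto_SucD(1)[OF Suc.prems]]])
        (rule Suc.IH[OF smooth_upto_SucD(2)[OF Suc.prems]])
  qed simp
  then show ?thesis using assms by (simp add: smooth_fun_upto)
qed

lemma smooth_fun_cis: "smooth_fun (\<lambda>t. cis (c * t))"
proof -
  have "smooth_upto n (\<lambda>t. cis (c * t))" for n
  proof (induction n)
    case (Suc n)
    show ?case
    proof (rule smooth_upto_SucI)
      have "((\<lambda>t. exp (of_real t * (\<i> * of_real c))) has_vector_derivative
          \<i> * of_real c * exp (of_real t * (\<i> * of_real c))) (at t)" for t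
        using exp_scaleR_has_vector_derivative_left[of "\<i> * of_real c" t]
        by (simp add: scaleR_conv_of_real)
      moreover have "cis (c * t) = exp (of_real t * (\<i> * of_real c))" for t
        by (simp add: cis_conv_exp mult_ac)
      ultimately show "((\<lambda>t. cis (c * t)) has_vector_derivative (\<i> * of_real c) * cis (c * t)) (at t)" for t
        by simp
      show "smooth_upto n (\<lambda>t. (\<i> * of_real c) * cis (c * t))"
        by (intro smooth_upto_mult smooth_upto_const Suc)
    qed
  qed simp
  then show ?thesis by (simp add: smooth_fun_upto)
qed

section \<open>Translations, and uniform estimates for higher derivatives\<close>

lemma has_vector_derivative_shift_arg:
  "((\<lambda>s. f (s + c)) has_vector_derivative y) (at t) \<longleftrightarrow> (f has_vector_derivative y) (at (t + c))"
  for t :: real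
proof -
  have sh: "((\<lambda>s. h (s + d)) has_vector_derivative y) (at r)"
    if "(h has_vector_derivative y) (at (r + d))" for h d r
  proof -
    have "((\<lambda>s. s + d) has_vector_derivative 1) (at r)"
      by (auto intro!: derivative_eq_intros)
    from vector_diff_chain_at[OF this that] show ?thesis by (simp add: o_def)
  qed
  \<comment> \<open>The converse direction translates back by \<open>- c\<close>.\<close>
  show ?thesis using sh[of f t c] sh[of "\<lambda>s. f (s + c)" "t + c" "- c"] by auto
qed

text \<open>\<open>vector_derivative\<close> is a choice from the predicate
  \<open>has_vector_derivative\<close>. The preceding equivalence makes the two predicates equal, so
  the chosen values agree for every \<open>f\<close>.\<close>

lemma vderiv_shift: "vderiv (\<lambda>t. f (t + c)) = (\<lambda>t. vderiv f (t + c))"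
  by (simp add: vector_derivative_def has_vector_derivative_shift_arg)

lemma nth_derivative_shift: "nth_derivative n (\<lambda>t. f (t + c)) = (\<lambda>t. nth_derivative n f (t + c))"
  by (induction n) (simp_all add: nth_derivative_Suc vderiv_shift)

lemma smooth_fun_shift: "smooth_fun f \<Longrightarrow> smooth_fun (\<lambda>t. f (t + c))"
proof -
  have "smooth_upto n (\<lambda>t. f (t + c))" if "smooth_upto n f" for n using that
  proof (induction n arbitrary: f)
    case (Suc n)
    show ?case
    proof (rule smooth_upto_SucI)
      show "((\<lambda>t. f (t + c)) has_vector_derivative vderiv f (t + c)) (at t)" for t
        unfolding has_vector_derivative_shift_arg by (rule smooth_upto_SucD(1)[OF Suc.prems])
    qed (rule Suc.IH[OF smooth_upto_SucD(2)[OF Suc.prems]])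
  qed simp
  then show "smooth_fun f \<Longrightarrow> smooth_fun (\<lambda>t. f (t + c))" by (simp add: smooth_fun_upto)
qed

lemma nth_derivative_lincomb:
  assumes "smooth_fun f" "smooth_fun g"
  shows "nth_derivative n (\<lambda>t. a * f t + b * g t) = (\<lambda>t. a * nth_derivative n f t + b * nth_derivative n g t)"
proof (induction n)
  case (Suc n)
  have "vderiv (\<lambda>t. a * nth_derivative n f t + b * nth_derivative n g t)
      = (\<lambda>t. a * nth_derivative (Suc n) f t + b * nth_derivative (Suc n) g t)"
    unfolding nth_derivative_Suc
    by (rule vderiv_eqI) (intro has_vector_derivative_add has_vector_derivative_mult_right
        smooth_funD(1) smooth_fun_nth_derivative assms)
  then show ?case by (simp add: nth_derivative_Suc Suc)
qed simp

lemma nth_derivative_zero: "nth_derivative n (\<lambda>t. 0) = (\<lambda>t. 0)"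
  using nth_derivative_lincomb[OF smooth_fun_const smooth_fun_const, of n 0 0 0 0] by simp

lemma nth_derivative_sum:
  assumes "\<And>i. i \<in> I \<Longrightarrow> smooth_fun (f i)"
  shows "nth_derivative n (\<lambda>t. \<Sum>i\<in>I. f i t) = (\<lambda>t. \<Sum>i\<in>I. nth_derivative n (f i) t)"
  using assms
proof (induction I rule: infinite_finite_induct)
  case (insert i I)
  have "smooth_fun (f i)" "smooth_fun (\<lambda>t. \<Sum>i\<in>I. f i t)"
    using insert.prems by (auto intro!: smooth_fun_sum)
  from nth_derivative_lincomb[OF this, of n 1 1] show ?case using insert by simp
qed (simp_all add: nth_derivative_zero)

text \<open>\<open>K\<close> is chosen before \<open>f\<close> and \<open>g\<close>, which is the
  uniformity needed for products of bounded sets. The induction applies the product rule once; it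
  varies the bounds because a differentiated factor satisfies the same bounds moved up by one
  order.\<close>

lemma nth_derivative_mult_bound:
  "\<exists>K. \<forall>f g. smooth_fun f \<longrightarrow> smooth_fun g \<longrightarrow> (\<forall>m t. cmod (nth_derivative m f t) \<le> B m) \<longrightarrow>
     (\<forall>m t. cmod (nth_derivative m g t) \<le> C m) \<longrightarrow> (\<forall>t. cmod (nth_derivative n (\<lambda>t. f t * g t) t) \<le> K)"
proof (induction n arbitrary: B C)
  case 0
  have "cmod (f t * g t) \<le> B 0 * C 0"
    if "\<forall>m t. cmod (nth_derivative m f t) \<le> B m" "\<forall>m t. cmod (nth_derivative m g t) \<le> C m" for f g t
  proof -
    have "cmod (f t) \<le> B 0" "cmod (g t) \<le> C 0"
      using that[THEN spec, of 0, THEN spec, of t] by simp_all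
    then show ?thesis unfolding norm_mult by (intro mult_mono) (auto intro: order_trans[OF norm_ge_zero])
  qed
  then show ?case by (intro exI[of _ "B 0 * C 0"]) simp
next
  case (Suc n)
  obtain K where K: "\<And>f g t. smooth_fun f \<Longrightarrow> smooth_fun g \<Longrightarrow> (\<And>m t. cmod (nth_derivative m f t) \<le> B m) \<Longrightarrow>
     (\<And>m t. cmod (nth_derivative m g t) \<le> C (Suc m)) \<Longrightarrow> cmod (nth_derivative n (\<lambda>t. f t * g t) t) \<le> K"
    using Suc.IH[of B "\<lambda>m. C (Suc m)"] by metis
  obtain L where L: "\<And>f g t. smooth_fun f \<Longrightarrow> smooth_fun g \<Longrightarrow> (\<And>m t. cmod (nth_derivative m f t) \<le> B (Suc m)) \<Longrightarrow>
     (\<And>m t. cmod (nth_derivative m g t) \<le> C m) \<Longrightarrow> cmod (nth_derivative n (\<lambda>t. f t * g t) t) \<le> L"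
    using Suc.IH[of "\<lambda>m. B (Suc m)" C] by metis
  show ?case
  proof (intro exI[of _ "K + L"] allI impI)
    fix f g t
    assume s: "smooth_fun f" "smooth_fun g"
      and B: "\<forall>m t. cmod (nth_derivative m f t) \<le> B m" and C: "\<forall>m t. cmod (nth_derivative m g t) \<le> C m"
    note s' = s[THEN smooth_funD(2)]
    have "vderiv (\<lambda>t. f t * g t) = (\<lambda>t. f t * vderiv g t + vderiv f t * g t)"
      by (rule vderiv_eqI[OF has_vector_derivative_mult[OF smooth_funD(1) smooth_funD(1)]]) fact+
    then have "nth_derivative (Suc n) (\<lambda>t. f t * g t) t
        = nth_derivative n (\<lambda>t. f t * vderiv g t) t + nth_derivative n (\<lambda>t. vderiv f t * g t) t"
      using nth_derivative_lincomb[OF smooth_fun_mult[OF s(1) s'(2)] smooth_fun_mult[OF s'(1) s(2)], of n 1 1]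
      by (simp add: nth_derivative_Suc')
    moreover have "cmod (nth_derivative n (\<lambda>t. f t * vderiv g t) t) \<le> K"
      by (rule K) (use s s' B C in \<open>simp_all flip: nth_derivative_Suc'\<close>)
    moreover have "cmod (nth_derivative n (\<lambda>t. vderiv f t * g t) t) \<le> L"
      by (rule L) (use s s' B C in \<open>simp_all flip: nth_derivative_Suc'\<close>)
    ultimately show "cmod (nth_derivative (Suc n) (\<lambda>t. f t * g t) t) \<le> K + L"
      by (simp only: norm_triangle_mono)
  qed
qed

text \<open>Completeness of the space of smooth functions. The pointwise limits \<open>g n\<close>
  of the derivatives of order \<open>n\<close> are uniform limits, hence \<open>g (Suc n)\<close> is
  the derivative of \<open>g n\<close>; as \<open>g 0 = f\<close>, the \<open>g n\<close> are the
  derivatives of \<open>f\<close>.\<close>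

lemma smooth_fun_limit:
  assumes s: "\<And>m. smooth_fun (s m)"
    and cau: "\<And>n e. e > 0 \<Longrightarrow> \<exists>N. \<forall>i\<ge>N. \<forall>j\<ge>N. \<forall>t. cmod (nth_derivative n (s i) t - nth_derivative n (s j) t) \<le> e"
    and f: "\<And>t. (\<lambda>m. s m t) \<longlonglongrightarrow> f t"
  shows "smooth_fun f" "(\<lambda>m. nth_derivative n (s m) t) \<longlonglongrightarrow> nth_derivative n f t"
proof -
  have "Cauchy (\<lambda>m. nth_derivative n (s m) t)" for n t
  proof (rule metric_CauchyI)
    fix e :: real assume "e > 0"
    then obtain N where N: "\<And>i j. i \<ge> N \<Longrightarrow> j \<ge> N \<Longrightarrow> cmod (nth_derivative n (s i) t - nth_derivative n (s j) t) \<le> e/2"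
      using cau[of "e/2" n] by auto
    have "dist (nth_derivative n (s i) t) (nth_derivative n (s j) t) < e" if "i \<ge> N" "j \<ge> N" for i j
      using N[OF that] \<open>e > 0\<close> by (simp add: dist_norm)
    then show "\<exists>N. \<forall>i\<ge>N. \<forall>j\<ge>N. dist (nth_derivative n (s i) t) (nth_derivative n (s j) t) < e" by blast
  qed
  then have "\<forall>n t. \<exists>l. (\<lambda>m. nth_derivative n (s m) t) \<longlonglongrightarrow> l"
    using Cauchy_convergent convergent_def by blast
  then obtain g where g: "\<And>n t. (\<lambda>m. nth_derivative n (s m) t) \<longlonglongrightarrow> g n t" by metis
  \<comment> \<open>Letting \<open>j\<close> tend to infinity in the uniform Cauchy estimate bounds
    the distance to the limit uniformly in \<open>t\<close>.\<close>
  have unif: "\<exists>N. \<forall>i\<ge>N. \<forall>t. cmod (nth_derivative n (s i) t - g n t) \<le> e" if e: "e > 0" for n e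
  proof -
    obtain N where N: "\<And>i j t. i \<ge> N \<Longrightarrow> j \<ge> N \<Longrightarrow> cmod (nth_derivative n (s i) t - nth_derivative n (s j) t) \<le> e"
      using cau[OF e, of n] by auto
    have "cmod (nth_derivative n (s i) t - g n t) \<le> e" if "i \<ge> N" for i t
      by (rule LIMSEQ_le_const2[OF tendsto_norm[OF tendsto_diff[OF tendsto_const g]]]) (use N that in blast)
    then show ?thesis by blast
  qed
  have der: "(g n has_vector_derivative g (Suc n) t) (at t)" for n t
  proof -
    \<comment> \<open>Differentiation of a limit: convergence at the single point \<open>0\<close>
      and uniform convergence of the derivatives suffice. The limit function \<open>G\<close> so
      obtained is then identified with \<open>g n\<close>.\<close>
    have "\<exists>G. \<forall>x\<in>UNIV. (\<lambda>m. nth_derivative n (s m) x) \<longlonglongrightarrow> G x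
        \<and> (G has_derivative (\<lambda>h. h *\<^sub>R g (Suc n) x)) (at x within UNIV)"
    proof (rule has_derivative_sequence[where ?x0.0 = 0 and l = "g n 0"])
      show "(\<lambda>m. nth_derivative n (s m) 0) \<longlonglongrightarrow> g n 0" by (rule g)
      show "(nth_derivative n (s m) has_derivative (\<lambda>h. h *\<^sub>R nth_derivative (Suc n) (s m) x)) (at x within UNIV)" for m x
        using smooth_funD(1)[OF smooth_fun_nth_derivative[OF s]] by (simp add: has_vector_derivative_def nth_derivative_Suc)
      fix e :: real assume "e > 0"
      then obtain N where N: "\<And>i t. i \<ge> N \<Longrightarrow> cmod (nth_derivative (Suc n) (s i) t - g (Suc n) t) \<le> e"
        using unif[of e "Suc n"] by auto
      show "\<forall>\<^sub>F i in sequentially. \<forall>x\<in>UNIV. \<forall>h.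
          cmod (h *\<^sub>R nth_derivative (Suc n) (s i) x - h *\<^sub>R g (Suc n) x) \<le> e * norm h"
        unfolding eventually_sequentially scaleR_diff_right[symmetric] norm_scaleR
        using N by (intro exI[of _ N]) (auto simp: mult.commute[of e] intro!: mult_left_mono)
    qed simp_all
    then obtain G where G: "\<And>x. (\<lambda>m. nth_derivative n (s m) x) \<longlonglongrightarrow> G x"
      "\<And>x. (G has_derivative (\<lambda>h. h *\<^sub>R g (Suc n) x)) (at x)" by auto
    have "G = g n" using LIMSEQ_unique[OF G(1) g] by blast
    then show ?thesis using G(2) by (simp add: has_vector_derivative_def)
  qed
  have nf: "nth_derivative n f = g n" for n
  proof (induction n)
    case 0 show ?case using LIMSEQ_unique[OF f] g[of 0] by (simp add: fun_eq_iff)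
  next
    case (Suc n) then show ?case using vderiv_eqI[OF der] by (simp add: nth_derivative_Suc)
  qed
  show "smooth_fun f"
    unfolding smooth_fun_def nf using differentiableI_vector[OF der] by simp
  show "(\<lambda>m. nth_derivative n (s m) t) \<longlonglongrightarrow> nth_derivative n f t" unfolding nf by (rule g)
qed

text \<open>All derivatives inherit the period 1, so their values are attained on the compact
  interval \<open>{0..1}\<close>.\<close>

lemma nth_derivative_periodic_bounded:
  assumes f: "smooth_fun f" and per: "\<And>t. f (t + 1) = f t"
  shows "\<exists>C. \<forall>t. cmod (nth_derivative n f t) \<le> C"
proof -
  let ?g = "nth_derivative n f"
  have p: "?g (t + 1) = ?g t" for t using fun_cong[OF nth_derivative_shift[of n f 1], of t] by (simp add: per)
  have pn: "?g (t + of_nat m) = ?g t" for t and m :: nat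
  proof (induction m)
    case (Suc m)
    then show ?case using p[of "t + of_nat m"] by (simp add: add_ac)
  qed simp
  have pz: "?g (t + of_int k) = ?g t" for t k
  proof (cases k rule: int_cases2)
    case (nonneg m)
    then show ?thesis using pn by simp
  next
    case (nonpos m)
    then show ?thesis using pn[of "t - of_nat m" m] by simp
  qed
  have "compact (?g ` {0..1})"
    by (intro compact_continuous_image smooth_fun_continuous smooth_fun_nth_derivative f) simp
  then obtain C where C: "\<And>t. t \<in> {0..1} \<Longrightarrow> cmod (?g t) \<le> C"
    by (meson bounded_iff compact_imp_bounded imageI)
  have "cmod (?g t) \<le> C" for t
  proof -
    have "?g t = ?g (frac t)" using pz[of "frac t" "\<lfloor>t\<rfloor>"] by (simp add: frac_def)
    then show ?thesis using C[of "frac t"] by (simp add: frac_lt_1 less_imp_le)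
  qed
  then show ?thesis by blast
qed

section \<open>The noncommutative torus as a complete bornological algebra\<close>

lemma circle_obtain: obtains t where "x = abs_circle t"
proof -
  have "\<exists>t. x = abs_circle t" by (induct x rule: circle.abs_induct) auto
  then show thesis using that by blast
qed

lemma abs_circle_eq_iff: "abs_circle s = abs_circle t \<longleftrightarrow> s - t \<in> \<int>"
  by (simp add: circle.abs_eq_iff)

lemma abs_circle_add_1: "abs_circle (t + 1) = abs_circle t"
  by (simp add: abs_circle_eq_iff)

lemma rotate_abs_circle: "rotate \<theta> k (abs_circle t) = abs_circle (t + of_int k * \<theta>)"
  by (rule rotate.abs_eq)

lemma rotate_rotate: "rotate \<theta> j (rotate \<theta> i x) = rotate \<theta> (i + j) x"
  by (rule circle_obtain[of x]) (simp add: rotate_abs_circle algebra_simps)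

lemma rotate_0: "rotate \<theta> 0 x = x"
  by (rule circle_obtain[of x]) (simp add: rotate_abs_circle)

section \<open>Basic bounded sets\<close>

abbreviation fibre :: "(int \<times> circle \<Rightarrow> complex) \<Rightarrow> int \<Rightarrow> real \<Rightarrow> complex" where
  "fibre a k \<equiv> \<lambda>t. a (k, abs_circle t)"

text \<open>For finite \<open>F\<close> these sets are cofinal in the bornology, and for nonnegative
  \<open>C\<close> they are completant disks; every boundedness and completeness question is reduced
  to them.\<close>

definition torus_disk :: "int set \<Rightarrow> (nat \<Rightarrow> real) \<Rightarrow> (int \<times> circle \<Rightarrow> complex) set" where
  "torus_disk F C = {a. (\<forall>k. smooth_fun (fibre a k)) \<and> (\<forall>k x. a (k, x) \<noteq> 0 \<longrightarrow> k \<in> F)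
     \<and> (\<forall>n k t. cmod (nth_derivative n (fibre a k) t) \<le> C n)}"

lemma torus_diskI:
  assumes "\<And>k. smooth_fun (fibre a k)" "\<And>k x. a (k, x) \<noteq> 0 \<Longrightarrow> k \<in> F"
    "\<And>n k t. cmod (nth_derivative n (fibre a k) t) \<le> C n"
  shows "a \<in> torus_disk F C"
  using assms by (auto simp: torus_disk_def)

lemma torus_diskD:
  assumes "a \<in> torus_disk F C"
  shows "smooth_fun (fibre a k)" "a (k, x) \<noteq> 0 \<Longrightarrow> k \<in> F"
    "cmod (nth_derivative n (fibre a k) t) \<le> C n" "k \<notin> F \<Longrightarrow> a (k, x) = 0"
  using assms by (auto simp: torus_disk_def)

lemma torus_disk_nonneg: "a \<in> torus_disk F C \<Longrightarrow> 0 \<le> C n"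
  using torus_diskD(3)[of a F C n 0 0] norm_ge_zero order_trans by blast

lemma torus_disk_mono:
  assumes "a \<in> torus_disk F C" "F \<subseteq> G" "\<And>n. C n \<le> D n" shows "a \<in> torus_disk G D"
proof (rule torus_diskI)
  note a = torus_diskD[OF assms(1)]
  show "smooth_fun (fibre a k)" for k by (rule a(1))
  show "k \<in> G" if "a (k, x) \<noteq> 0" for k x using a(2)[OF that] assms(2) by blast
  show "cmod (nth_derivative n (fibre a k) t) \<le> D n" for n k t
    using order_trans[OF a(3) assms(3)] .
qed

lemma torus_disk_lincomb:
  assumes a: "a \<in> torus_disk F C" and b: "b \<in> torus_disk G D"
  shows "(\<lambda>p. c * a p + d * b p) \<in> torus_disk (F \<union> G) (\<lambda>n. cmod c * C n + cmod d * D n)"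
proof (rule torus_diskI)
  note a = torus_diskD[OF a] and b = torus_diskD[OF b]
  show "smooth_fun (\<lambda>t. c * a (k, abs_circle t) + d * b (k, abs_circle t))" for k
    by (intro smooth_fun_add smooth_fun_mult smooth_fun_const a(1) b(1))
  show "k \<in> F \<union> G" if "c * a (k, x) + d * b (k, x) \<noteq> 0" for k x
    using that a(2)[of k x] b(2)[of k x] by (cases "a (k, x) = 0") auto
  show "cmod (nth_derivative n (\<lambda>t. c * a (k, abs_circle t) + d * b (k, abs_circle t)) t)
      \<le> cmod c * C n + cmod d * D n" for n k t
    unfolding nth_derivative_lincomb[OF a(1) b(1)]
    by (rule norm_triangle_mono) (auto simp: norm_mult intro!: mult_left_mono a b)
qed

lemma torus_disk_add:
  "a \<in> torus_disk F C \<Longrightarrow> b \<in> torus_disk G D \<Longrightarrow> (\<lambda>p. a p + b p) \<in> torus_disk (F \<union> G) (\<lambda>n. C n + D n)"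
  using torus_disk_lincomb[of a F C b G D 1 1] by simp

lemma torus_disk_smult:
  assumes a: "a \<in> torus_disk F C" and c: "cmod c \<le> r"
  shows "(\<lambda>p. c * a p) \<in> torus_disk F (\<lambda>n. r * C n)"
proof (rule torus_disk_mono)
  show "(\<lambda>p. c * a p) \<in> torus_disk (F \<union> F) (\<lambda>n. cmod c * C n + cmod 0 * C n)"
    using torus_disk_lincomb[OF a a, of c 0] by simp
qed (use c torus_disk_nonneg[OF a] in \<open>auto intro: mult_right_mono\<close>)

lemma torus_disk_zero: "(\<And>n. 0 \<le> C n) \<Longrightarrow> (\<lambda>p. 0) \<in> torus_disk F C"
  by (rule torus_diskI) (simp_all add: smooth_fun_const nth_derivative_zero)

text \<open>Periodicity and finite support make derivative bounds automatic, which is why the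
  carrier of the algebra imposes none.\<close>

lemma torus_disk_exists:
  assumes "\<And>k. smooth_fun (fibre a k)" "finite F" "\<And>k x. a (k, x) \<noteq> 0 \<Longrightarrow> k \<in> F"
  shows "\<exists>C. a \<in> torus_disk F C"
proof -
  have "\<forall>n k. \<exists>C. \<forall>t. cmod (nth_derivative n (fibre a k) t) \<le> C"
    using nth_derivative_periodic_bounded[OF assms(1)] by (simp add: abs_circle_add_1)
  then obtain C where C: "\<And>n k t. cmod (nth_derivative n (fibre a k) t) \<le> C n k" by metis
  have C0: "0 \<le> C n k" for n k using C[of n k 0] norm_ge_zero order_trans by blast
  \<comment> \<open>Summing the bounds over \<open>F\<close> dominates each of them, and the sum has
    the right value 0 when \<open>F\<close> is empty.\<close>
  have "cmod (nth_derivative n (fibre a k) t) \<le> (\<Sum>k\<in>F. C n k)" for n k t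
  proof (cases "k \<in> F")
    case True
    then have "C n k \<le> (\<Sum>k\<in>F. C n k)" using assms(2) C0 by (intro member_le_sum) auto
    then show ?thesis using C order_trans by blast
  next
    case False
    then have "fibre a k = (\<lambda>t. 0)" using assms(3) by blast
    then show ?thesis by (simp add: nth_derivative_zero sum_nonneg C0)
  qed
  with assms show ?thesis by (intro exI torus_diskI) auto
qed

locale rotation_algebra =
  fixes \<theta> :: real
begin

abbreviation "torus \<equiv> noncommutative_torus \<theta>"

lemma torus_simps:
  "zero torus = (\<lambda>p. 0)" "add torus = (\<lambda>a b p. a p + b p)" "smult torus = (\<lambda>c a p. c * a p)"
  by (simp_all add: noncommutative_torus_def)

lemma torus_bornology: "bornology torus = {S. \<exists>F C. finite F \<and> S \<subseteq> torus_disk F C}"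
proof (rule Set.set_eqI, rule iffI)
  fix S assume "S \<in> bornology torus"
  then have S: "\<And>a k. a \<in> S \<Longrightarrow> smooth_fun (fibre a k)"
    "\<forall>n. \<exists>C. \<forall>a\<in>S. \<forall>k t. cmod (nth_derivative n (fibre a k) t) \<le> C"
    and fin: "\<exists>F. finite F \<and> (\<forall>a\<in>S. \<forall>k x. a (k, x) \<noteq> 0 \<longrightarrow> k \<in> F)"
    by (simp_all add: noncommutative_torus_def)
  from fin obtain F where F: "finite F" "\<And>a k x. a \<in> S \<Longrightarrow> a (k, x) \<noteq> 0 \<Longrightarrow> k \<in> F" by blast
  from choice[OF S(2)] obtain C where C: "\<forall>n. \<forall>a\<in>S. \<forall>k t. cmod (nth_derivative n (fibre a k) t) \<le> C n"
    by (rule exE)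
  have "a \<in> torus_disk F C" if "a \<in> S" for a
    by (rule torus_diskI) (use S(1)[OF that] F(2)[OF that] C that in \<open>simp_all\<close>)
  with F(1) show "S \<in> {S. \<exists>F C. finite F \<and> S \<subseteq> torus_disk F C}" by blast
next
  fix S assume "S \<in> {S. \<exists>F C. finite F \<and> S \<subseteq> torus_disk F C}"
  then obtain F C where F: "finite F" and S: "\<And>a. a \<in> S \<Longrightarrow> a \<in> torus_disk F C" by blast
  note S = torus_diskD[OF S]
  have "\<exists>C. \<forall>a\<in>S. \<forall>k t. cmod (nth_derivative n (fibre a k) t) \<le> C" for n
    using S(3) by blast
  moreover have "\<exists>F. finite F \<and> (\<forall>a\<in>S. \<forall>k x. a (k, x) \<noteq> 0 \<longrightarrow> k \<in> F)"
    using S(2) F by blast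
  ultimately show "S \<in> bornology torus" using S(1) by (simp add: noncommutative_torus_def)
qed

lemma torus_bornologyI: "finite F \<Longrightarrow> S \<subseteq> torus_disk F C \<Longrightarrow> S \<in> bornology torus"
  unfolding torus_bornology by blast

lemma torus_bornologyE:
  assumes "S \<in> bornology torus"
  obtains F C where "finite F" "S \<subseteq> torus_disk F C"
  using assms unfolding torus_bornology by blast

lemma torus_carrier: "carrier torus = {a. \<exists>F C. finite F \<and> a \<in> torus_disk F C}"
proof (rule Set.set_eqI, rule iffI)
  fix a assume "a \<in> carrier torus"
  then have a: "\<And>k. smooth_fun (fibre a k)" and fin: "\<exists>F. finite F \<and> (\<forall>k x. a (k, x) \<noteq> 0 \<longrightarrow> k \<in> F)"
    by (simp_all add: noncommutative_torus_def)
  from fin obtain F where F: "finite F" "\<And>k x. a (k, x) \<noteq> 0 \<Longrightarrow> k \<in> F" by blast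
  from torus_disk_exists[OF a F] obtain C where "a \<in> torus_disk F C" by (rule exE)
  with F(1) show "a \<in> {a. \<exists>F C. finite F \<and> a \<in> torus_disk F C}" by blast
next
  fix a assume "a \<in> {a. \<exists>F C. finite F \<and> a \<in> torus_disk F C}"
  then obtain F C where F: "finite F" and a: "a \<in> torus_disk F C" by blast
  have "\<exists>F. finite F \<and> (\<forall>k x. a (k, x) \<noteq> 0 \<longrightarrow> k \<in> F)"
    using torus_diskD(2)[OF a] F by blast
  then show "a \<in> carrier torus" using torus_diskD(1)[OF a] by (simp add: noncommutative_torus_def)
qed

lemma torus_carrierI: "finite F \<Longrightarrow> a \<in> torus_disk F C \<Longrightarrow> a \<in> carrier torus"
  unfolding torus_carrier by blast

lemma torus_carrierE:
  assumes "a \<in> carrier torus"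
  obtains F C where "finite F" "a \<in> torus_disk F C"
  using assms unfolding torus_carrier by blast

lemma torus_carrier_add:
  assumes "a \<in> carrier torus" "b \<in> carrier torus" shows "(\<lambda>p. a p + b p) \<in> carrier torus"
  by (rule torus_carrierE[OF assms(1)], rule torus_carrierE[OF assms(2)])
    (rule torus_carrierI[OF _ torus_disk_add], simp_all)

lemma torus_carrier_smult:
  assumes "a \<in> carrier torus" shows "(\<lambda>p. c * a p) \<in> carrier torus"
  by (rule torus_carrierE[OF assms]) (rule torus_carrierI[OF _ torus_disk_smult], auto)

lemma torus_born_vector_space: "born_vector_space torus"
  unfolding born_vector_space_def
proof (intro conjI ballI allI)
  show "Module.module complex_ring torus"
    by (rule complex_moduleI)
      (auto simp: torus_simps torus_carrier_add torus_carrier_smult algebra_simps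
        intro: torus_carrierI[OF finite.emptyI torus_disk_zero[of "\<lambda>n. 0"]])
  show "is_bornology (carrier torus) (bornology torus)"
    unfolding is_bornology_def
  proof (intro conjI ballI allI impI)
    show "bornology torus \<subseteq> Pow (carrier torus)"
      by (auto elim!: torus_bornologyE intro: torus_carrierI)
    show "{} \<in> bornology torus" by (rule torus_bornologyI[of "{}"]) auto
    show "{a} \<in> bornology torus" if "a \<in> carrier torus" for a
      by (rule torus_carrierE[OF that]) (rule torus_bornologyI, auto)
    show "S \<in> bornology torus" if "T \<in> bornology torus" "S \<subseteq> T" for S T
      using that by (meson torus_bornologyE torus_bornologyI order_trans)
    show "S \<union> T \<in> bornology torus" if S: "S \<in> bornology torus" and T: "T \<in> bornology torus" for S T
    proof -
      obtain F C where F: "finite F" "S \<subseteq> torus_disk F C" using S by (rule torus_bornologyE)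
      obtain G D where G: "finite G" "T \<subseteq> torus_disk G D" using T by (rule torus_bornologyE)
      have "S \<union> T \<subseteq> torus_disk (F \<union> G) (\<lambda>n. max (C n) (D n))"
        using F(2) G(2) by (auto intro: torus_disk_mono)
      with F(1) G(1) show ?thesis by (intro torus_bornologyI) auto
    qed
  qed
  fix S assume "S \<in> bornology torus"
  then obtain F C where F: "finite F" "S \<subseteq> torus_disk F C" by (rule torus_bornologyE)
  show "{c \<odot>\<^bsub>torus\<^esub> a |a. a \<in> S} \<in> bornology torus" for c
    by (rule torus_bornologyI[OF F(1), of _ "\<lambda>n. cmod c * C n"])
      (use F(2) in \<open>auto simp: torus_simps intro!: torus_disk_smult\<close>)
  show "{c \<odot>\<^bsub>torus\<^esub> a |c a. cmod c \<le> 1 \<and> a \<in> S} \<in> bornology torus"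
    by (rule torus_bornologyI[OF F(1), of _ "\<lambda>n. 1 * C n"])
      (use F(2) in \<open>auto simp only: torus_simps intro!: torus_disk_smult\<close>)
  fix T assume "T \<in> bornology torus"
  then obtain G D where G: "finite G" "T \<subseteq> torus_disk G D" by (rule torus_bornologyE)
  show "{a \<oplus>\<^bsub>torus\<^esub> b |a b. a \<in> S \<and> b \<in> T} \<in> bornology torus"
    by (rule torus_bornologyI[of "F \<union> G" _ "\<lambda>n. C n + D n"])
      (use F G in \<open>auto simp: torus_simps intro!: torus_disk_add\<close>)
qed

sublocale torus: born_vs torus by (rule born_vs.intro[OF torus_born_vector_space])

lemma torus_minus:
  "a \<in> carrier torus \<Longrightarrow> b \<in> carrier torus \<Longrightarrow> a \<ominus>\<^bsub>torus\<^esub> b = (\<lambda>p. a p - b p)"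
  by (simp add: torus.sminus) (simp add: torus_simps)

lemma torus_disk_disk:
  assumes F: "finite F" and C: "\<And>n. 0 \<le> C n"
  shows "disk torus (torus_disk F C)"
  unfolding disk_def
proof (intro conjI ballI allI impI)
  show "torus_disk F C \<subseteq> carrier torus" using torus_carrierI[OF F] by blast
  show "torus_disk F C \<noteq> {}" using torus_disk_zero[of C F, OF C] by blast
  fix a assume a: "a \<in> torus_disk F C"
  show "c \<odot>\<^bsub>torus\<^esub> a \<in> torus_disk F C" if "cmod c \<le> 1" for c
    using torus_disk_smult[OF a that] by (simp add: torus_simps)
  fix b t assume b: "b \<in> torus_disk F C" and t: "t \<in> {0..1::real}"
  show "of_real (1 - t) \<odot>\<^bsub>torus\<^esub> a \<oplus>\<^bsub>torus\<^esub> of_real t \<odot>\<^bsub>torus\<^esub> b \<in> torus_disk F C"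
    by (rule torus_disk_mono, unfold torus_simps, rule torus_disk_lincomb[OF a b])
      (use t in \<open>auto simp del: of_real_diff simp: algebra_simps\<close>)
qed

text \<open>Translates the scaled disks of the completeness criterion into scaled derivative
  bounds.\<close>

lemma scl_torus_disk:
  assumes "r > 0" shows "torus.scl r (torus_disk F C) = torus_disk F (\<lambda>n. r * C n)"
proof
  show "torus.scl r (torus_disk F C) \<subseteq> torus_disk F (\<lambda>n. r * C n)"
    using assms by (auto simp: torus.scl_def torus_simps intro!: torus_disk_smult)
  show "torus_disk F (\<lambda>n. r * C n) \<subseteq> torus.scl r (torus_disk F C)"
  proof
    fix a assume "a \<in> torus_disk F (\<lambda>n. r * C n)"
    then have "(\<lambda>p. of_real (1/r) * a p) \<in> torus_disk F (\<lambda>n. 1/r * (r * C n))"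
      using assms by (intro torus_disk_smult) (auto simp: norm_divide)
    then have "(\<lambda>p. of_real (1/r) * a p) \<in> torus_disk F C" using assms by simp
    moreover have "a = of_real r \<odot>\<^bsub>torus\<^esub> (\<lambda>p. of_real (1/r) * a p)"
      using assms by (simp add: torus_simps)
    ultimately show "a \<in> torus.scl r (torus_disk F C)" unfolding torus.scl_def by blast
  qed
qed

text \<open>Smallness in the disk norm forces uniform smallness of every derivative on every fibre.
  A Cauchy sequence thus converges together with all derivatives, \<open>smooth_fun_limit\<close>
  makes the limit smooth, and the Cauchy bounds and the support condition pass to the limit.\<close>

lemma torus_disk_completant:
  assumes F: "finite F" and C: "\<And>n. 0 \<le> C n"
  shows "completant torus (torus_disk F C)"
  unfolding torus.completant_iff[OF torus_disk_disk[OF assms]]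
proof (intro conjI allI impI)
  fix a assume a: "\<forall>r>0. a \<in> torus.scl r (torus_disk F C)"
  show "a = \<zero>\<^bsub>torus\<^esub>"
    unfolding torus_simps
  proof
    fix p :: "int \<times> circle"
    obtain k t where p: "p = (k, abs_circle t)" using circle_obtain by (metis surj_pair)
    have "cmod (a p) \<le> e" if "e > 0" for e
    proof -
      \<comment> \<open>The bound of order 0 controls the values of \<open>a\<close>; adding 1 keeps
        the denominator positive when \<open>C 0 = 0\<close>.\<close>
      have r: "e / (C 0 + 1) > 0" using that C[of 0] by simp
      then have "a \<in> torus_disk F (\<lambda>n. e / (C 0 + 1) * C n)" using a scl_torus_disk by blast
      then have "cmod (a p) \<le> e / (C 0 + 1) * C 0" using torus_diskD(3)[of a F _ 0 k t] by (simp add: p)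
      also have "\<dots> \<le> e" using that C[of 0] by (simp add: field_simps)
      finally show ?thesis .
    qed
    then show "a p = 0" by (metis dense_ge norm_le_zero_iff)
  qed
next
  have dk: "disk torus (torus_disk F C)" by (rule torus_disk_disk[OF assms])
  fix s :: "nat \<Rightarrow> int \<times> circle \<Rightarrow> complex"
  assume s: "range s \<subseteq> lin_span torus (torus_disk F C) \<and>
    (\<forall>r>0. \<exists>N. \<forall>m\<ge>N. \<forall>n\<ge>N. s m \<ominus>\<^bsub>torus\<^esub> s n \<in> torus.scl r (torus_disk F C))"
  have ssp: "s i \<in> lin_span torus (torus_disk F C)" for i using s by (auto dest: range_subsetD)
  then have sc: "s i \<in> carrier torus" for i using torus.span_sub[OF dk] by blast
  have sb: "\<exists>r. s i \<in> torus_disk F (\<lambda>n. r * C n)" for i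
  proof -
    have "\<exists>r>0. s i \<in> torus.scl r (torus_disk F C)" using ssp[of i] by (simp add: torus.lin_span_disk[OF dk])
    then show ?thesis using scl_torus_disk by blast
  qed
  have sm: "smooth_fun (fibre (s i) k)" for i k using sb torus_diskD(1) by blast
  have nd: "nth_derivative n (\<lambda>t. f (k, abs_circle t) - g (k, abs_circle t)) t
      = nth_derivative n (fibre f k) t - nth_derivative n (fibre g k) t"
    if "smooth_fun (fibre f k)" "smooth_fun (fibre g k)" for n f g k t
    using nth_derivative_lincomb[OF that, of n 1 "-1"] by simp
  have cau: "\<exists>N. \<forall>i\<ge>N. \<forall>j\<ge>N. (\<lambda>p. s i p - s j p) \<in> torus_disk F (\<lambda>n. r * C n)" if "r > 0" for r
  proof -
    have "\<exists>N. \<forall>m\<ge>N. \<forall>n\<ge>N. s m \<ominus>\<^bsub>torus\<^esub> s n \<in> torus.scl r (torus_disk F C)" using s that by simp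
    then show ?thesis by (simp add: scl_torus_disk[OF that] torus_minus sc)
  qed
  have unif: "\<exists>N. \<forall>i\<ge>N. \<forall>j\<ge>N. \<forall>t. cmod (nth_derivative n (fibre (s i) k) t - nth_derivative n (fibre (s j) k) t) \<le> e"
    if "e > 0" for n k e
  proof -
    have "e / (C n + 1) > 0" using that C[of n] by simp
    from cau[OF this] obtain N where N: "\<And>i j. i \<ge> N \<Longrightarrow> j \<ge> N \<Longrightarrow>
        (\<lambda>p. s i p - s j p) \<in> torus_disk F (\<lambda>n'. e / (C n + 1) * C n')" by auto
    have "e / (C n + 1) * C n \<le> e" using that C[of n] by (simp add: field_simps)
    then have "cmod (nth_derivative n (fibre (s i) k) t - nth_derivative n (fibre (s j) k) t) \<le> e"
      if "i \<ge> N" "j \<ge> N" for i j t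
      using torus_diskD(3)[OF N[OF that], of n k t] by (simp add: nd[OF sm sm])
    then show ?thesis by blast
  qed
  have "convergent (\<lambda>i. s i p)" for p
  proof -
    obtain k t where p: "p = (k, abs_circle t)" using circle_obtain by (metis surj_pair)
    have "Cauchy (\<lambda>i. s i p)"
    proof (rule metric_CauchyI)
      fix e :: real assume e: "e > 0"
      then obtain N where N: "\<And>i j. i \<ge> N \<Longrightarrow> j \<ge> N \<Longrightarrow> cmod (s i p - s j p) \<le> e/2"
        using unif[of "e/2" 0 k] by (auto simp: p)
      have "dist (s i p) (s j p) < e" if "i \<ge> N" "j \<ge> N" for i j
        using N[OF that] e by (simp add: dist_norm)
      then show "\<exists>N. \<forall>i\<ge>N. \<forall>j\<ge>N. dist (s i p) (s j p) < e" by blast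
    qed
    then show ?thesis by (simp add: Cauchy_convergent_iff)
  qed
  then obtain a where a: "\<And>p. (\<lambda>i. s i p) \<longlonglongrightarrow> a p" unfolding convergent_def by metis
  note lims = smooth_fun_limit[of "\<lambda>i. fibre (s i) k" "fibre a k" for k, OF sm unif a]
  have supp: "k \<in> F" if "a (k, x) \<noteq> 0" for k x
  proof (rule ccontr)
    assume k: "k \<notin> F"
    then have "s i (k, x) = 0" for i using sb[of i] torus_diskD(4) by blast
    then have "(\<lambda>i. s i (k, x)) \<longlonglongrightarrow> 0" by simp
    then show False using LIMSEQ_unique[OF a] that by blast
  qed
  have lim: "\<exists>N. \<forall>i\<ge>N. (\<lambda>p. s i p - a p) \<in> torus_disk F (\<lambda>n. r * C n)" if r: "r > 0" for r
  proof -
    from cau[OF r] obtain N where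
      N: "\<And>i j. i \<ge> N \<Longrightarrow> j \<ge> N \<Longrightarrow> (\<lambda>p. s i p - s j p) \<in> torus_disk F (\<lambda>n. r * C n)" by auto
    have "(\<lambda>p. s i p - a p) \<in> torus_disk F (\<lambda>n. r * C n)" if i: "i \<ge> N" for i
    proof (rule torus_diskI)
      show "smooth_fun (\<lambda>t. s i (k, abs_circle t) - a (k, abs_circle t))" for k
        using smooth_fun_add[OF sm smooth_fun_mult[OF smooth_fun_const[of "-1"] lims(1)], of i k] by simp
      show "k \<in> F" if "s i (k, x) - a (k, x) \<noteq> 0" for k x
        using that supp[of k x] sb[of i] torus_diskD(2)[of "s i" F _ k x] by (cases "a (k, x) = 0") auto
      fix n k t
      have "(\<lambda>j. cmod (nth_derivative n (fibre (s i) k) t - nth_derivative n (fibre (s j) k) t))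
          \<longlonglongrightarrow> cmod (nth_derivative n (fibre (s i) k) t - nth_derivative n (fibre a k) t)"
        by (intro tendsto_intros lims(2))
      moreover have "cmod (nth_derivative n (fibre (s i) k) t - nth_derivative n (fibre (s j) k) t) \<le> r * C n"
        if "j \<ge> N" for j
        using torus_diskD(3)[OF N[OF i that], of n k t] by (simp add: nd[OF sm sm])
      ultimately have "cmod (nth_derivative n (fibre (s i) k) t - nth_derivative n (fibre a k) t) \<le> r * C n"
        by (intro LIMSEQ_le_const2) blast+
      then show "cmod (nth_derivative n (\<lambda>t. s i (k, abs_circle t) - a (k, abs_circle t)) t) \<le> r * C n"
        using nd[OF sm lims(1), of n i k t] by simp
    qed
    then show ?thesis by blast
  qed
  obtain i where i: "(\<lambda>p. s i p - a p) \<in> torus_disk F (\<lambda>n. 1 * C n)" using lim[of 1] by auto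
  obtain r where r: "s i \<in> torus_disk F (\<lambda>n. r * C n)" using sb by blast
  \<comment> \<open>Write \<open>a = s i - (s i - a)\<close>. The radius
    \<open>\<bar>r\<bar> + 1\<close> is positive whatever the sign of \<open>r\<close>, as
    \<open>scl_torus_disk\<close> requires.\<close>
  have "a \<in> torus_disk F (\<lambda>n. (\<bar>r\<bar> + 1) * C n)"
  proof (rule torus_disk_mono)
    show "a \<in> torus_disk (F \<union> F) (\<lambda>n. cmod 1 * (r * C n) + cmod (-1) * (1 * C n))"
      using torus_disk_lincomb[OF r i, of 1 "-1"] by simp
    show "cmod 1 * (r * C n) + cmod (-1) * (1 * C n) \<le> (\<bar>r\<bar> + 1) * C n" for n
      using mult_right_mono[OF abs_ge_self[of r] C[of n]] by (simp add: algebra_simps)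
  qed simp
  then have "a \<in> torus.scl (\<bar>r\<bar> + 1) (torus_disk F C)" by (simp add: scl_torus_disk)
  then have asp: "a \<in> lin_span torus (torus_disk F C)" by (rule torus.scl_span[OF dk])
  then have ac: "a \<in> carrier torus" using torus.span_sub[OF dk] by blast
  show "\<exists>v\<in>lin_span torus (torus_disk F C). \<forall>r>0. \<exists>N. \<forall>n\<ge>N. s n \<ominus>\<^bsub>torus\<^esub> v \<in> torus.scl r (torus_disk F C)"
    by (rule bexI[OF _ asp]) (use lim in \<open>simp add: scl_torus_disk torus_minus sc ac\<close>)
qed

lemma torus_complete: "complete_born_space torus"
  unfolding complete_born_space_def
proof (intro conjI ballI torus_born_vector_space)
  fix B assume "B \<in> bornology torus"
  then obtain F C where F: "finite F" "B \<subseteq> torus_disk F C" by (rule torus_bornologyE)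
  \<comment> \<open>The bounds \<open>C n\<close> may be negative when \<open>B\<close> is empty,
    whereas a disk has to contain the zero function.\<close>
  let ?D = "torus_disk F (\<lambda>n. max 0 (C n))"
  have "B \<subseteq> ?D" using F(2) by (auto intro: torus_disk_mono)
  moreover have "completant torus ?D" by (rule torus_disk_completant[OF F(1)]) simp
  moreover have "?D \<in> bornology torus" by (rule torus_bornologyI[OF F(1) order_refl])
  ultimately show "\<exists>D\<in>bornology torus. B \<subseteq> D \<and> completant torus D" by blast
qed

end

section \<open>The convolution product\<close>

lemma infsum_finite_support:
  assumes "finite J" "\<And>j. j \<notin> J \<Longrightarrow> f j = 0"
  shows "infsum f UNIV = sum f J"
proof -
  have "infsum f UNIV = infsum f J" by (rule infsum_cong_neutral) (use assms(2) in auto)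
  then show ?thesis using assms(1) by simp
qed

context rotation_algebra
begin

text \<open>\<open>J\<close> may be any finite set outside which \<open>b\<close> vanishes, so
  several products can be expanded over a common index set.\<close>

lemma torus_mult:
  assumes "finite J" "\<forall>j x. j \<notin> J \<longrightarrow> b (j, x) = 0"
  shows "(a \<otimes>\<^bsub>torus\<^esub> b) (k, x) = (\<Sum>j\<in>J. a (k - j, rotate \<theta> j x) * b (j, x))"
  using infsum_finite_support[OF assms(1), of "\<lambda>j. a (k - j, rotate \<theta> j x) * b (j, x)"] assms(2)
  by (simp add: noncommutative_torus_def)

text \<open>A fibre of the product is a sum over \<open>G\<close> of products of a translated fibre
  of \<open>a\<close> with a fibre of \<open>b\<close>. Translation preserves the derivative bounds,
  and \<open>nth_derivative_mult_bound\<close> estimates each summand by a constant that depends on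
  \<open>C\<close> and \<open>D\<close> alone. So \<open>E\<close> serves all \<open>a\<close> and
  \<open>b\<close> at once, which is boundedness of the multiplication.\<close>

lemma torus_mult_disk:
  assumes F: "finite F" and G: "finite G"
  shows "\<exists>E. \<forall>a\<in>torus_disk F C. \<forall>b\<in>torus_disk G D. a \<otimes>\<^bsub>torus\<^esub> b \<in> torus_disk ((\<lambda>(i, j). i + j) ` (F \<times> G)) E"
proof -
  have "\<forall>n. \<exists>K. \<forall>f g. smooth_fun f \<longrightarrow> smooth_fun g \<longrightarrow> (\<forall>m t. cmod (nth_derivative m f t) \<le> C m) \<longrightarrow>
     (\<forall>m t. cmod (nth_derivative m g t) \<le> D m) \<longrightarrow> (\<forall>t. cmod (nth_derivative n (\<lambda>t. f t * g t) t) \<le> K)"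
    using nth_derivative_mult_bound[of C D] by simp
  from choice[OF this] obtain K where K: "\<And>n f g t. smooth_fun f \<Longrightarrow> smooth_fun g \<Longrightarrow>
      (\<And>m t. cmod (nth_derivative m f t) \<le> C m) \<Longrightarrow> (\<And>m t. cmod (nth_derivative m g t) \<le> D m) \<Longrightarrow>
      cmod (nth_derivative n (\<lambda>t. f t * g t) t) \<le> K n" by blast
  have "a \<otimes>\<^bsub>torus\<^esub> b \<in> torus_disk ((\<lambda>(i, j). i + j) ` (F \<times> G)) (\<lambda>n. of_nat (card G) * K n)"
    if "a \<in> torus_disk F C" and "b \<in> torus_disk G D" for a b
  proof (rule torus_diskI)
    note a = torus_diskD[OF that(1)] and b = torus_diskD[OF that(2)]
    have m: "(a \<otimes>\<^bsub>torus\<^esub> b) (k, x) = (\<Sum>j\<in>G. a (k - j, rotate \<theta> j x) * b (j, x))" for k x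
      by (rule torus_mult[OF G]) (use b(4) in blast)
    have fm: "fibre (a \<otimes>\<^bsub>torus\<^esub> b) k = (\<lambda>t. \<Sum>j\<in>G. fibre a (k - j) (t + of_int j * \<theta>) * fibre b j t)" for k
      by (simp add: m rotate_abs_circle)
    have sa: "smooth_fun (\<lambda>t. fibre a k (t + c))" for k c by (rule smooth_fun_shift[OF a(1)])
    have da: "cmod (nth_derivative n (\<lambda>t. fibre a k (t + c)) t) \<le> C n" for n k c t
      using nth_derivative_shift[of n "fibre a k" c] a(3) by simp
    note sab = smooth_fun_mult[OF sa b(1)]
    show "smooth_fun (fibre (a \<otimes>\<^bsub>torus\<^esub> b) k)" for k
      unfolding fm by (rule smooth_fun_sum[OF sab])
    show "k \<in> (\<lambda>(i, j). i + j) ` (F \<times> G)" if "(a \<otimes>\<^bsub>torus\<^esub> b) (k, x) \<noteq> 0" for k x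
    proof -
      obtain j where "j \<in> G" "a (k - j, rotate \<theta> j x) * b (j, x) \<noteq> 0"
        using \<open>(a \<otimes>\<^bsub>torus\<^esub> b) (k, x) \<noteq> 0\<close> unfolding m by (meson sum.neutral)
      then show ?thesis using a(2)[of "k - j" "rotate \<theta> j x"] by (intro image_eqI[of _ _ "(k - j, j)"]) auto
    qed
    show "cmod (nth_derivative n (fibre (a \<otimes>\<^bsub>torus\<^esub> b) k) t) \<le> of_nat (card G) * K n" for n k t
      unfolding fm nth_derivative_sum[OF sab]
    proof (rule order_trans[OF norm_sum sum_bounded_above])
      fix j
      show "cmod (nth_derivative n (\<lambda>t. fibre a (k - j) (t + of_int j * \<theta>) * fibre b j t) t) \<le> K n"
        by (rule K[OF sa b(1) da b(3)])
    qed
  qed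
  then show ?thesis by blast
qed

lemma torus_mult_carrier:
  assumes "a \<in> carrier torus" "b \<in> carrier torus" shows "a \<otimes>\<^bsub>torus\<^esub> b \<in> carrier torus"
proof -
  obtain F C where F: "finite F" "a \<in> torus_disk F C" using assms(1) by (rule torus_carrierE)
  obtain G D where G: "finite G" "b \<in> torus_disk G D" using assms(2) by (rule torus_carrierE)
  from torus_mult_disk[OF F(1) G(1), of C D] F(2) G(2) obtain E
    where "a \<otimes>\<^bsub>torus\<^esub> b \<in> torus_disk ((\<lambda>(i, j). i + j) ` (F \<times> G)) E" by blast
  then show ?thesis using F(1) G(1) by (intro torus_carrierI) auto
qed

lemma torus_carrier_support:
  assumes "a \<in> carrier torus" obtains F where "finite F" "\<forall>k x. k \<notin> F \<longrightarrow> a (k, x) = 0"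
  using torus_carrierE[OF assms] torus_diskD(4) by metis

lemma torus_mult_bilinear: "bounded_bilinear_map torus torus torus (mult torus)"
  unfolding bounded_bilinear_map_def
proof (intro conjI ballI allI)
  fix a b assume ab: "a \<in> carrier torus" "b \<in> carrier torus"
  show "a \<otimes>\<^bsub>torus\<^esub> b \<in> carrier torus" by (rule torus_mult_carrier[OF ab])
  obtain G where G: "finite G" "\<forall>k x. k \<notin> G \<longrightarrow> b (k, x) = 0" using ab(2) by (rule torus_carrier_support)
  note m = torus_mult[OF G]
  show "(c \<odot>\<^bsub>torus\<^esub> a) \<otimes>\<^bsub>torus\<^esub> b = c \<odot>\<^bsub>torus\<^esub> (a \<otimes>\<^bsub>torus\<^esub> b)" for c
    by (rule ext, rule prod.induct) (simp add: m torus_simps sum_distrib_left mult.assoc)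
  show "a \<otimes>\<^bsub>torus\<^esub> (c \<odot>\<^bsub>torus\<^esub> b) = c \<odot>\<^bsub>torus\<^esub> (a \<otimes>\<^bsub>torus\<^esub> b)" for c
    by (rule ext, rule prod.induct) (simp add: m torus_mult[OF G(1)] G(2) torus_simps sum_distrib_left mult.left_commute)
  fix a' assume a': "a' \<in> carrier torus"
  show "(a \<oplus>\<^bsub>torus\<^esub> a') \<otimes>\<^bsub>torus\<^esub> b = a \<otimes>\<^bsub>torus\<^esub> b \<oplus>\<^bsub>torus\<^esub> a' \<otimes>\<^bsub>torus\<^esub> b"
    by (rule ext, rule prod.induct) (simp add: m torus_simps sum.distrib algebra_simps)
  obtain F where F: "finite F" "\<forall>k x. k \<notin> F \<longrightarrow> a' (k, x) = 0" using a' by (rule torus_carrier_support)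
  \<comment> \<open>A common index set for both right factors and their sum.\<close>
  have FG: "finite (F \<union> G)" using F G by simp
  show "a \<otimes>\<^bsub>torus\<^esub> (b \<oplus>\<^bsub>torus\<^esub> a') = a \<otimes>\<^bsub>torus\<^esub> b \<oplus>\<^bsub>torus\<^esub> a \<otimes>\<^bsub>torus\<^esub> a'"
    by (rule ext, rule prod.induct)
      (simp add: torus_mult[OF FG] F(2) G(2) torus_simps sum.distrib algebra_simps)
next
  fix S T assume S: "S \<in> bornology torus" and T: "T \<in> bornology torus"
  obtain F C where F: "finite F" "S \<subseteq> torus_disk F C" using S by (rule torus_bornologyE)
  obtain G D where G: "finite G" "T \<subseteq> torus_disk G D" using T by (rule torus_bornologyE)
  from torus_mult_disk[OF F(1) G(1), of C D] obtain E where
    E: "\<And>a b. a \<in> torus_disk F C \<Longrightarrow> b \<in> torus_disk G D \<Longrightarrow>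
      a \<otimes>\<^bsub>torus\<^esub> b \<in> torus_disk ((\<lambda>(i, j). i + j) ` (F \<times> G)) E" by blast
  show "{a \<otimes>\<^bsub>torus\<^esub> b |a b. a \<in> S \<and> b \<in> T} \<in> bornology torus"
    by (rule torus_bornologyI[of "(\<lambda>(i, j). i + j) ` (F \<times> G)" _ E]) (use F G E in blast)+
qed

text \<open>Both sides become double sums over the supports of \<open>b\<close> and
  \<open>c\<close>. Substituting \<open>i + j\<close> for the outer index on the right matches them,
  since rotating by \<open>i\<close> and then by \<open>j\<close> is rotating by
  \<open>i + j\<close>.\<close>

lemma torus_mult_assoc:
  assumes a: "a \<in> carrier torus" and b: "b \<in> carrier torus" and c: "c \<in> carrier torus"
  shows "(a \<otimes>\<^bsub>torus\<^esub> b) \<otimes>\<^bsub>torus\<^esub> c = a \<otimes>\<^bsub>torus\<^esub> (b \<otimes>\<^bsub>torus\<^esub> c)"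
proof (rule ext, rule prod.induct)
  fix k x
  obtain G where G: "finite G" "\<forall>k x. k \<notin> G \<longrightarrow> b (k, x) = 0" using b by (rule torus_carrier_support)
  obtain H where H: "finite H" "\<forall>k x. k \<notin> H \<longrightarrow> c (k, x) = 0" using c by (rule torus_carrier_support)
  let ?J = "(\<lambda>(i, j). i + j) ` (G \<times> H)"
  have J: "finite ?J" using G H by simp
  have bc: "\<forall>j x. j \<notin> ?J \<longrightarrow> (b \<otimes>\<^bsub>torus\<^esub> c) (j, x) = 0"
    unfolding torus_mult[OF H]
  proof (intro allI impI sum.neutral ballI)
    fix j x assume j: "j \<notin> ?J"
    fix i assume i: "i \<in> H"
    have "j - i \<notin> G"
    proof
      assume "j - i \<in> G"
      with i have "j \<in> ?J" by (intro image_eqI[of _ _ "(j - i, i)"]) auto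
      with j show False by simp
    qed
    then show "b (j - i, rotate \<theta> i x) * c (i, x) = 0" by (simp add: G(2))
  qed
  have "(a \<otimes>\<^bsub>torus\<^esub> (b \<otimes>\<^bsub>torus\<^esub> c)) (k, x)
      = (\<Sum>j\<in>?J. \<Sum>i\<in>H. a (k - j, rotate \<theta> j x) * (b (j - i, rotate \<theta> i x) * c (i, x)))"
    unfolding torus_mult[OF J bc] torus_mult[OF H] by (simp add: sum_distrib_left)
  also have "\<dots> = (\<Sum>i\<in>H. \<Sum>j\<in>?J. a (k - j, rotate \<theta> j x) * (b (j - i, rotate \<theta> i x) * c (i, x)))"
    by (rule sum.swap)
  \<comment> \<open>For fixed \<open>i\<close>, the terms of \<open>?J\<close> outside the translate
    \<open>i + G\<close> vanish because \<open>b\<close> does; the remaining ones are reindexed by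
    \<open>G\<close>.\<close>
  also have "\<dots> = (\<Sum>i\<in>H. \<Sum>j\<in>G. a (k - (i + j), rotate \<theta> (i + j) x) * (b (j, rotate \<theta> i x) * c (i, x)))"
  proof (rule sum.cong[OF refl])
    fix i assume i: "i \<in> H"
    have "(\<Sum>j\<in>?J. a (k - j, rotate \<theta> j x) * (b (j - i, rotate \<theta> i x) * c (i, x)))
        = (\<Sum>j\<in>(\<lambda>j. i + j) ` G. a (k - j, rotate \<theta> j x) * (b (j - i, rotate \<theta> i x) * c (i, x)))"
    proof (rule sum.mono_neutral_right[OF J], safe)
      show "i + j \<in> ?J" if "j \<in> G" for j using i that by (intro image_eqI[of _ _ "(j, i)"]) auto
      fix g h assume "g + h \<notin> (+) i ` G"
      then have "g + h - i \<notin> G" by (metis add_diff_cancel_left' diff_add_cancel add.commute image_eqI)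
      then show "a (k - (g + h), rotate \<theta> (g + h) x) * (b (g + h - i, rotate \<theta> i x) * c (i, x)) = 0"
        by (simp add: G(2))
    qed
    also have "\<dots> = (\<Sum>j\<in>G. a (k - (i + j), rotate \<theta> (i + j) x) * (b (j, rotate \<theta> i x) * c (i, x)))"
      by (subst sum.reindex) (auto simp: inj_on_def)
    finally show "(\<Sum>j\<in>?J. a (k - j, rotate \<theta> j x) * (b (j - i, rotate \<theta> i x) * c (i, x)))
        = (\<Sum>j\<in>G. a (k - (i + j), rotate \<theta> (i + j) x) * (b (j, rotate \<theta> i x) * c (i, x)))" .
  qed
  also have "\<dots> = ((a \<otimes>\<^bsub>torus\<^esub> b) \<otimes>\<^bsub>torus\<^esub> c) (k, x)"
    unfolding torus_mult[OF H] torus_mult[OF G]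
    by (simp add: rotate_rotate sum_distrib_right mult.assoc diff_diff_add)
  finally show "((a \<otimes>\<^bsub>torus\<^esub> b) \<otimes>\<^bsub>torus\<^esub> c) (k, x) = (a \<otimes>\<^bsub>torus\<^esub> (b \<otimes>\<^bsub>torus\<^esub> c)) (k, x)" by simp
qed

lemma torus_algebra: "complete_born_algebra torus"
  unfolding complete_born_algebra_def
  using torus_complete torus_mult_bilinear torus_mult_assoc by blast

end

section \<open>Unital bimodules are smooth\<close>

lemma bounded_linear_map_right:
  assumes V: "born_vector_space V" and b: "bounded_bilinear_map V W X b" and v: "v \<in> carrier V"
  shows "bounded_linear_map W X (b v)"
proof -
  interpret V: born_vs V by (rule born_vs.intro[OF V])
  have "b v ` A \<in> bornology X" if "A \<in> bornology W" for A
  proof -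
    have "b v ` A = (\<lambda>(v, w). b v w) ` ({v} \<times> A)" by force
    then show ?thesis using bounded_bilinear_mapD(6)[OF b V.bornology_single[OF v] that] by simp
  qed
  then show ?thesis using v by (simp add: bounded_linear_map_def bounded_bilinear_mapD[OF b])
qed

lemma bounded_linear_map_id: "bounded_linear_map V V (\<lambda>x. x)"
  by (simp add: bounded_linear_map_def)

lemma unital_smooth_bimodule:
  assumes M: "born_bimodule A M l r" and u: "u \<in> carrier A"
    and ul: "\<And>a. a \<in> carrier A \<Longrightarrow> u \<otimes>\<^bsub>A\<^esub> a = a" and ur: "\<And>a. a \<in> carrier A \<Longrightarrow> a \<otimes>\<^bsub>A\<^esub> u = a"
    and lu: "\<And>m. m \<in> carrier M \<Longrightarrow> l u m = m" and ru: "\<And>m. m \<in> carrier M \<Longrightarrow> r m u = m"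
  shows "smooth_bimodule A M l r"
proof -
  have cA: "complete_born_space A" and cM: "complete_born_space M"
    and bA: "bounded_bilinear_map A A A (mult A)"
    and bl: "bounded_bilinear_map A M M l" and br: "bounded_bilinear_map M A M r"
    and al: "\<And>a b m. a \<in> carrier A \<Longrightarrow> b \<in> carrier A \<Longrightarrow> m \<in> carrier M \<Longrightarrow> l (a \<otimes>\<^bsub>A\<^esub> b) m = l a (l b m)"
    and ar: "\<And>a b m. a \<in> carrier A \<Longrightarrow> b \<in> carrier A \<Longrightarrow> m \<in> carrier M \<Longrightarrow> r m (a \<otimes>\<^bsub>A\<^esub> b) = r (r m a) b"
    using M by (auto simp: born_bimodule_def complete_born_algebra_def)
  interpret L: balanced A A M "mult A" l by unfold_locales fact+
  interpret R: balanced M A A r "mult A" by unfold_locales fact+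
  obtain f where f: "bounded_linear_map (balanced_tensor_space A A M (mult A) l) M f"
    "\<And>a m. a \<in> carrier A \<Longrightarrow> m \<in> carrier M \<Longrightarrow> f (balanced_tensor A A M (mult A) l a m) = l a m"
    using L.balanced_tensor_lift[OF cM bl] al by auto
  let ?g = "balanced_tensor A A M (mult A) l u"
  have g: "bounded_linear_map M (balanced_tensor_space A A M (mult A) l) ?g"
    by (rule bounded_linear_map_right[OF L.bvs[OF cA] L.bounded_bilinear_balanced_tensor u])
  \<comment> \<open>On elementary tensors, balancing moves \<open>a\<close> to the left factor:
    \<open>u \<otimes> (a m) = (u a) \<otimes> m = a \<otimes> m\<close>. Elementary tensors
    determine bounded linear maps into a complete space.\<close>
  have gf: "?g (f t) = t" if "t \<in> carrier (balanced_tensor_space A A M (mult A) l)" for t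
  proof (rule L.balanced_tensor_ext[OF L.complete_balanced_tensor_space
        bounded_linear_map_comp[OF f(1) g] bounded_linear_map_id _ that])
    fix a m assume "a \<in> carrier A" "m \<in> carrier M"
    then show "?g (f (balanced_tensor A A M (mult A) l a m)) = balanced_tensor A A M (mult A) l a m"
      using L.balanced_tensor_balanced[of u a m, symmetric] u by (simp add: f(2) ul)
  qed
  have fl: "\<exists>f. born_iso (balanced_tensor_space A A M (mult A) l) M f
          \<and> (\<forall>a\<in>carrier A. \<forall>m\<in>carrier M. f (balanced_tensor A A M (mult A) l a m) = l a m)"
    unfolding born_iso_def using f g gf lu u by (intro exI[of _ f] conjI exI[of _ ?g]) simp_all
  obtain h where h: "bounded_linear_map (balanced_tensor_space M A A r (mult A)) M h"
    "\<And>a m. m \<in> carrier M \<Longrightarrow> a \<in> carrier A \<Longrightarrow> h (balanced_tensor M A A r (mult A) m a) = r m a"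
    using R.balanced_tensor_lift[OF cM br] ar by auto
  let ?k = "\<lambda>m. balanced_tensor M A A r (mult A) m u"
  have k: "bounded_linear_map M (balanced_tensor_space M A A r (mult A)) ?k"
    by (rule bounded_linear_map_left[OF R.bvs[OF cA] R.bounded_bilinear_balanced_tensor u])
  have kh: "?k (h t) = t" if "t \<in> carrier (balanced_tensor_space M A A r (mult A))" for t
  proof (rule R.balanced_tensor_ext[OF R.complete_balanced_tensor_space
        bounded_linear_map_comp[OF h(1) k] bounded_linear_map_id _ that])
    fix m a assume "m \<in> carrier M" "a \<in> carrier A"
    then show "?k (h (balanced_tensor M A A r (mult A) m a)) = balanced_tensor M A A r (mult A) m a"
      using R.balanced_tensor_balanced[of m a u] u by (simp add: h(2) ur)
  qed
  have fr: "\<exists>f. born_iso (balanced_tensor_space M A A r (mult A)) M f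
          \<and> (\<forall>m\<in>carrier M. \<forall>a\<in>carrier A. f (balanced_tensor M A A r (mult A) m a) = r m a)"
    unfolding born_iso_def using h k kh ru u by (intro exI[of _ h] conjI exI[of _ ?k]) simp_all
  show ?thesis unfolding smooth_bimodule_def using M fl fr by blast
qed

section \<open>Ideals\<close>

text \<open>Smoothness of the zero ideal includes completeness of its underlying space. The bounded
  sets are the empty set and \<open>{\<zero>}\<close>, so the single disk \<open>{\<zero>}\<close>
  suffices.\<close>

lemma zero_complete_born_space:
  assumes "born_vector_space V" shows "complete_born_space (sub_space V {\<zero>\<^bsub>V\<^esub>})"
proof -
  interpret V: born_vs V by (rule born_vs.intro[OF assms])
  let ?Z = "sub_space V {\<zero>\<^bsub>V\<^esub>}"
  have simps: "carrier ?Z = {\<zero>\<^bsub>V\<^esub>}" "zero ?Z = \<zero>\<^bsub>V\<^esub>" "add ?Z = add V" "smult ?Z = smult V"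
    by (simp_all add: sub_space_def)
  have born: "bornology ?Z = {{}, {\<zero>\<^bsub>V\<^esub>}}"
    using V.bornology_empty V.bornology_single by (auto simp: sub_space_def)
  have sz: "c \<odot>\<^bsub>V\<^esub> \<zero>\<^bsub>V\<^esub> = \<zero>\<^bsub>V\<^esub>" for c by (rule V.smult_r_null) simp
  have bZ: "born_vector_space ?Z"
    unfolding born_vector_space_def
  proof (intro conjI ballI allI)
    show "Module.module complex_ring ?Z"
      by (rule complex_moduleI) (auto simp: simps sz)
    show "is_bornology (carrier ?Z) (bornology ?Z)"
      unfolding is_bornology_def born simps by auto
  qed (auto simp: born simps sz)
  interpret Z: born_vs ?Z by (rule born_vs.intro[OF bZ])
  have dk: "disk ?Z {\<zero>\<^bsub>V\<^esub>}" by (simp add: disk_def simps sz)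
  have sp: "lin_span ?Z {\<zero>\<^bsub>V\<^esub>} = {\<zero>\<^bsub>V\<^esub>}"
    using Z.span_sub[OF dk] Z.submodule_D(2)[OF Z.span_submodule[OF dk]] by (auto simp: simps)
  have "completant ?Z {\<zero>\<^bsub>V\<^esub>}"
    unfolding Z.completant_iff[OF dk]
  proof (intro conjI allI impI)
    fix v assume "\<forall>r>0. v \<in> Z.scl r {\<zero>\<^bsub>V\<^esub>}"
    then have "v \<in> Z.scl 1 {\<zero>\<^bsub>V\<^esub>}" by simp
    then show "v = \<zero>\<^bsub>?Z\<^esub>" by (simp add: Z.scl_def simps sz)
  next
    fix s :: "nat \<Rightarrow> 'a"
    assume "range s \<subseteq> lin_span ?Z {\<zero>\<^bsub>V\<^esub>} \<and>
      (\<forall>r>0. \<exists>N. \<forall>m\<ge>N. \<forall>n\<ge>N. s m \<ominus>\<^bsub>?Z\<^esub> s n \<in> Z.scl r {\<zero>\<^bsub>V\<^esub>})"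
    then have s: "s n = \<zero>\<^bsub>?Z\<^esub>" for n by (auto simp: sp simps)
    have "s n \<ominus>\<^bsub>?Z\<^esub> \<zero>\<^bsub>?Z\<^esub> \<in> Z.scl r {\<zero>\<^bsub>V\<^esub>}" for n r
      using Z.scl_zero[OF dk] Z.diff_zero_iff[of "\<zero>\<^bsub>?Z\<^esub>" "\<zero>\<^bsub>?Z\<^esub>"] by (simp add: s)
    then show "\<exists>v\<in>lin_span ?Z {\<zero>\<^bsub>V\<^esub>}. \<forall>r>0. \<exists>N. \<forall>n\<ge>N. s n \<ominus>\<^bsub>?Z\<^esub> v \<in> Z.scl r {\<zero>\<^bsub>V\<^esub>}"
      by (auto simp: sp simps)
  qed
  then show ?thesis unfolding complete_born_space_def using bZ by (auto simp: born)
qed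

text \<open>A Mackey limit of the zero sequence lies in every positive multiple of one bounded disk,
  hence is zero because complete spaces are separated.\<close>

lemma zero_closed_subspace:
  assumes "complete_born_space V" shows "closed_subspace V {\<zero>\<^bsub>V\<^esub>}"
  unfolding closed_subspace_def
proof (intro conjI allI impI)
  interpret V: complete_vs V by (rule complete_vsI[OF assms])
  show "submodule {\<zero>\<^bsub>V\<^esub>} complex_ring V"
    by (rule V.submodule_I) auto
  fix s v assume "range s \<subseteq> {\<zero>\<^bsub>V\<^esub>} \<and> v \<in> carrier V \<and> Mackey_converges V s v"
  then have s: "\<And>n. s n = \<zero>\<^bsub>V\<^esub>" and v: "v \<in> carrier V" and "Mackey_converges V s v" by auto
  then obtain D where D: "D \<in> bornology V" "disk V D"
    "\<And>r. r > 0 \<Longrightarrow> \<exists>N. \<forall>n\<ge>N. s n \<ominus>\<^bsub>V\<^esub> v \<in> V.scl r D"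
    unfolding V.Mackey_iff by blast
  have "v \<in> V.scl r D" if "r > 0" for r
  proof -
    have "\<zero>\<^bsub>V\<^esub> \<ominus>\<^bsub>V\<^esub> v \<in> V.scl r D" using D(3)[OF that] s by auto
    from V.scl_diff_commute[OF D(2) _ v this] that v show ?thesis
      using V.add_diff_self[of "\<zero>\<^bsub>V\<^esub>" v] by simp
  qed
  from V.complete_separated[OF D(1) this] show "v \<in> {\<zero>\<^bsub>V\<^esub>}" by simp
qed

text \<open>Lets the whole algebra be treated as an ideal of itself.\<close>

lemma sub_space_carrier:
  assumes "born_vector_space V" shows "sub_space V (carrier V) = V"
proof -
  interpret V: born_vs V by (rule born_vs.intro[OF assms])
  have "{B \<in> bornology V. B \<subseteq> carrier V} = bornology V" using V.bornology_carrier by auto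
  then show ?thesis by (simp add: sub_space_def)
qed

lemma bounded_bilinear_sub_space:
  assumes f: "bounded_bilinear_map V W X f" and V': "V' \<subseteq> carrier V" and W': "W' \<subseteq> carrier W"
    and X': "\<And>v w. v \<in> V' \<Longrightarrow> w \<in> W' \<Longrightarrow> f v w \<in> X'"
  shows "bounded_bilinear_map (sub_space V V') (sub_space W W') (sub_space X X') f"
proof -
  note D = bounded_bilinear_mapD[OF f]
  have "(\<lambda>(a, b). f a b) ` (A \<times> B) \<in> bornology (sub_space X X')"
    if "A \<in> bornology (sub_space V V')" "B \<in> bornology (sub_space W W')" for A B
    using that D(6)[of A B] by (auto simp: sub_space_def intro!: X')
  then show ?thesis
    unfolding bounded_bilinear_map_def setcompr2'
    using subsetD[OF V'] subsetD[OF W'] by (simp add: D(1-5) X' sub_space_def)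
qed

section \<open>Monomials, the unit and the two trivial ideals\<close>

context rotation_algebra
begin

text \<open>In crossed product notation this is \<open>U^m f\<close>, where the unitary
  \<open>U = monomial 1 (\<lambda>x. 1)\<close> implements the rotation and functions stand on the
  right.\<close>

definition monomial :: "int \<Rightarrow> (circle \<Rightarrow> complex) \<Rightarrow> int \<times> circle \<Rightarrow> complex" where
  "monomial m f = (\<lambda>(k, x). if k = m then f x else 0)"

lemma monomial_carrier:
  assumes "smooth_fun (\<lambda>t. f (abs_circle t))" shows "monomial m f \<in> carrier torus"
proof -
  have "\<exists>C. monomial m f \<in> torus_disk {m} C"
  proof (rule torus_disk_exists)
    show "smooth_fun (fibre (monomial m f) k)" for k
      using assms by (cases "k = m") (simp_all add: monomial_def smooth_fun_const)
  qed (auto simp: monomial_def split: if_splits)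
  then show ?thesis using torus_carrierI[of "{m}"] by blast
qed

lemma torus_smooth: "a \<in> carrier torus \<Longrightarrow> smooth_fun (fibre a k)"
  using torus_carrierE torus_diskD(1) by metis

lemma monomial_mult_left:
  assumes "a \<in> carrier torus"
  shows "(monomial m f \<otimes>\<^bsub>torus\<^esub> a) (k, x) = f (rotate \<theta> (k - m) x) * a (k - m, x)"
proof -
  obtain F where F: "finite F" "\<forall>k x. k \<notin> F \<longrightarrow> a (k, x) = 0" using assms by (rule torus_carrier_support)
  \<comment> \<open>The only index that can contribute is \<open>k - m\<close>, which has to be
    present even if it lies outside the support of \<open>a\<close>.\<close>
  let ?J = "insert (k - m) F"
  have "(monomial m f \<otimes>\<^bsub>torus\<^esub> a) (k, x)
      = (\<Sum>j\<in>?J. monomial m f (k - j, rotate \<theta> j x) * a (j, x))"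
    by (rule torus_mult) (use F in auto)
  also have "\<dots> = (\<Sum>j\<in>?J. if j = k - m then f (rotate \<theta> j x) * a (j, x) else 0)"
    by (rule sum.cong) (auto simp: monomial_def)
  also have "\<dots> = f (rotate \<theta> (k - m) x) * a (k - m, x)"
    using F(1) by (subst sum.delta) auto
  finally show ?thesis .
qed

lemma monomial_mult_right:
  "(a \<otimes>\<^bsub>torus\<^esub> monomial m f) (k, x) = a (k - m, rotate \<theta> m x) * f x"
proof -
  have "(a \<otimes>\<^bsub>torus\<^esub> monomial m f) (k, x) = (\<Sum>j\<in>{m}. a (k - j, rotate \<theta> j x) * monomial m f (j, x))"
    by (rule torus_mult) (auto simp: monomial_def)
  then show ?thesis by (simp add: monomial_def)
qed

definition torus_unit :: "int \<times> circle \<Rightarrow> complex" where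
  "torus_unit = monomial 0 (\<lambda>x. 1)"

lemma torus_unit_carrier: "torus_unit \<in> carrier torus"
  unfolding torus_unit_def by (rule monomial_carrier[OF smooth_fun_const])

lemma torus_unit_left: "a \<in> carrier torus \<Longrightarrow> torus_unit \<otimes>\<^bsub>torus\<^esub> a = a"
  by (rule ext, rule prod.induct) (simp add: torus_unit_def monomial_mult_left)

lemma torus_unit_right: "a \<otimes>\<^bsub>torus\<^esub> torus_unit = a"
  by (rule ext, rule prod.induct) (simp add: torus_unit_def monomial_mult_right rotate_0)

text \<open>The actions are restrictions of the multiplication and \<open>torus_unit\<close> acts as
  the identity on both sides, so \<open>unital_smooth_bimodule\<close> applies.\<close>

lemma ideal_smooth:
  assumes I: "I \<subseteq> carrier torus" "\<And>a x. a \<in> carrier torus \<Longrightarrow> x \<in> I \<Longrightarrow> a \<otimes>\<^bsub>torus\<^esub> x \<in> I \<and> x \<otimes>\<^bsub>torus\<^esub> a \<in> I"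
    and c: "complete_born_space (sub_space torus I)"
  shows "smooth_bimodule torus (sub_space torus I) (mult torus) (mult torus)"
proof (rule unital_smooth_bimodule[OF _ torus_unit_carrier])
  have sI: "carrier (sub_space torus I) = I" by (simp add: sub_space_def)
  note b = bounded_bilinear_sub_space[OF torus_mult_bilinear]
  have "bounded_bilinear_map torus (sub_space torus I) (sub_space torus I) (mult torus)"
    using b[of "carrier torus" I I] I by (simp add: sub_space_carrier[OF torus_born_vector_space])
  moreover have "bounded_bilinear_map (sub_space torus I) torus (sub_space torus I) (mult torus)"
    using b[of I "carrier torus" I] I by (simp add: sub_space_carrier[OF torus_born_vector_space])
  ultimately show "born_bimodule torus (sub_space torus I) (mult torus) (mult torus)"
    unfolding born_bimodule_def sI using torus_algebra c subsetD[OF I(1)] by (simp add: torus_mult_assoc)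
qed (use I(1) in \<open>auto simp: sub_space_def torus_unit_left torus_unit_right\<close>)

lemma torus_self_induced: "self_induced torus"
proof -
  have "smooth_bimodule torus (sub_space torus (carrier torus)) (mult torus) (mult torus)"
    by (rule ideal_smooth)
      (simp_all add: torus_mult_carrier sub_space_carrier[OF torus_born_vector_space] torus_complete)
  then show ?thesis
    by (simp add: self_induced_def torus_algebra sub_space_carrier[OF torus_born_vector_space])
qed

lemma born_ideal_carrier: "born_ideal torus (carrier torus)"
  using torus_self_induced
  by (simp add: born_ideal_def torus.closed_subspace_carrier torus_mult_carrier
      sub_space_carrier[OF torus_born_vector_space] self_induced_def)

lemma born_ideal_zero: "born_ideal torus {\<zero>\<^bsub>torus\<^esub>}"
proof -
  have z: "a \<otimes>\<^bsub>torus\<^esub> \<zero>\<^bsub>torus\<^esub> = \<zero>\<^bsub>torus\<^esub>" "\<zero>\<^bsub>torus\<^esub> \<otimes>\<^bsub>torus\<^esub> a = \<zero>\<^bsub>torus\<^esub>" for a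
    by (simp_all add: noncommutative_torus_def fun_eq_iff)
  show ?thesis
    unfolding born_ideal_def
    using torus_self_induced zero_closed_subspace[OF torus_complete]
      ideal_smooth[of "{\<zero>\<^bsub>torus\<^esub>}", OF _ _ zero_complete_born_space[OF torus_born_vector_space]]
    by (simp add: z)
qed

end

section \<open>Nonzero ideals at an irrational angle\<close>

lift_definition circle_exp :: "circle \<Rightarrow> complex" is "\<lambda>t. cis (2 * pi * t)"
proof -
  fix s t :: real assume "s - t \<in> \<int>"
  then have "cis (2 * pi * (s - t)) = 1" by (simp add: cis_multiple_2pi)
  moreover have "cis (2 * pi * s) = cis (2 * pi * (s - t)) * cis (2 * pi * t)"
    by (simp add: cis_mult algebra_simps)
  ultimately show "cis (2 * pi * s) = cis (2 * pi * t)" by simp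
qed

text \<open>\<open>circle_exp\<close> is a character of modulus 1, so the factor produced by
  conjugation does not depend on the point \<open>x\<close>.\<close>

lemma circle_exp_rotate: "circle_exp (rotate \<theta> k x) * cnj (circle_exp x) = cis (2 * pi * (of_int k * \<theta>))"
  by (rule circle_obtain[of x]) (simp add: rotate_abs_circle circle_exp.abs_eq cis_cnj cis_mult algebra_simps)

lemma cis_2pi_int_mult_irrational:
  assumes "\<theta> \<notin> \<rat>" "k \<noteq> 0" shows "cis (2 * pi * (of_int k * \<theta>)) \<noteq> 1"
proof
  assume "cis (2 * pi * (of_int k * \<theta>)) = 1"
  then have "cos (2 * pi * (of_int k * \<theta>)) = 1" by (metis cis.simps(1) one_complex.simps(1))
  then obtain n where "2 * pi * (of_int k * \<theta>) = of_int n * 2 * pi" by (auto simp: cos_one_2pi_int)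
  then have "\<theta> = of_int n / of_int k" using assms(2) by (simp add: field_simps)
  then show False using assms(1) by simp
qed

locale torus_ideal = rotation_algebra +
  fixes I
  assumes irrational: "\<theta> \<notin> \<rat>"
    and sub: "submodule I complex_ring torus"
    and left: "\<And>a b. a \<in> carrier torus \<Longrightarrow> b \<in> I \<Longrightarrow> a \<otimes>\<^bsub>torus\<^esub> b \<in> I"
    and right: "\<And>a b. a \<in> carrier torus \<Longrightarrow> b \<in> I \<Longrightarrow> b \<otimes>\<^bsub>torus\<^esub> a \<in> I"
begin

lemma ideal_carrier: "a \<in> I \<Longrightarrow> a \<in> carrier torus"
  using torus.submodule_D(1)[OF sub] by blast

lemma ideal_add: "a \<in> I \<Longrightarrow> b \<in> I \<Longrightarrow> (\<lambda>p. a p + b p) \<in> I"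
  using torus.submodule_D(3)[OF sub] by (simp add: torus_simps)

lemma ideal_smult: "a \<in> I \<Longrightarrow> (\<lambda>p. c * a p) \<in> I"
  using torus.submodule_D(4)[OF sub] by (simp add: torus_simps)

lemma ideal_sum: "(\<And>i. i \<in> M \<Longrightarrow> a i \<in> I) \<Longrightarrow> (\<lambda>p. \<Sum>i\<in>M. a i p) \<in> I"
  using torus.submodule_D(2)[OF sub]
  by (induction M rule: infinite_finite_induct) (simp_all add: torus_simps ideal_add)

text \<open>Conjugation by the unitary function \<open>circle_exp\<close>, whose inverse is its
  complex conjugate.\<close>

lemma ideal_twist:
  assumes "a \<in> I" shows "(\<lambda>(k, x). cis (2 * pi * (of_int k * \<theta>)) * a (k, x)) \<in> I"
proof -
  have e: "smooth_fun (\<lambda>t. circle_exp (abs_circle t))"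
    by (simp add: circle_exp.abs_eq smooth_fun_cis)
  let ?u = "monomial 0 circle_exp" and ?v = "monomial 0 (\<lambda>x. cnj (circle_exp x))"
  have u: "?u \<in> carrier torus" and v: "?v \<in> carrier torus"
    using e by (auto intro!: monomial_carrier smooth_fun_cnj)
  have twist: "circle_exp (rotate \<theta> k x) * a (k, x) * cnj (circle_exp x) = cis (2 * pi * (of_int k * \<theta>)) * a (k, x)" for k x
    unfolding circle_exp_rotate[of \<theta> k x, symmetric] by (simp add: mult_ac)
  have "(?u \<otimes>\<^bsub>torus\<^esub> a) \<otimes>\<^bsub>torus\<^esub> ?v = (\<lambda>(k, x). cis (2 * pi * (of_int k * \<theta>)) * a (k, x))"
    by (rule ext, rule prod.induct)
      (simp add: monomial_mult_right monomial_mult_left[OF ideal_carrier[OF assms]] rotate_0 twist)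
  moreover have "(?u \<otimes>\<^bsub>torus\<^esub> a) \<otimes>\<^bsub>torus\<^esub> ?v \<in> I" by (rule right[OF v left[OF u assms]])
  ultimately show ?thesis by simp
qed

lemma ideal_diagonal:
  assumes "finite F" "0 \<notin> F" "a \<in> I" "\<forall>k x. k \<notin> insert 0 F \<longrightarrow> a (k, x) = 0"
  shows "monomial 0 (\<lambda>x. a (0, x)) \<in> I"
  using assms
proof (induction F arbitrary: a rule: finite_induct)
  case empty
  then have "monomial 0 (\<lambda>x. a (0, x)) = a" by (auto simp: monomial_def fun_eq_iff)
  then show ?case using empty by simp
next
  case (insert j F)
  let ?e = "\<lambda>k. cis (2 * pi * (of_int k * \<theta>))"
  \<comment> \<open>The factor on component \<open>k\<close> is
    \<open>(?e k - ?e j) / (1 - ?e j)\<close>: it is 0 for \<open>k = j\<close> and 1 for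
    \<open>k = 0\<close>, as \<open>?e 0 = 1\<close>. Thus \<open>b\<close> loses component
    \<open>j\<close>, keeps component 0 and acquires no new one.\<close>
  define b where "b = (\<lambda>(k, x). 1 / (1 - ?e j) * (?e k * a (k, x) + (- ?e j) * a (k, x)))"
  have j: "?e j \<noteq> 1" using cis_2pi_int_mult_irrational[OF irrational, of j] insert.prems by simp
  have "(\<lambda>p. 1 / (1 - ?e j) * ((\<lambda>(k, x). ?e k * a (k, x)) p + (- ?e j) * a p)) \<in> I"
    by (intro ideal_smult ideal_add ideal_twist insert.prems)
  also have "(\<lambda>p. 1 / (1 - ?e j) * ((\<lambda>(k, x). ?e k * a (k, x)) p + (- ?e j) * a p)) = b"
    by (auto simp: b_def fun_eq_iff)
  finally have "b \<in> I" .
  moreover have "\<forall>k x. k \<notin> insert 0 F \<longrightarrow> b (k, x) = 0" using insert.prems by (auto simp: b_def)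
  ultimately have "monomial 0 (\<lambda>x. b (0, x)) \<in> I" using insert.IH insert.prems by simp
  moreover have "b (0, x) = a (0, x)" for x
    using j by (simp add: b_def divide_simps) (simp add: algebra_simps)
  ultimately show ?case by simp
qed

text \<open>Conjugation by a monomial of degree \<open>m\<close> translates a function along the
  orbits. Passing first to \<open>f * cnj f\<close> makes the summands nonnegative, so no
  cancellation can occur between translates.\<close>

lemma ideal_norm_sum:
  assumes f: "monomial 0 f \<in> I"
  shows "monomial 0 (\<lambda>x. \<Sum>m\<in>M. of_real ((cmod (f (rotate \<theta> m x)))\<^sup>2)) \<in> I"
proof -
  have "smooth_fun (fibre (monomial 0 f) 0)" by (rule torus_smooth[OF ideal_carrier[OF f]])
  then have "smooth_fun (\<lambda>t. f (abs_circle t))" by (simp add: monomial_def)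
  then have v: "monomial 0 (\<lambda>x. cnj (f x)) \<in> carrier torus"
    by (intro monomial_carrier smooth_fun_cnj)
  let ?c = "monomial 0 f \<otimes>\<^bsub>torus\<^esub> monomial 0 (\<lambda>x. cnj (f x))"
  have c: "?c \<in> I" by (rule right[OF v f])
  let ?U = "\<lambda>m. monomial m (\<lambda>x. 1)"
  have U: "?U m \<in> carrier torus" for m by (rule monomial_carrier[OF smooth_fun_const])
  have cU: "?c \<otimes>\<^bsub>torus\<^esub> ?U m \<in> I" for m by (rule right[OF U c])
  have norm_sq: "z * cnj z = (of_real (cmod z))\<^sup>2" for z
    using complex_norm_square[of z] by simp
  \<comment> \<open>Multiplying on the right by \<open>?U m\<close> shifts the degree by
    \<open>m\<close> and rotates the argument; \<open>?U (- m)\<close> on the left restores degree 0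
    and leaves the argument alone.\<close>
  have "?U (- m) \<otimes>\<^bsub>torus\<^esub> (?c \<otimes>\<^bsub>torus\<^esub> ?U m)
      = monomial 0 (\<lambda>x. of_real ((cmod (f (rotate \<theta> m x)))\<^sup>2))" for m
    by (rule ext, rule prod.induct)
      (simp add: monomial_mult_right monomial_mult_left[OF ideal_carrier[OF cU]] rotate_0,
        simp add: monomial_def norm_sq)
  then have "monomial 0 (\<lambda>x. of_real ((cmod (f (rotate \<theta> m x)))\<^sup>2)) \<in> I" for m
    using left[OF U cU, of "- m" m] by simp
  then have "(\<lambda>p. \<Sum>m\<in>M. monomial 0 (\<lambda>x. of_real ((cmod (f (rotate \<theta> m x)))\<^sup>2)) p) \<in> I"
    by (rule ideal_sum)
  moreover have "(\<lambda>p. \<Sum>m\<in>M. monomial 0 (\<lambda>x. of_real ((cmod (f (rotate \<theta> m x)))\<^sup>2)) p)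
      = monomial 0 (\<lambda>x. \<Sum>m\<in>M. of_real ((cmod (f (rotate \<theta> m x)))\<^sup>2))"
    by (auto simp: monomial_def fun_eq_iff)
  ultimately show ?thesis by simp
qed

text \<open>The nonvanishing set of \<open>f\<close> is open and, orbits being dense, meets every
  orbit; its translates therefore cover the circle. Compactness is applied on the line, to the
  interval \<open>{0..1}\<close>, which represents every point of the circle.\<close>

lemma orbit_cover:
  assumes f: "smooth_fun (\<lambda>t. f (abs_circle t))" and nz: "f y \<noteq> 0"
  obtains M where "finite M" "\<And>x. \<exists>m\<in>M. f (rotate \<theta> m x) \<noteq> 0"
proof -
  let ?g = "\<lambda>t. f (abs_circle t)"
  define U where "U m = {t. ?g (t + of_int m * \<theta>) \<noteq> 0}" for m
  have op: "open (U m)" for m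
    unfolding U_def
    by (rule open_Collect_neq[OF smooth_fun_continuous[OF smooth_fun_shift[OF f]] continuous_on_const])
  obtain s where s: "y = abs_circle s" by (rule circle_obtain)
  have "open (U 0)" "s \<in> U 0" using op[of 0] nz by (simp_all add: U_def s)
  then obtain e where e: "e > 0" "\<And>t. dist t s < e \<Longrightarrow> t \<in> U 0" by (metis open_dist)
  have "\<exists>m. t \<in> U m" for t
  proof -
    \<comment> \<open>Density of the numbers \<open>k * \<theta> - h\<close>, aimed at
      \<open>s - t\<close>, moves \<open>t\<close> to within \<open>e\<close> of \<open>s\<close>;
      the integer \<open>h\<close> disappears on the circle.\<close>
    obtain h k where hk: "\<bar>of_int k * \<theta> - of_int h - (s - t)\<bar> < e"
      using sequence_of_fractional_parts_is_dense[OF irrational e(1), of "s - t"] by metis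
    have "t + of_int k * \<theta> - of_int h \<in> U 0"
      by (rule e(2)) (use hk in \<open>simp add: dist_real_def algebra_simps\<close>)
    moreover have "abs_circle (t + of_int k * \<theta> - of_int h) = abs_circle (t + of_int k * \<theta>)"
      by (simp add: abs_circle_eq_iff)
    ultimately show ?thesis by (auto simp: U_def)
  qed
  then have "{0..1} \<subseteq> (\<Union>m\<in>UNIV. U m)" by blast
  then obtain M where M: "finite M" "{0..1} \<subseteq> (\<Union>m\<in>M. U m)"
    by (rule compactE_image[OF compact_Icc op]) blast
  have "\<exists>m\<in>M. f (rotate \<theta> m x) \<noteq> 0" for x
  proof -
    obtain t where t: "x = abs_circle t" by (rule circle_obtain)
    have x: "x = abs_circle (frac t)" by (simp add: t abs_circle_eq_iff frac_def)
    have "frac t \<in> {0..1}" by (simp add: frac_lt_1 less_imp_le)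
    then obtain m where "m \<in> M" "frac t \<in> U m" using M(2) by blast
    then show ?thesis by (auto simp: U_def x rotate_abs_circle)
  qed
  with M(1) show thesis by (rule that)
qed

lemma ideal_unit:
  assumes "I \<noteq> {\<zero>\<^bsub>torus\<^esub>}" shows "torus_unit \<in> I"
proof -
  obtain a where a: "a \<in> I" "a \<noteq> (\<lambda>p. 0)"
    using assms torus.submodule_D(2)[OF sub] by (auto simp: torus_simps)
  then obtain k x where kx: "a (k, x) \<noteq> 0" by (metis surj_pair)
  define b where "b = a \<otimes>\<^bsub>torus\<^esub> monomial (- k) (\<lambda>x. 1)"
  have b: "b \<in> I" unfolding b_def by (rule right[OF monomial_carrier[OF smooth_fun_const] a(1)])
  \<comment> \<open>Right multiplication by a monomial of degree \<open>- k\<close> moves component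
    \<open>k\<close> to component 0 and rotates the argument by \<open>- k\<close>; evaluating at
    \<open>rotate \<theta> k x\<close> recovers \<open>a (k, x)\<close>.\<close>
  have b0: "b (0, rotate \<theta> k x) \<noteq> 0"
    using kx by (simp add: b_def monomial_mult_right rotate_rotate rotate_0)
  obtain F where F: "finite F" "\<forall>k x. k \<notin> F \<longrightarrow> b (k, x) = 0"
    using ideal_carrier[OF b] by (rule torus_carrier_support)
  define f where "f = (\<lambda>x. b (0, x))"
  have f: "monomial 0 f \<in> I"
    unfolding f_def by (rule ideal_diagonal[of "F - {0}"]) (use F b in auto)
  have sf: "smooth_fun (\<lambda>t. f (abs_circle t))"
    unfolding f_def by (rule torus_smooth[OF ideal_carrier[OF b]])
  obtain M where M: "finite M" "\<And>x. \<exists>m\<in>M. f (rotate \<theta> m x) \<noteq> 0"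
    using orbit_cover[of f "rotate \<theta> k x", OF sf] b0 unfolding f_def by blast
  \<comment> \<open>Writing \<open>h\<close> as the embedding of a real sum reduces
    \<open>h x \<noteq> 0\<close> to positivity of that sum.\<close>
  define h where "h = (\<lambda>x. complex_of_real (\<Sum>m\<in>M. (cmod (f (rotate \<theta> m x)))\<^sup>2))"
  have h: "monomial 0 h \<in> I" using ideal_norm_sum[OF f, of M] by (simp add: h_def)
  have hnz: "h x \<noteq> 0" for x
  proof -
    obtain m where m: "m \<in> M" "f (rotate \<theta> m x) \<noteq> 0" using M(2) by blast
    have "(\<Sum>m\<in>M. (cmod (f (rotate \<theta> m x)))\<^sup>2) > 0"
      by (rule sum_pos2[OF M(1) m(1)]) (use m(2) in auto)
    then show ?thesis unfolding h_def of_real_eq_0_iff by linarith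
  qed
  \<comment> \<open>Smoothness of \<open>h\<close> is read off from membership of
    \<open>monomial 0 h\<close> in the carrier, so that its pointwise inverse is again an element of
    the algebra.\<close>
  have "smooth_fun (\<lambda>t. h (abs_circle t))"
    using torus_smooth[OF ideal_carrier[OF h], of 0] by (simp add: monomial_def)
  then have "monomial 0 (\<lambda>x. inverse (h x)) \<in> carrier torus"
    by (intro monomial_carrier smooth_fun_inverse hnz)
  from right[OF this h] have "monomial 0 h \<otimes>\<^bsub>torus\<^esub> monomial 0 (\<lambda>x. inverse (h x)) \<in> I" .
  moreover have "monomial 0 h \<otimes>\<^bsub>torus\<^esub> monomial 0 (\<lambda>x. inverse (h x)) = torus_unit"
    by (rule ext, rule prod.induct)
      (simp add: monomial_mult_right rotate_0, simp add: monomial_def torus_unit_def hnz)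
  ultimately show ?thesis by simp
qed

end

theorem theorem7p5p4:
  fixes \<theta> :: real
  assumes "\<theta> \<notin> \<rat>"
  shows "simple_born_algebra (noncommutative_torus \<theta>)"
proof -
  interpret rotation_algebra \<theta> .
  have "I = {\<zero>\<^bsub>torus\<^esub>} \<or> I = carrier torus" if I: "born_ideal torus I" for I
  proof (cases "I = {\<zero>\<^bsub>torus\<^esub>}")
    case False
    interpret torus_ideal \<theta> I
      by (rule torus_ideal.intro) (use I assms in \<open>auto simp: born_ideal_def closed_subspace_def\<close>)
    have "a \<in> I" if "a \<in> carrier torus" for a
      using left[OF that ideal_unit[OF False]] by (simp add: torus_unit_right)
    then show ?thesis using ideal_carrier by blast
  qed simp
  then show ?thesis
    unfolding simple_born_algebra_def
    using torus_self_induced born_ideal_zero born_ideal_carrier by blast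
qed

end
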